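(* Let $N\ge 1$, let $\Omega\subset\mathbb{R}^N$ be a bounded domain which is of class $C^{1,1}$ if $N\ge 2$, and let $1<q<p<\infty$. Let $m,a\in L^\gamma(\Omega)$ for some $\gamma>N$, with $m_+\not\equiv 0$, $a\not\equiv 0$. Assume that $m\ge 0$ a.e. in $\Omega$ and $\int_\Omega a\varphi_1^q\,dx>0$. Assume also, in addition to $1<q<p$, that $$(q-1)s^p+q s^{p-1}-(p-q)s+(q-p+1)\ge 0\quad\text{for all } s\ge 0.$$ Then for any $\lambda>\lambda_1(m)$ there exists $f\in C_0^\infty(\Omega)\setminus\{0\}$ satisfying $f\ge 0$ in $\Omega$ such that the problem $$-\Delta_p u=\lambda\,m(x)|u|^{p-2}u+\eta\,a(x)|u|^{q-2}u+f(x)\ \text{ in }\Omega,\qquad u=0\ \text{ on }\partial\Omega,$$ has no positive solution and no negative solution provided $\eta\ge 0$.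
   Context: Notation: $w_\pm=\max\{\pm w,0\}$; $\Delta_p u=\mathrm{div}(|\nabla u|^{p-2}\nabla u)$; $C_0^\infty(\Omega)$ is the set of smooth functions with compact support in $\Omega$. A solution is a function $u\in W_0^{1,p}(\Omega)$ with $\int_\Omega|\nabla u|^{p-2}\nabla u\cdot\nabla\xi\,dx=\lambda\int_\Omega m|u|^{p-2}u\xi\,dx+\eta\int_\Omega a|u|^{q-2}u\xi\,dx+\int_\Omega f\xi\,dx$ for all $\xi\in W_0^{1,p}(\Omega)$. Solutions belong to $C^1(\overline\Omega)$; positive (negative) means $u>0$ ($u<0$) in $\Omega$. The first positive eigenvalue is $$\lambda_1(m)=\inf\left\{\frac{\int_\Omega|\nabla u|^p\,dx}{\int_\Omega m|u|^p\,dx}:\ u\in W_0^{1,p}(\Omega),\ \int_\Omega m|u|^p\,dx>0\right\};$$ it is attained, and $\varphi_1$ denotes its nonnegative minimizer normalized by $\|\varphi_1\|_\infty=1$ (it is unique and positive in $\Omega$). *)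

theory Defs
  imports "HOL-Analysis.Analysis" "HOL-Probability.Essential_Supremum"
begin

text \<open>
  The space \<open>R^N\<close> is an arbitrary Euclidean space \<open>'a\<close> with \<open>N = DIM('a) \<ge> 1\<close>. Functions on \<open>\<Omega>\<close> are
  total functions on \<open>'a\<close>; all notions below only depend on their values on \<open>\<Omega>\<close>, and, except for
  the pointwise sign of a solution, only on their class modulo null sets.
\<close>

primrec C_k :: "nat \<Rightarrow> ('a::euclidean_space \<Rightarrow> real) \<Rightarrow> bool" where
  "C_k 0 f \<longleftrightarrow> continuous_on UNIV f"
| "C_k (Suc k) f \<longleftrightarrow> (\<forall>x. f differentiable (at x)) \<and>
     (\<forall>i\<in>Basis. C_k k (\<lambda>x. frechet_derivative f (at x) i))"

text \<open>Elements of \<open>C_0^\<infinity>(\<Omega>)\<close> are represented by their extension by zero to the whole space.\<close>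

definition C0_inf :: "'a::euclidean_space set \<Rightarrow> ('a \<Rightarrow> real) set" where
  "C0_inf \<Omega> = {\<phi>. (\<forall>k. C_k k \<phi>) \<and>
     compact (closure (support_on UNIV \<phi>)) \<and> closure (support_on UNIV \<phi>) \<subseteq> \<Omega>}"

definition Lp_space :: "'a::euclidean_space set \<Rightarrow> real \<Rightarrow>
    ('a \<Rightarrow> 'b::{real_normed_vector, second_countable_topology}) set" where
  "Lp_space \<Omega> p = {u. u \<in> borel_measurable (lebesgue_on \<Omega>) \<and>
     integrable (lebesgue_on \<Omega>) (\<lambda>x. norm (u x) powr p)}"

definition locally_integrable :: "'a::euclidean_space set \<Rightarrow> ('a \<Rightarrow> 'b::euclidean_space) \<Rightarrow> bool" where
  "locally_integrable \<Omega> u \<longleftrightarrow> (\<forall>K. compact K \<and> K \<subseteq> \<Omega> \<longrightarrow> set_integrable lebesgue K u)"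

definition has_weak_gradient ::
    "'a::euclidean_space set \<Rightarrow> ('a \<Rightarrow> real) \<Rightarrow> ('a \<Rightarrow> 'a) \<Rightarrow> bool" where
  "has_weak_gradient \<Omega> u g \<longleftrightarrow> locally_integrable \<Omega> u \<and> locally_integrable \<Omega> g \<and>
     (\<forall>\<phi>\<in>C0_inf \<Omega>. \<forall>i\<in>Basis.
        (LINT x|lebesgue_on \<Omega>. u x * frechet_derivative \<phi> (at x) i)
        = - (LINT x|lebesgue_on \<Omega>. (g x \<bullet> i) * \<phi> x))"

text \<open>A weak gradient is unique up to null sets, so the choice made here does not affect integrals.\<close>

definition weak_grad :: "'a::euclidean_space set \<Rightarrow> ('a \<Rightarrow> real) \<Rightarrow> 'a \<Rightarrow> 'a" where
  "weak_grad \<Omega> u = (SOME g. has_weak_gradient \<Omega> u g)"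

definition W1p :: "'a::euclidean_space set \<Rightarrow> real \<Rightarrow> ('a \<Rightarrow> real) set" where
  "W1p \<Omega> p = {u. u \<in> Lp_space \<Omega> p \<and> (\<exists>g\<in>Lp_space \<Omega> p. has_weak_gradient \<Omega> u g)}"

definition W1p_norm :: "'a::euclidean_space set \<Rightarrow> real \<Rightarrow> ('a \<Rightarrow> real) \<Rightarrow> real" where
  "W1p_norm \<Omega> p u = ((LINT x|lebesgue_on \<Omega>. \<bar>u x\<bar> powr p)
      + (LINT x|lebesgue_on \<Omega>. norm (weak_grad \<Omega> u x) powr p)) powr (1 / p)"

definition W01p :: "'a::euclidean_space set \<Rightarrow> real \<Rightarrow> ('a \<Rightarrow> real) set" where
  "W01p \<Omega> p = {u \<in> W1p \<Omega> p. \<forall>\<epsilon>>0. \<exists>\<phi>\<in>C0_inf \<Omega>. W1p_norm \<Omega> p (\<lambda>x. u x - \<phi> x) < \<epsilon>}"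

text \<open>
  Near each boundary point, \<open>\<Omega>\<close> is the strict epigraph, in some direction \<open>\<nu>\<close>, of a function with
  Lipschitz continuous gradient. A function of \<open>N - 1\<close> variables is encoded as a function \<open>h\<close> on the
  whole space that only depends on the projection onto the hyperplane orthogonal to \<open>\<nu>\<close>.
\<close>

definition C11_boundary :: "'a::euclidean_space set \<Rightarrow> bool" where
  "C11_boundary \<Omega> \<longleftrightarrow> (\<forall>x\<^sub>0\<in>frontier \<Omega>. \<exists>r>0. \<exists>\<nu> h G L.
     norm \<nu> = 1 \<and>
     (\<forall>x. h x = h (x - (x \<bullet> \<nu>) *\<^sub>R \<nu>)) \<and>
     (\<forall>x. GDERIV h x :> G x) \<and> L-lipschitz_on UNIV G \<and>
     \<Omega> \<inter> ball x\<^sub>0 r = {x \<in> ball x\<^sub>0 r. x \<bullet> \<nu> > h x})"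

definition bounded_domain :: "'a::euclidean_space set \<Rightarrow> bool" where
  "bounded_domain \<Omega> \<longleftrightarrow> open \<Omega> \<and> connected \<Omega> \<and> \<Omega> \<noteq> {} \<and> bounded \<Omega>"

definition lambda1 :: "'a::euclidean_space set \<Rightarrow> real \<Rightarrow> ('a \<Rightarrow> real) \<Rightarrow> real" where
  "lambda1 \<Omega> p m =
     Inf {(LINT x|lebesgue_on \<Omega>. norm (weak_grad \<Omega> u x) powr p)
            / (LINT x|lebesgue_on \<Omega>. m x * \<bar>u x\<bar> powr p) | u.
          u \<in> W01p \<Omega> p \<and> (LINT x|lebesgue_on \<Omega>. m x * \<bar>u x\<bar> powr p) > 0}"

definition first_eigenfunction ::
    "'a::euclidean_space set \<Rightarrow> real \<Rightarrow> ('a \<Rightarrow> real) \<Rightarrow> ('a \<Rightarrow> real) \<Rightarrow> bool" where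
  "first_eigenfunction \<Omega> p m \<phi> \<longleftrightarrow>
     \<phi> \<in> W01p \<Omega> p \<and> (LINT x|lebesgue_on \<Omega>. m x * \<bar>\<phi> x\<bar> powr p) > 0 \<and>
     (LINT x|lebesgue_on \<Omega>. norm (weak_grad \<Omega> \<phi> x) powr p)
       / (LINT x|lebesgue_on \<Omega>. m x * \<bar>\<phi> x\<bar> powr p) = lambda1 \<Omega> p m \<and>
     (AE x in lebesgue_on \<Omega>. \<phi> x \<ge> 0) \<and>
     esssup (lebesgue_on \<Omega>) (\<lambda>x. ereal \<bar>\<phi> x\<bar>) = 1"

definition is_solution :: "'a::euclidean_space set \<Rightarrow> real \<Rightarrow> real \<Rightarrow> ('a \<Rightarrow> real) \<Rightarrow> ('a \<Rightarrow> real) \<Rightarrow>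
    real \<Rightarrow> real \<Rightarrow> ('a \<Rightarrow> real) \<Rightarrow> ('a \<Rightarrow> real) \<Rightarrow> bool" where
  "is_solution \<Omega> p q m a lam \<eta> f u \<longleftrightarrow> u \<in> W01p \<Omega> p \<and>
     (\<forall>\<xi>\<in>W01p \<Omega> p.
        (LINT x|lebesgue_on \<Omega>.
           norm (weak_grad \<Omega> u x) powr (p - 2) * (weak_grad \<Omega> u x \<bullet> weak_grad \<Omega> \<xi> x))
        = lam * (LINT x|lebesgue_on \<Omega>. m x * \<bar>u x\<bar> powr (p - 2) * u x * \<xi> x)
          + \<eta> * (LINT x|lebesgue_on \<Omega>. a x * \<bar>u x\<bar> powr (q - 2) * u x * \<xi> x)
          + (LINT x|lebesgue_on \<Omega>. f x * \<xi> x))"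

text \<open>
  Regularity theory gives every solution a continuous (even \<open>C^1\<close> up to the boundary)
  representative. Its pointwise sign is the one meant below, whence the continuity requirement,
  which only selects that representative.
\<close>

definition is_positive_solution :: "'a::euclidean_space set \<Rightarrow> real \<Rightarrow> real \<Rightarrow> ('a \<Rightarrow> real) \<Rightarrow>
    ('a \<Rightarrow> real) \<Rightarrow> real \<Rightarrow> real \<Rightarrow> ('a \<Rightarrow> real) \<Rightarrow> ('a \<Rightarrow> real) \<Rightarrow> bool" where
  "is_positive_solution \<Omega> p q m a lam \<eta> f u \<longleftrightarrow>
     is_solution \<Omega> p q m a lam \<eta> f u \<and> continuous_on \<Omega> u \<and> (\<forall>x\<in>\<Omega>. u x > 0)"

definition is_negative_solution :: "'a::euclidean_space set \<Rightarrow> real \<Rightarrow> real \<Rightarrow> ('a \<Rightarrow> real) \<Rightarrow>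
    ('a \<Rightarrow> real) \<Rightarrow> real \<Rightarrow> real \<Rightarrow> ('a \<Rightarrow> real) \<Rightarrow> ('a \<Rightarrow> real) \<Rightarrow> bool" where
  "is_negative_solution \<Omega> p q m a lam \<eta> f u \<longleftrightarrow>
     is_solution \<Omega> p q m a lam \<eta> f u \<and> continuous_on \<Omega> u \<and> (\<forall>x\<in>\<Omega>. u x < 0)"

end

theory Submission
  imports Defs
begin

text \<open>
  Write \<open>\<lambda>\<^sub>1\<close> for the first eigenvalue and \<open>\<phi>\<^sub>1\<close> for the first eigenfunction. Up to its sign, a positive or
  negative solution is a positive function \<open>v\<close> which, away from the support of \<open>f\<close>, solves
  \<open>- \<Delta>\<^sub>p v = lam m v\<^sup>p\<^sup>-\<^sup>1 + \<eta> a v\<^sup>q\<^sup>-\<^sup>1\<close>. So it suffices to find a compact set \<open>K \<subseteq> \<Omega>\<close> such that no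
  positive \<open>v\<close> solves this equation when tested with functions supported in \<open>K\<close>; for \<open>f\<close> one then
  takes any smooth bump in \<open>\<Omega> - K\<close>, which is a nonempty open set.

  The set \<open>K\<close> and a matching family of functions \<open>\<psi>\<close> come from a variational problem. Fix \<open>\<Lambda>\<close>
  between \<open>\<lambda>\<^sub>1\<close> and \<open>lam\<close>, and minimize \<open>\<integral> |\<nabla>w|\<^sup>p - \<Lambda> \<integral> m |w|\<^sup>p\<close> over the functions with
  \<open>0 \<le> w \<le> \<phi>\<^sub>1\<close> that vanish outside \<open>K\<close>. Going from \<open>\<psi>\<close> to \<open>\<psi> - t \<zeta>\<close> with \<open>\<zeta> \<ge> 0\<close> respects the upper
  obstacle \<open>\<phi>\<^sub>1\<close>, hence a minimizer satisfies \<open>- \<Delta>\<^sub>p \<psi> \<le> \<Lambda> m \<psi>\<^sup>p\<^sup>-\<^sup>1\<close>.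
  Near-minimizers satisfy this inequality up to an error as small as desired, which suffices below
  (\<open>one_sided_euler_lagrange\<close>). If \<open>K\<close> is large, then near-minimizers are close to \<open>\<phi>\<^sub>1\<close>
  (\<open>admissible_approximation\<close>, \<open>near_minimal_Lp_lim\<close>), and therefore \<open>\<integral> m \<psi>\<^sup>p\<close> stays away from \<open>0\<close> and
  \<open>\<integral> a \<psi>\<^sup>q \<ge> 0\<close>. This closeness rests on uniform convexity of \<open>L\<^sup>p\<close> and the Poincare inequality.

  The algebraic hypothesis on \<open>p\<close> and \<open>q\<close> yields a generalized Picone inequality,
  \<open>|\<nabla>v|\<^sup>p\<^sup>-\<^sup>2 \<nabla>v \<bullet> \<nabla>(\<psi>\<^sup>q / v\<^sup>q\<^sup>-\<^sup>1) \<le> |\<nabla>\<psi>|\<^sup>p\<^sup>-\<^sup>2 \<nabla>\<psi> \<bullet> \<nabla>(\<psi>\<^sup>q\<^sup>-\<^sup>p\<^sup>+\<^sup>1 v\<^sup>p\<^sup>-\<^sup>q)\<close>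
  (\<open>picone_vector\<close>). Testing the equation for \<open>v\<close> with \<open>\<psi>\<^sup>q / v\<^sup>q\<^sup>-\<^sup>1\<close> and the inequality for \<open>\<psi>\<close> with
  \<open>\<psi>\<^sup>q\<^sup>-\<^sup>p\<^sup>+\<^sup>1 v\<^sup>p\<^sup>-\<^sup>q\<close> gives
  \<open>lam \<integral> m \<psi>\<^sup>q v\<^sup>p\<^sup>-\<^sup>q + \<eta> \<integral> a \<psi>\<^sup>q \<le> \<Lambda> \<integral> m \<psi>\<^sup>q v\<^sup>p\<^sup>-\<^sup>q\<close> up to a small error,
  which is absurd, since \<open>v\<close> is bounded below by a positive constant on \<open>K\<close>. To have
  admissible test functions, \<open>\<psi>\<close> is replaced by \<open>\<psi> + e\<close> for a small constant \<open>e\<close>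
  (\<open>picone_regularized\<close>, \<open>W0_powr_product\<close>), which costs further errors that vanish with \<open>e\<close>; the
  estimate is \<open>no_positive_supersolution\<close>.

  The Sobolev space enters through the relation \<open>W0\<close>, the closure in \<open>L\<^sup>p\<close> of the pairs consisting of
  a continuously differentiable function with compact support and its gradient. Mollification and the fundamental lemma
  of the calculus of variations identify it with \<open>W01p\<close> and \<open>weak_grad\<close> (\<open>W01p_imp_W0\<close>,
  \<open>W0_imp_W01p\<close>), and the calculus needed, in particular the chain rule \<open>W0_chain\<close>, passes to the limit
  from the smooth case.
\<close>

section \<open>Pointwise inequalities\<close>

text \<open>
  As a function of the exponent, a power is an exponential and lies above its tangent. If exponents
  \<open>\<alpha>\<close> are averaged with mean \<open>\<beta>\<close>, the logarithms cancel, which gives weighted inequalities between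
  arithmetic and geometric means.
\<close>

lemma powr_ge_tangent_in_exponent:
  fixes s \<alpha> \<beta> :: real
  assumes "s > 0"
  shows "s powr \<alpha> \<ge> s powr \<beta> * (1 + (\<alpha> - \<beta>) * ln s)"
proof -
  have "s powr \<alpha> = s powr \<beta> * exp ((\<alpha> - \<beta>) * ln s)"
    using assms by (simp add: powr_def exp_add [symmetric] algebra_simps)
  moreover have "exp ((\<alpha> - \<beta>) * ln s) \<ge> 1 + (\<alpha> - \<beta>) * ln s"
    by (rule exp_ge_add_one_self)
  ultimately show ?thesis
    by (simp add: mult_left_mono)
qed

text \<open>
  After division by \<open>c powr p\<close> this is the previous lemma for the exponents \<open>p\<close> and \<open>0\<close>, with weights \<open>1\<close>
  and \<open>p - 1\<close> and mean exponent \<open>1\<close>.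
\<close>

lemma scalar_young_strict:
  fixes a c p :: real
  assumes "1 < p" "0 \<le> a" "0 < c" "a \<noteq> c"
  shows "p * c powr (p - 1) * a < (p - 1) * c powr p + a powr p"
proof (cases "a = 0")
  case True
  then show ?thesis using assms by simp
next
  case False
  define s where "s = a / c"
  have s: "s > 0" "s \<noteq> 1" using assms False by (auto simp: s_def)
  have "s powr p \<ge> s * (1 + (p - 1) * ln s)"
    using powr_ge_tangent_in_exponent[OF s(1), of 1 p] s by simp
  moreover have "1 > s * (1 - ln s)"
  proof -
    have "ln (1/s) < 1/s - 1"
      using ln_le_minus_one[of "1/s"] ln_eq_minus_one[of "1/s"] s by (cases "ln (1/s) = 1/s - 1") auto
    hence "1 - ln s < 1/s" using s by (simp add: ln_div)
    hence "s * (1 - ln s) < s * (1/s)" using s by (intro mult_strict_left_mono) auto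
    thus ?thesis using s by simp
  qed
  ultimately have "(p - 1) * (s * (1 - ln s)) + s * (1 + (p - 1) * ln s) < (p - 1) * 1 + s powr p"
    using assms by (intro add_less_le_mono mult_strict_left_mono) auto
  hence *: "p * s < (p - 1) + s powr p" by (simp add: algebra_simps)
  have c: "c powr p > 0" "c powr p = c powr (p - 1) * c"
    using assms by (auto simp: powr_diff)
  have a: "a = s * c" using assms by (simp add: s_def)
  have "c powr p * (p * s) < c powr p * ((p - 1) + s powr p)"
    using * c by (intro mult_strict_left_mono) auto
  also have "c powr p * ((p - 1) + s powr p) = (p - 1) * c powr p + a powr p"
    by (simp add: a powr_mult algebra_simps)
  also have "c powr p * (p * s) = p * c powr (p - 1) * a"
    by (simp add: a c(2))
  finally show ?thesis .
qed

lemma scalar_young: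
  fixes a c p :: real
  assumes "1 < p" "0 \<le> a" "0 \<le> c"
  shows "p * c powr (p - 1) * a \<le> (p - 1) * c powr p + a powr p"
proof (cases "c = 0 \<or> a = c")
  case True
  moreover have "p * c powr (p - 1) * c = (p - 1) * c powr p + c powr p" if "c > 0"
    using that by (simp add: powr_diff algebra_simps)
  ultimately show ?thesis using assms by fastforce
next
  case False
  then show ?thesis using scalar_young_strict[of p a c] assms by auto
qed

lemma norm_powr_add_le:
  fixes x y :: "'b::real_normed_vector"
  assumes "0 \<le> p"
  shows "norm (x + y) powr p \<le> 2 powr p * (norm x powr p + norm y powr p)"
proof -
  have "norm (x + y) \<le> 2 * max (norm x) (norm y)"
    using norm_triangle_ineq[of x y] by linarith
  hence "norm (x + y) powr p \<le> (2 * max (norm x) (norm y)) powr p"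
    using assms by (intro powr_mono2) auto
  also have "\<dots> = 2 powr p * max (norm x) (norm y) powr p"
    by (simp add: powr_mult)
  also have "\<dots> \<le> 2 powr p * (norm x powr p + norm y powr p)"
    by (intro mult_left_mono) (auto simp: max_def)
  finally show ?thesis .
qed

text \<open>
  For small \<open>\<tau>\<close> the first factor is close to \<open>1\<close>, so perturbing \<open>x\<close> increases the power of its norm by
  an arbitrarily small fraction plus a multiple of the power of the norm of the perturbation.
\<close>

lemma norm_powr_add_le_weighted:
  fixes x y :: "'b::real_normed_vector"
  assumes "1 < p" "0 < \<tau>" "\<tau> < 1"
  shows "norm (x + y) powr p \<le> (1 - \<tau>) powr (1 - p) * norm x powr p + \<tau> powr (1 - p) * norm y powr p"
proof -
  define u v where "u = norm x / (1 - \<tau>)" and "v = norm y / \<tau>"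
  define c where "c = norm x + norm y"
  have uv: "u \<ge> 0" "v \<ge> 0" "c \<ge> 0" using assms by (auto simp: u_def v_def c_def)
  have c: "c = (1 - \<tau>) * u + \<tau> * v" using assms by (simp add: c_def u_def v_def)
  have cc: "c powr (p - 1) * c = c powr p"
    using uv by (cases "c = 0") (auto simp: powr_diff)
  have "(1 - \<tau>) * (p * c powr (p - 1) * u) + \<tau> * (p * c powr (p - 1) * v)
     \<le> (1 - \<tau>) * ((p - 1) * c powr p + u powr p) + \<tau> * ((p - 1) * c powr p + v powr p)"
    using assms uv by (intro add_mono mult_left_mono scalar_young) auto
  moreover have "(1 - \<tau>) * (p * c powr (p - 1) * u) + \<tau> * (p * c powr (p - 1) * v)
      = p * (c powr (p - 1) * ((1 - \<tau>) * u + \<tau> * v))"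
    by (simp add: algebra_simps)
  ultimately have "p * c powr p \<le> (1 - \<tau>) * ((p - 1) * c powr p + u powr p) + \<tau> * ((p - 1) * c powr p + v powr p)"
    by (simp add: c[symmetric] cc)
  hence *: "c powr p \<le> (1 - \<tau>) * u powr p + \<tau> * v powr p"
    by (simp add: algebra_simps)
  have "norm (x + y) powr p \<le> c powr p"
    unfolding c_def using assms by (intro powr_mono2 norm_triangle_ineq) auto
  also note *
  also have "(1 - \<tau>) * u powr p = (1 - \<tau>) powr (1 - p) * norm x powr p"
    using assms by (simp add: u_def powr_divide powr_diff)
  also have "\<tau> * v powr p = \<tau> powr (1 - p) * norm y powr p"
    using assms by (simp add: v_def powr_divide powr_diff)
  finally show ?thesis .
qed

text \<open>
  The nonlinearity in the weak form of the \<open>p\<close>-Laplacian. Since \<open>0 powr (p - 2) = 0\<close>, it also has its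
  continuous value at \<open>0\<close> when \<open>1 < p < 2\<close>.
\<close>

definition pflux :: "real \<Rightarrow> 'b::real_inner \<Rightarrow> 'b" where
  "pflux p x = norm x powr (p - 2) *\<^sub>R x"

lemma pflux_zero [simp]: "pflux p 0 = 0"
  by (simp add: pflux_def)

lemma norm_pflux: "norm (pflux p x) = norm x powr (p - 1)"
proof (cases "x = 0")
  case False
  have "norm x powr (p - 1) = norm x powr (p - 2 + 1)" by simp
  also have "\<dots> = norm x powr (p - 2) * norm x"
    using False by (subst powr_add) simp
  finally show ?thesis by (simp add: pflux_def)
qed simp

lemma pflux_inner_self: "pflux p x \<bullet> x = norm x powr p"
proof (cases "x = 0")
  case False
  have "norm x powr p = norm x powr (p - 2 + 2)" by simp
  also have "\<dots> = norm x powr (p - 2) * (norm x)\<^sup>2"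
    using False by (subst powr_add) simp
  finally show ?thesis by (simp add: pflux_def power2_norm_eq_inner)
qed simp

lemma pflux_scaleR: "\<rho> \<ge> 0 \<Longrightarrow> pflux p (\<rho> *\<^sub>R x) = \<rho> powr (p - 1) *\<^sub>R pflux p x"
proof (cases "\<rho> = 0")
  case False
  assume "\<rho> \<ge> 0"
  moreover have "\<rho> powr (p - 1) = \<rho> powr (p - 2) * \<rho>"
  proof -
    have "\<rho> powr (p - 1) = \<rho> powr (p - 2 + 1)" by simp
    also have "\<dots> = \<rho> powr (p - 2) * \<rho>"
      using False \<open>\<rho> \<ge> 0\<close> by (subst powr_add) simp
    finally show ?thesis .
  qed
  ultimately show ?thesis by (simp add: pflux_def powr_mult algebra_simps)
qed simp

lemma pflux_uminus: "pflux p (- x) = - pflux p x"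
  by (simp add: pflux_def)

lemma pflux_inner_le:
  "\<bar>pflux p x \<bullet> y\<bar> \<le> norm x powr (p - 1) * norm y"
  using Cauchy_Schwarz_ineq2[of "pflux p x" y] by (simp add: norm_pflux)

lemma powr_pm1_mult_le:
  fixes a b p :: real
  assumes "1 < p" "0 \<le> a" "0 \<le> b"
  shows "a powr (p - 1) * b \<le> a powr p + b powr p"
proof -
  have "p * (a powr (p - 1) * b) \<le> (p - 1) * a powr p + b powr p"
    using scalar_young[of p b a] assms by (simp add: algebra_simps)
  also have "\<dots> \<le> p * (a powr p + b powr p)"
    using assms mult_right_mono[OF less_imp_le[OF assms(1)] powr_ge_zero[of b p]] powr_ge_zero[of a p]
    unfolding left_diff_distrib distrib_left by linarith
  finally show ?thesis using assms by simp
qed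

text \<open>
  The vector \<open>p *\<^sub>R pflux p y\<close> is the gradient at \<open>y\<close> of the convex function \<open>norm y powr p\<close>.
\<close>

lemma norm_powr_ge_pflux_tangent:
  fixes x y :: "'b::real_inner"
  assumes "1 < p"
  shows "p * (pflux p y \<bullet> (x - y)) \<le> norm x powr p - norm y powr p"
proof -
  have "p * (pflux p y \<bullet> x) \<le> p * (norm y powr (p - 1) * norm x)"
    using pflux_inner_le[of p y x] assms by (intro mult_left_mono) auto
  also have "\<dots> \<le> (p - 1) * norm y powr p + norm x powr p"
    using scalar_young[of p "norm x" "norm y"] assms by (simp add: algebra_simps)
  finally show ?thesis
    by (simp add: inner_diff_right pflux_inner_self algebra_simps)
qed

lemma continuous_pflux:
  assumes "1 < p"
  shows "continuous_on UNIV (pflux p :: 'b::real_inner \<Rightarrow> 'b)"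
  unfolding continuous_on_eq_continuous_at[OF open_UNIV]
proof safe
  fix x :: 'b
  show "isCont (pflux p) x"
  proof (cases "x = 0")
    case True
    have "((\<lambda>y::'b. norm y powr (p - 1)) \<longlongrightarrow> norm (0::'b) powr (p - 1)) (at 0)"
      using assms by (intro tendsto_powr' tendsto_intros) auto
    hence "((\<lambda>y::'b. norm (pflux p y)) \<longlongrightarrow> 0) (at 0)"
      using assms by (simp add: norm_pflux)
    thus ?thesis using True by (simp add: isCont_def tendsto_norm_zero_iff)
  next
    case False
    thus ?thesis unfolding pflux_def
      by (intro continuous_intros) auto
  qed
qed

text \<open>
  Vectors of equal norm are separated by the parallelogram law, vectors of different norm by strict
  convexity of the scalar power.
\<close>

lemma norm_powr_midpoint_strict:
  fixes x y :: "'b::real_inner"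
  assumes "1 < p" "x \<noteq> y"
  shows "norm ((x + y) /\<^sub>R 2) powr p < (norm x powr p + norm y powr p) / 2"
proof (cases "norm x = norm y")
  case True
  have "(norm (x + y))\<^sup>2 + (norm (x - y))\<^sup>2 = 2 * (norm x)\<^sup>2 + 2 * (norm y)\<^sup>2"
    by (simp add: power2_norm_eq_inner algebra_simps)
  moreover have "(norm (x - y))\<^sup>2 > 0" using assms by simp
  ultimately have "(norm (x + y))\<^sup>2 < 2 * (norm x)\<^sup>2 + 2 * (norm y)\<^sup>2" by linarith
  hence "(norm (x + y))\<^sup>2 < (2 * norm x)\<^sup>2" using True by (simp add: power_mult_distrib)
  hence "norm (x + y) < 2 * norm x" by (rule power_less_imp_less_base) simp
  hence "norm ((x + y) /\<^sub>R 2) powr p < norm x powr p"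
    using assms by (intro powr_less_mono2) auto
  thus ?thesis using True by simp
next
  case False
  define a b where "a = norm x" and "b = norm y"
  define c where "c = (a + b) / 2"
  have ab: "a \<ge> 0" "b \<ge> 0" "a \<noteq> b" using False by (auto simp: a_def b_def)
  hence c: "c > 0" "a \<noteq> c" "b \<noteq> c" by (auto simp: c_def)
  have "p * c powr (p - 1) * a + p * c powr (p - 1) * b
     < ((p - 1) * c powr p + a powr p) + ((p - 1) * c powr p + b powr p)"
    using assms ab c by (intro add_strict_mono scalar_young_strict) auto
  moreover have "p * c powr (p - 1) * a + p * c powr (p - 1) * b = 2 * p * c powr p"
  proof -
    have "p * c powr (p - 1) * a + p * c powr (p - 1) * b = 2 * p * (c powr (p - 1) * c)"
      by (simp add: c_def algebra_simps)
    thus ?thesis using c by (simp add: powr_diff)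
  qed
  ultimately have "c powr p < (a powr p + b powr p) / 2" by (simp add: algebra_simps)
  moreover have "norm ((x + y) /\<^sub>R 2) powr p \<le> c powr p"
    using assms norm_triangle_ineq[of x y] by (intro powr_mono2) (auto simp: c_def a_def b_def)
  ultimately show ?thesis by (simp add: a_def b_def)
qed

lemma norm_powr_midpoint:
  fixes x y :: "'b::real_inner"
  assumes "1 < p"
  shows "norm ((x + y) /\<^sub>R 2) powr p \<le> (norm x powr p + norm y powr p) / 2"
proof (cases "x = y")
  case True
  then show ?thesis by (simp add: scaleR_2 [symmetric])
next
  case False
  then show ?thesis using norm_powr_midpoint_strict[OF assms False] by simp
qed

text \<open>
  Both sides scale alike, so it suffices to compare them where the larger norm is \<open>1\<close>, which in finite
  dimension is a compact set of pairs.
\<close>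

lemma homogeneous_inequality:
  fixes Q R :: "'b::real_normed_vector \<Rightarrow> 'b \<Rightarrow> real"
  assumes Q: "\<And>\<rho> x y. \<rho> > 0 \<Longrightarrow> Q (\<rho> *\<^sub>R x) (\<rho> *\<^sub>R y) = \<rho> powr p * Q x y"
    and R: "\<And>\<rho> x y. \<rho> > 0 \<Longrightarrow> R (\<rho> *\<^sub>R x) (\<rho> *\<^sub>R y) = \<rho> powr p * R x y"
    and zero: "Q 0 0 \<le> R 0 0"
    and unit: "\<And>x y. norm x \<le> 1 \<Longrightarrow> norm y \<le> 1 \<Longrightarrow> norm x = 1 \<or> norm y = 1 \<Longrightarrow> Q x y \<le> R x y"
  shows "Q x y \<le> R x y"
proof (cases "x = 0 \<and> y = 0")
  case True
  then show ?thesis using zero by simp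
next
  case False
  define \<rho> where "\<rho> = max (norm x) (norm y)"
  have \<rho>: "\<rho> > 0" using False by (auto simp: \<rho>_def less_max_iff_disj)
  have "Q (x /\<^sub>R \<rho>) (y /\<^sub>R \<rho>) \<le> R (x /\<^sub>R \<rho>) (y /\<^sub>R \<rho>)"
    using \<rho> by (intro unit) (auto simp: \<rho>_def field_simps max_def)
  hence "\<rho> powr p * Q (x /\<^sub>R \<rho>) (y /\<^sub>R \<rho>) \<le> \<rho> powr p * R (x /\<^sub>R \<rho>) (y /\<^sub>R \<rho>)"
    by (intro mult_left_mono) auto
  thus ?thesis using \<rho> by (simp add: Q[symmetric] R[symmetric])
qed

text \<open>
  A quantitative form of strict convexity, valid for all \<open>p > 1\<close> alike: among normalized pairs
  that are not close to each other, the convexity deficit has a positive minimum.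
\<close>

lemma norm_powr_uniformly_convex:
  assumes "1 < p" "0 < \<epsilon>"
  obtains C where "C > 0" "\<And>x y :: 'b::euclidean_space.
     norm (x - y) powr p \<le> \<epsilon> * (norm x powr p + norm y powr p)
       + C * ((norm x powr p + norm y powr p) / 2 - norm ((x + y) /\<^sub>R 2) powr p)"
proof -
  define D where "D = (\<lambda>x y :: 'b. (norm x powr p + norm y powr p) / 2 - norm ((x + y) /\<^sub>R 2) powr p)"
  define S where "S = (cball 0 1 \<times> cball (0::'b) 1) \<inter> {z. norm (fst z - snd z) powr p \<ge> \<epsilon>}"
  have "closed {z::'b \<times> 'b. norm (fst z - snd z) powr p \<ge> \<epsilon>}"
    using assms by (intro closed_Collect_le continuous_intros continuous_on_powr') auto
  hence "compact S"
    unfolding S_def by (intro compact_Int_closed compact_Times) auto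
  have cont: "continuous_on S (\<lambda>z. D (fst z) (snd z))"
    unfolding D_def using assms by (intro continuous_intros continuous_on_powr') auto
  have D0: "D x y \<ge> 0" for x y
    using norm_powr_midpoint[of p x y] assms by (simp add: D_def)
  obtain d where d: "d > 0" "\<And>x y. (x, y) \<in> S \<Longrightarrow> d \<le> D x y"
  proof (cases "S = {}")
    case True
    then show ?thesis using that[of 1] by auto
  next
    case False
    then obtain z where z: "z \<in> S" "\<And>w. w \<in> S \<Longrightarrow> D (fst z) (snd z) \<le> D (fst w) (snd w)"
      using continuous_attains_inf[OF \<open>compact S\<close> _ cont] by blast
    have "fst z \<noteq> snd z" using z(1) assms by (auto simp: S_def)
    hence "D (fst z) (snd z) > 0"
      using norm_powr_midpoint_strict[of p "fst z" "snd z"] assms by (simp add: D_def)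
    thus ?thesis using that z(2) by (metis fst_conv snd_conv)
  qed
  \<comment> \<open>Normalized vectors have distance at most \<open>2\<close>.\<close>
  define C where "C = 2 powr p / d"
  have "C > 0" using d by (simp add: C_def)
  moreover have "norm (x - y) powr p \<le> \<epsilon> * (norm x powr p + norm y powr p) + C * D x y" for x y
  proof (rule homogeneous_inequality[where p = p
        and Q = "\<lambda>x y. norm (x - y) powr p" and R = "\<lambda>x y. \<epsilon> * (norm x powr p + norm y powr p) + C * D x y"])
    fix \<rho> :: real and x y :: 'b assume \<rho>: "\<rho> > 0"
    show "norm (\<rho> *\<^sub>R x - \<rho> *\<^sub>R y) powr p = \<rho> powr p * norm (x - y) powr p"
      using \<rho> by (simp add: scaleR_diff_right[symmetric] powr_mult)
    have "norm ((\<rho> *\<^sub>R x + \<rho> *\<^sub>R y) /\<^sub>R 2) = \<rho> * norm ((x + y) /\<^sub>R 2)"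
      using \<rho> by (simp add: scaleR_add_right[symmetric])
    hence "D (\<rho> *\<^sub>R x) (\<rho> *\<^sub>R y) = \<rho> powr p * D x y"
      unfolding D_def using \<rho> by (simp add: powr_mult algebra_simps add_divide_distrib)
    thus "\<epsilon> * (norm (\<rho> *\<^sub>R x) powr p + norm (\<rho> *\<^sub>R y) powr p) + C * D (\<rho> *\<^sub>R x) (\<rho> *\<^sub>R y)
        = \<rho> powr p * (\<epsilon> * (norm x powr p + norm y powr p) + C * D x y)"
      using \<rho> by (simp add: powr_mult algebra_simps)
  next
    fix x y :: 'b assume xy: "norm x \<le> 1" "norm y \<le> 1" "norm x = 1 \<or> norm y = 1"
    show "norm (x - y) powr p \<le> \<epsilon> * (norm x powr p + norm y powr p) + C * D x y"
    proof (cases "norm (x - y) powr p \<ge> \<epsilon>")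
      case True
      hence "(x, y) \<in> S" using xy by (simp add: S_def)
      hence "d \<le> D x y" by (rule d)
      have "norm (x - y) \<le> 2" using xy norm_triangle_ineq4[of x y] by linarith
      hence "norm (x - y) powr p \<le> 2 powr p" using assms by (intro powr_mono2) auto
      also have "\<dots> = C * d" using d by (simp add: C_def)
      also have "\<dots> \<le> C * D x y" using \<open>d \<le> D x y\<close> \<open>C > 0\<close> by simp
      finally show ?thesis using assms by (smt (verit) mult_nonneg_nonneg powr_ge_zero)
    next
      case False
      have "norm x powr p + norm y powr p \<ge> 1" using xy(3) by auto
      hence "\<epsilon> * (norm x powr p + norm y powr p) \<ge> \<epsilon> * 1" using assms by (intro mult_left_mono) auto
      moreover have "C * D x y \<ge> 0" using D0 \<open>C > 0\<close> by simp
      ultimately show ?thesis using False by linarith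
    qed
  qed (auto simp: D_def)
  ultimately show ?thesis using that unfolding D_def by blast
qed

text \<open>
  Uniform continuity of the flux on bounded sets, spread out by homogeneity. It lets the flux at \<open>x - t h\<close>
  replace the flux at \<open>x\<close> with one \<open>t\<close> for all vectors.
\<close>

lemma pflux_perturbation:
  assumes "1 < p" "0 < \<epsilon>" "0 < t\<^sub>0"
  obtains t where "t > 0" "t \<le> t\<^sub>0" "\<And>x h :: 'b::euclidean_space.
     pflux p x \<bullet> h \<le> pflux p (x - t *\<^sub>R h) \<bullet> h + \<epsilon> * (norm x powr p + norm h powr p)"
proof -
  have "uniformly_continuous_on (cball 0 2) (pflux p :: 'b \<Rightarrow> 'b)"
    using continuous_on_subset[OF continuous_pflux[OF assms(1)]]
    by (intro compact_uniformly_continuous) auto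
  then obtain \<delta> where \<delta>: "\<delta> > 0" "\<And>x y :: 'b. norm x \<le> 2 \<Longrightarrow> norm y \<le> 2 \<Longrightarrow> dist x y < \<delta>
      \<Longrightarrow> dist (pflux p x) (pflux p y) < \<epsilon>"
    using assms(2) unfolding uniformly_continuous_on_def by (metis mem_cball_0)
  define t where "t = min t\<^sub>0 (min 1 (\<delta> / 2))"
  have t: "t > 0" "t \<le> 1" "t < \<delta>" "t \<le> t\<^sub>0" using \<delta> assms(3) by (auto simp: t_def min_less_iff_disj)
  have "pflux p x \<bullet> h - pflux p (x - t *\<^sub>R h) \<bullet> h \<le> \<epsilon> * (norm x powr p + norm h powr p)" for x h :: 'b
  proof (rule homogeneous_inequality[where p = p
        and Q = "\<lambda>x h. pflux p x \<bullet> h - pflux p (x - t *\<^sub>R h) \<bullet> h"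
        and R = "\<lambda>x h. \<epsilon> * (norm x powr p + norm h powr p)"])
    fix \<rho> :: real and x h :: 'b assume \<rho>: "\<rho> > 0"
    have "\<rho> *\<^sub>R x - t *\<^sub>R \<rho> *\<^sub>R h = \<rho> *\<^sub>R (x - t *\<^sub>R h)" by (simp add: algebra_simps)
    moreover have "\<rho> powr (p - 1) * \<rho> = \<rho> powr p" using \<rho> by (simp add: powr_diff)
    ultimately show "pflux p (\<rho> *\<^sub>R x) \<bullet> (\<rho> *\<^sub>R h) - pflux p (\<rho> *\<^sub>R x - t *\<^sub>R \<rho> *\<^sub>R h) \<bullet> (\<rho> *\<^sub>R h)
        = \<rho> powr p * (pflux p x \<bullet> h - pflux p (x - t *\<^sub>R h) \<bullet> h)"
      using \<rho> by (simp add: pflux_scaleR right_diff_distrib) (simp add: mult.assoc[symmetric] mult.commute)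
    show "\<epsilon> * (norm (\<rho> *\<^sub>R x) powr p + norm (\<rho> *\<^sub>R h) powr p)
        = \<rho> powr p * (\<epsilon> * (norm x powr p + norm h powr p))"
      using \<rho> by (simp add: powr_mult algebra_simps)
  next
    fix x h :: 'b assume xh: "norm x \<le> 1" "norm h \<le> 1" "norm x = 1 \<or> norm h = 1"
    have th: "norm (t *\<^sub>R h) \<le> t" using xh t by (simp add: mult_left_le)
    have "norm (x - t *\<^sub>R h) \<le> 2"
      using norm_triangle_ineq4[of x "t *\<^sub>R h"] th t xh by linarith
    moreover have "dist x (x - t *\<^sub>R h) < \<delta>" using th t(3) unfolding dist_norm by simp
    ultimately have *: "norm (pflux p x - pflux p (x - t *\<^sub>R h)) < \<epsilon>"
      using \<delta>(2)[of x "x - t *\<^sub>R h"] xh by (simp add: dist_norm)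
    have "pflux p x \<bullet> h - pflux p (x - t *\<^sub>R h) \<bullet> h \<le> norm (pflux p x - pflux p (x - t *\<^sub>R h)) * norm h"
      by (metis inner_diff_left norm_cauchy_schwarz)
    also have "\<dots> \<le> \<epsilon> * 1" using * xh assms(2) by (intro mult_mono) auto
    also have "\<dots> \<le> \<epsilon> * (norm x powr p + norm h powr p)"
      using xh(3) assms(2) by (intro mult_left_mono) auto
    finally show "pflux p x \<bullet> h - pflux p (x - t *\<^sub>R h) \<bullet> h \<le> \<epsilon> * (norm x powr p + norm h powr p)" .
  qed auto
  thus ?thesis using that[OF t(1,4)] by (metis add.commute diff_le_eq)
qed

locale picone_exponents =
  fixes p q :: real
  assumes q_gt_1: "1 < q" and q_less_p: "q < p"
    and pq: "\<And>s::real. s \<ge> 0 \<Longrightarrow>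
      (q - 1) * s powr p + q * s powr (p - 1) - (p - q) * s + (q - p + 1) \<ge> 0"
begin

lemma p_gt_1: "1 < p" using q_gt_1 q_less_p by simp

text \<open>
  At \<open>s = 0\<close> the hypothesis gives \<open>q - p + 1 \<ge> 0\<close>. If this were an equality, then \<open>p > 2\<close>, and for
  small \<open>s\<close> the linear term, whose coefficient is negative, would dominate.
\<close>

lemma theta_pos: "q - p + 1 > 0"
proof (rule ccontr)
  assume "\<not> ?thesis"
  moreover have "q - p + 1 \<ge> 0" using pq[of 0] by simp
  ultimately have q: "q = p - 1" by simp
  have p2: "p > 2" using q q_gt_1 by simp
  define r where "r = p - 2"
  \<comment> \<open>With this \<open>s\<close>, the terms with exponents \<open>p\<close> and \<open>p - 1\<close> add up to at most \<open>s / 2\<close>.\<close>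
  define s where "s = (1 / (2 * (2 * p - 3))) powr (1 / r)"
  have r: "r > 0" using p2 by (simp add: r_def)
  have s: "s > 0" "s \<le> 1" using p2 r by (auto simp: s_def intro!: powr_le1 divide_le_eq_1_pos[THEN iffD2])
  have sr: "s powr r = 1 / (2 * (2 * p - 3))" using r p2 by (simp add: s_def powr_powr)
  have "0 \<le> (p - 2) * s powr p + (p - 1) * s powr (p - 1) - s"
    using pq[of s] s by (simp add: q algebra_simps)
  moreover have "(p - 2) * s powr p \<le> (p - 2) * s powr (p - 1)"
    using s p2 by (intro mult_left_mono powr_mono') auto
  ultimately have "s \<le> (2 * p - 3) * s powr (p - 1)" by (simp add: algebra_simps)
  also have "s powr (p - 1) = s powr (r + 1)" by (simp add: r_def)
  also have "\<dots> = s powr r * s" using s by (subst powr_add) simp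
  also have "(2 * p - 3) * (s powr r * s) = s / 2" using p2 by (simp add: sr field_simps)
  finally show False using s by simp
qed

text \<open>
  The weights \<open>q - 1\<close>, \<open>p - q\<close>, \<open>q - p + 1\<close> of the exponents \<open>p\<close>, \<open>1\<close>, \<open>0\<close> have sum \<open>q\<close> and mean
  exponent \<open>p - 1\<close>: a weighted inequality between the arithmetic and the geometric mean.
\<close>

lemma picone_polynomial_plus:
  assumes "s \<ge> 0"
  shows "(q - 1) * s powr p - q * s powr (p - 1) + (p - q) * s + (q - p + 1) \<ge> 0"
proof (cases "s = 0")
  case True
  then show ?thesis using theta_pos p_gt_1 by simp
next
  case False
  hence s: "s > 0" using assms by simp
  define L w where "L = ln s" and "w = s powr (p - 1)"
  have "(q - 1) * s powr p \<ge> (q - 1) * (w * (1 + L))"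
    using powr_ge_tangent_in_exponent[OF s, of "p - 1" p] q_gt_1
    by (intro mult_left_mono) (auto simp: L_def w_def)
  moreover have "(p - q) * s \<ge> (p - q) * (w * (1 + (2 - p) * L))"
    using powr_ge_tangent_in_exponent[OF s, of "p - 1" 1] q_less_p s
    by (intro mult_left_mono) (auto simp: L_def w_def algebra_simps)
  moreover have "(q - p + 1) * 1 \<ge> (q - p + 1) * (w * (1 + (1 - p) * L))"
    using powr_ge_tangent_in_exponent[OF s, of "p - 1" 0] theta_pos s
    by (intro mult_left_mono) (auto simp: L_def w_def algebra_simps)
  moreover have "(q - 1) * (w * (1 + L)) + (p - q) * (w * (1 + (2 - p) * L))
      + (q - p + 1) * (w * (1 + (1 - p) * L)) = q * w"
    by (simp add: algebra_simps)
  ultimately show ?thesis by (simp add: w_def)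
qed

text \<open>
  For given norms, the difference of the two sides is affine in \<open>X \<bullet> Y\<close>, so it is smallest when \<open>X\<close> and
  \<open>Y\<close> are parallel or antiparallel. With \<open>s = norm Y / norm X\<close> these two cases are
  \<open>picone_polynomial_plus\<close> and the hypothesis on \<open>p\<close> and \<open>q\<close>. For \<open>X = \<nabla>\<psi> / \<psi>\<close> and \<open>Y = \<nabla>v / v\<close> this
  is the generalized Picone inequality, divided by \<open>\<psi>\<^sup>q v\<^sup>p\<^sup>-\<^sup>q\<close>.
\<close>

lemma picone_vector:
  fixes X Y :: "'b::real_inner"
  shows "q * (pflux p Y \<bullet> X) - (q - 1) * norm Y powr p
     \<le> (q - p + 1) * norm X powr p + (p - q) * (pflux p X \<bullet> Y)"
proof (cases "X = 0")
  case True
  then show ?thesis using q_gt_1 by simp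
next
  case False
  define a b where "a = norm X" and "b = norm Y"
  define s where "s = b / a"
  define \<kappa> where "\<kappa> = (p - q) * a powr (p - 2) - q * b powr (p - 2)"
  have a: "a > 0" and b: "b \<ge> 0" and s: "s \<ge> 0" using False by (auto simp: a_def b_def s_def)
  have bs: "b = s * a" using a by (simp add: s_def)
  have pw: "z powr (p - 2) * z = z powr (p - 1)" "z powr (p - 1) * z = z powr p" if "z \<ge> 0" for z :: real
    using that powr_add[of z "p - 2" 1] powr_add[of z "p - 1" 1] by (cases "z = 0"; simp)+
  have e1: "(p - q) * s * a powr p = (p - q) * (a powr (p - 1) * b)"
    using a by (simp add: bs pw(2)[symmetric] algebra_simps)
  have e2: "q * s powr (p - 1) * a powr p = q * (b powr (p - 1) * a)"
    using a by (simp add: bs pw(2)[symmetric] powr_mult algebra_simps)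
  have bp: "b powr p = s powr p * a powr p" by (simp add: bs powr_mult)
  have \<kappa>ab: "\<kappa> * (a * b) = (p - q) * (a powr (p - 1) * b) - q * (b powr (p - 1) * a)"
    using a b by (simp add: \<kappa>_def pw(1)[symmetric] algebra_simps)
  have "a powr p * ((q - 1) * s powr p - q * s powr (p - 1) + (p - q) * s + (q - p + 1)) \<ge> 0"
    using picone_polynomial_plus[OF s] by simp
  hence 1: "(q - p + 1) * a powr p + (q - 1) * b powr p + \<kappa> * (a * b) \<ge> 0"
    unfolding \<kappa>ab e1[symmetric] e2[symmetric] bp by (simp add: algebra_simps)
  have "a powr p * ((q - 1) * s powr p + q * s powr (p - 1) - (p - q) * s + (q - p + 1)) \<ge> 0"
    using pq[OF s] by simp
  hence 2: "(q - p + 1) * a powr p + (q - 1) * b powr p - \<kappa> * (a * b) \<ge> 0"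
    unfolding \<kappa>ab e1[symmetric] e2[symmetric] bp by (simp add: algebra_simps)
  have "\<bar>\<kappa> * (X \<bullet> Y)\<bar> \<le> \<bar>\<kappa>\<bar> * (a * b)"
    unfolding abs_mult a_def b_def by (intro mult_left_mono Cauchy_Schwarz_ineq2) auto
  hence "(q - p + 1) * a powr p + (q - 1) * b powr p + \<kappa> * (X \<bullet> Y) \<ge> 0"
    using 1 2 by (cases "\<kappa> \<ge> 0"; simp only: abs_of_nonneg abs_of_neg not_le; linarith)
  moreover have "(p - q) * (pflux p X \<bullet> Y) - q * (pflux p Y \<bullet> X) = \<kappa> * (X \<bullet> Y)"
    by (simp add: pflux_def \<kappa>_def a_def b_def inner_commute algebra_simps)
  ultimately show ?thesis by (simp add: a_def b_def)
qed

text \<open>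
  The vectors on the left and right are the gradients of \<open>H v\<^sup>1\<^sup>-\<^sup>q\<close> and \<open>G v\<^sup>p\<^sup>-\<^sup>q\<close> when \<open>x\<close> and \<open>y\<close> are those
  of \<open>\<sigma> = \<psi> + e\<close> and \<open>v\<close>. Subtracting the constants in \<open>G\<close> and \<open>H\<close> makes these functions vanish
  with \<open>\<psi>\<close>; it does not affect the derivatives of \<open>G\<close> and \<open>H\<close>, and its effect on the remaining
  two terms is the error.
\<close>

lemma picone_regularized:
  fixes x y :: "'b::real_inner"
  assumes "0 < e" "e \<le> \<sigma>" "0 < v"
  defines "G \<equiv> \<sigma> powr (q - p + 1) - e powr (q - p + 1)" and "H \<equiv> \<sigma> powr q - e powr q"
  shows "pflux p y \<bullet> ((q * \<sigma> powr (q - 1) * v powr (1 - q)) *\<^sub>R x + (H * ((1 - q) * v powr (- q))) *\<^sub>R y)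
    \<le> pflux p x \<bullet> (((q - p + 1) * \<sigma> powr (q - p) * v powr (p - q)) *\<^sub>R x
          + (G * ((p - q) * v powr (p - q - 1))) *\<^sub>R y)
      + (q - 1) * e powr q * v powr (- q) * norm y powr p
      + (p - q) * e powr (q - p + 1) * v powr (p - q - 1) * (norm x powr (p - 1) * norm y)"
proof -
  define X Y where "X = (1/\<sigma>) *\<^sub>R x" and "Y = (1/v) *\<^sub>R y"
  have \<sigma>: "\<sigma> > 0" using assms by simp
  define A where "A = \<sigma> powr q * v powr (p - q)"
  have A: "A \<ge> 0" by (simp add: A_def)
  have e1: "A * (pflux p Y \<bullet> X) = \<sigma> powr (q - 1) * v powr (1 - q) * (pflux p y \<bullet> x)"
    using \<sigma> assms by (simp add: A_def X_def Y_def pflux_scaleR powr_divide powr_diff mult.commute)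
  have e2: "A * norm Y powr p = \<sigma> powr q * v powr (- q) * norm y powr p"
    using \<sigma> assms by (simp add: A_def Y_def powr_divide)
      (simp add: powr_diff powr_minus field_simps)
  have e3: "A * norm X powr p = \<sigma> powr (q - p) * v powr (p - q) * norm x powr p"
    using \<sigma> assms by (simp add: A_def X_def powr_divide powr_diff)
  have e4: "A * (pflux p X \<bullet> Y) = \<sigma> powr (q - p + 1) * v powr (p - q - 1) * (pflux p x \<bullet> y)"
    using \<sigma> assms by (simp add: A_def X_def Y_def pflux_scaleR powr_divide powr_diff powr_add mult_ac)
  have "A * (q * (pflux p Y \<bullet> X) - (q - 1) * norm Y powr p)
     \<le> A * ((q - p + 1) * norm X powr p + (p - q) * (pflux p X \<bullet> Y))"
    by (intro mult_left_mono picone_vector A)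
  hence main: "q * (\<sigma> powr (q - 1) * v powr (1 - q) * (pflux p y \<bullet> x))
      - (q - 1) * (\<sigma> powr q * v powr (- q) * norm y powr p)
     \<le> (q - p + 1) * (\<sigma> powr (q - p) * v powr (p - q) * norm x powr p)
      + (p - q) * (\<sigma> powr (q - p + 1) * v powr (p - q - 1) * (pflux p x \<bullet> y))"
    unfolding e1[symmetric] e2[symmetric] e3[symmetric] e4[symmetric] by (simp add: algebra_simps)
  have "(p - q) * e powr (q - p + 1) * v powr (p - q - 1) * (pflux p x \<bullet> y)
      \<le> (p - q) * e powr (q - p + 1) * v powr (p - q - 1) * (norm x powr (p - 1) * norm y)"
    using pflux_inner_le[of p x y] q_less_p by (intro mult_left_mono) auto
  thus ?thesis using main
    unfolding G_def H_def inner_add_right inner_scaleR_right pflux_inner_self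
    by (simp add: algebra_simps)
qed

end

section \<open>Mean convergence of order p\<close>

definition Lp :: "'s measure \<Rightarrow> real \<Rightarrow> ('s \<Rightarrow> 'b::euclidean_space) \<Rightarrow> bool" where
  "Lp M p u \<longleftrightarrow> u \<in> borel_measurable M \<and> integrable M (\<lambda>x. norm (u x) powr p)"

definition Lp_lim :: "'s measure \<Rightarrow> real \<Rightarrow> (nat \<Rightarrow> 's \<Rightarrow> 'b::euclidean_space) \<Rightarrow> ('s \<Rightarrow> 'b) \<Rightarrow> bool" where
  "Lp_lim M p U u \<longleftrightarrow> (\<forall>n. Lp M p (U n)) \<and> Lp M p u \<and>
     (\<lambda>n. LINT x|M. norm (U n x - u x) powr p) \<longlonglongrightarrow> 0"

lemma LpD: "Lp M p u \<Longrightarrow> u \<in> borel_measurable M" "Lp M p u \<Longrightarrow> integrable M (\<lambda>x. norm (u x) powr p)"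
  by (auto simp: Lp_def)

lemma integrable_mult_AE_bounded:
  fixes f g :: "'s \<Rightarrow> real"
  assumes "integrable M f" "g \<in> borel_measurable M" "AE x in M. \<bar>g x\<bar> \<le> B"
  shows "integrable M (\<lambda>x. f x * g x)"
proof (rule Bochner_Integration.integrable_bound)
  show "integrable M (\<lambda>x. B * f x)" using assms by simp
  show "AE x in M. norm (f x * g x) \<le> norm (B * f x)"
    using assms(3)
  proof eventually_elim
    case (elim x)
    have "\<bar>f x\<bar> * \<bar>g x\<bar> \<le> \<bar>f x\<bar> * \<bar>B\<bar>" using elim by (intro mult_left_mono) auto
    thus "norm (f x * g x) \<le> norm (B * f x)" by (simp add: abs_mult mult.commute)
  qed
qed (use assms in auto)

lemma Lp_limD:
  "Lp_lim M p U u \<Longrightarrow> Lp M p (U n)" "Lp_lim M p U u \<Longrightarrow> Lp M p u"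
  "Lp_lim M p U u \<Longrightarrow> (\<lambda>n. LINT x|M. norm (U n x - u x) powr p) \<longlonglongrightarrow> 0"
  by (auto simp: Lp_lim_def)

lemma Lp_zero [simp]: "Lp M p (\<lambda>x. 0)"
  by (simp add: Lp_def)

lemma Lp_bound:
  fixes u :: "'s \<Rightarrow> 'b::euclidean_space"
  assumes "0 \<le> p" "u \<in> borel_measurable M" "integrable M w" "AE x in M. norm (u x) powr p \<le> w x"
  shows "Lp M p u"
proof -
  have [measurable]: "u \<in> borel_measurable M" by fact
  have "integrable M (\<lambda>x. norm (u x) powr p)"
    by (rule Bochner_Integration.integrable_bound[OF assms(3)])
      (measurable, use assms(4) in \<open>auto elim!: eventually_mono\<close>)
  thus ?thesis using assms by (simp add: Lp_def)
qed

lemma Lp_cong_AE: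
  fixes u u' :: "'s \<Rightarrow> 'b::euclidean_space"
  assumes "Lp M p u" "u' \<in> borel_measurable M" "AE x in M. u x = u' x"
  shows "Lp M p u'"
proof -
  have [measurable]: "u \<in> borel_measurable M" "u' \<in> borel_measurable M"
    using assms by (auto dest: LpD)
  have "integrable M (\<lambda>x. norm (u' x) powr p)"
    using LpD(2)[OF assms(1)]
    by (rule integrable_cong_AE_imp) (measurable, use assms(3) in \<open>auto elim!: eventually_mono\<close>)
  thus ?thesis using assms by (simp add: Lp_def)
qed

lemma Lp_add:
  assumes "0 \<le> p" "Lp M p u" "Lp M p v"
  shows "Lp M p (\<lambda>x. u x + v x)"
proof (rule Lp_bound[OF assms(1)])
  show "integrable M (\<lambda>x. 2 powr p * (norm (u x) powr p + norm (v x) powr p))"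
    using assms by (auto dest: LpD)
  show "(\<lambda>x. u x + v x) \<in> borel_measurable M"
    using assms by (intro borel_measurable_add) (auto dest: LpD)
qed (simp add: norm_powr_add_le assms)

lemma Lp_bounded_mult:
  fixes b :: "'s \<Rightarrow> real" and u :: "'s \<Rightarrow> 'b::euclidean_space"
  assumes "0 \<le> p" "b \<in> borel_measurable M" "AE x in M. \<bar>b x\<bar> \<le> B" "Lp M p u"
  shows "Lp M p (\<lambda>x. b x *\<^sub>R u x)"
proof (rule Lp_bound[OF assms(1)])
  show "integrable M (\<lambda>x. \<bar>B\<bar> powr p * norm (u x) powr p)"
    using assms by (auto dest: LpD)
  show "AE x in M. norm (b x *\<^sub>R u x) powr p \<le> \<bar>B\<bar> powr p * norm (u x) powr p"
    using assms(3)
  proof eventually_elim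
    case (elim x)
    have "\<bar>b x\<bar> powr p \<le> \<bar>B\<bar> powr p" using elim assms by (intro powr_mono2) auto
    thus ?case by (simp add: powr_mult mult_right_mono)
  qed
qed (use assms in \<open>auto dest: LpD\<close>)

lemma Lp_scaleR: "0 \<le> p \<Longrightarrow> Lp M p u \<Longrightarrow> Lp M p (\<lambda>x. c *\<^sub>R u x)" for c :: real
  by (rule Lp_bounded_mult[where B = "\<bar>c\<bar>"]) auto

lemma Lp_diff:
  assumes "0 \<le> p" "Lp M p u" "Lp M p v"
  shows "Lp M p (\<lambda>x. u x - v x)"
  using Lp_add[OF assms(1,2) Lp_scaleR[OF assms(1,3), of "-1"]] by simp

lemma Lp_imp_integrable:
  fixes u :: "'s \<Rightarrow> 'b::euclidean_space"
  assumes "finite_measure M" "1 \<le> p" "Lp M p u"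
  shows "integrable M u"
proof -
  interpret finite_measure M by fact
  show ?thesis
  proof (rule Bochner_Integration.integrable_bound)
    show "integrable M (\<lambda>x. 1 + norm (u x) powr p)"
      using assms by (auto dest: LpD)
    show "AE x in M. norm (u x) \<le> norm (1 + norm (u x) powr p)"
    proof (rule AE_I2)
      fix x
      show "norm (u x) \<le> norm (1 + norm (u x) powr p)"
      proof (cases "norm (u x) \<le> 1")
        case True
        thus ?thesis using powr_ge_zero[of "norm (u x)" p] by (simp add: add.commute add_increasing2)
      next
        case False
        hence "norm (u x) powr 1 \<le> norm (u x) powr p" using assms by (intro powr_mono) auto
        thus ?thesis using False by simp
      qed
    qed
  qed (use assms in \<open>auto dest: LpD\<close>)
qed

lemma Lp_of_bounded:
  fixes u :: "'s \<Rightarrow> 'b::euclidean_space"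
  assumes "finite_measure M" "0 \<le> p" "u \<in> borel_measurable M" "AE x in M. norm (u x) \<le> B"
  shows "Lp M p u"
proof -
  interpret finite_measure M by fact
  show ?thesis
  proof (rule Lp_bound[OF assms(2,3)])
    show "AE x in M. norm (u x) powr p \<le> \<bar>B\<bar> powr p"
      using assms(4) by eventually_elim (use assms in \<open>auto intro!: powr_mono2\<close>)
  qed simp
qed

lemma Lp_lim_measurable:
  "Lp_lim M p U u \<Longrightarrow> U n \<in> borel_measurable M" "Lp_lim M p U u \<Longrightarrow> u \<in> borel_measurable M"
  by (auto simp: Lp_lim_def Lp_def)

lemma Lp_lim_diff_Lp: "0 \<le> p \<Longrightarrow> Lp_lim M p U u \<Longrightarrow> Lp M p (\<lambda>x. U n x - u x)"
  by (intro Lp_diff Lp_limD)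

lemma Lp_lim_const [simp]: "Lp M p u \<Longrightarrow> Lp_lim M p (\<lambda>n. u) u"
  by (simp add: Lp_lim_def)

lemma Lp_lim_subseq:
  assumes "Lp_lim M p U u" "strict_mono (r :: nat \<Rightarrow> nat)"
  shows "Lp_lim M p (\<lambda>n. U (r n)) u"
  using assms LIMSEQ_subseq_LIMSEQ[OF Lp_limD(3)[OF assms(1)] assms(2)]
  by (auto simp: Lp_lim_def o_def)

lemma Lp_lim_compare:
  assumes "0 \<le> p" "\<And>n. Lp M p (U n)" "Lp M p u"
    and "\<And>n. integrable M (w n)" "\<And>n. AE x in M. norm (U n x - u x) powr p \<le> w n x"
    and "(\<lambda>n. LINT x|M. w n x) \<longlonglongrightarrow> 0"
  shows "Lp_lim M p U u"
  unfolding Lp_lim_def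
proof (intro conjI allI assms tendsto_sandwich[OF _ _ tendsto_const assms(6)])
  show "\<forall>\<^sub>F n in sequentially. 0 \<le> (LINT x|M. norm (U n x - u x) powr p)"
    by (intro always_eventually allI Bochner_Integration.integral_nonneg) auto
  show "\<forall>\<^sub>F n in sequentially. (LINT x|M. norm (U n x - u x) powr p) \<le> (LINT x|M. w n x)"
    by (intro always_eventually allI integral_mono_AE assms LpD(2)[OF Lp_diff])
qed

lemma Lp_lim_add:
  assumes p: "0 \<le> p" and U: "Lp_lim M p U u" and V: "Lp_lim M p V v"
  shows "Lp_lim M p (\<lambda>n x. U n x + V n x) (\<lambda>x. u x + v x)"
proof (rule Lp_lim_compare[OF p])
  let ?w = "\<lambda>n x. 2 powr p * (norm (U n x - u x) powr p + norm (V n x - v x) powr p)"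
  have i: "integrable M (\<lambda>x. norm (U n x - u x) powr p)" "integrable M (\<lambda>x. norm (V n x - v x) powr p)" for n
    by (rule LpD(2)[OF Lp_lim_diff_Lp[OF p U]] LpD(2)[OF Lp_lim_diff_Lp[OF p V]])+
  show "integrable M (?w n)" for n using i by auto
  have "(\<lambda>n. 2 powr p * ((LINT x|M. norm (U n x - u x) powr p) + (LINT x|M. norm (V n x - v x) powr p)))
     \<longlonglongrightarrow> 2 powr p * (0 + 0)"
    by (intro tendsto_intros Lp_limD U V)
  thus "(\<lambda>n. LINT x|M. ?w n x) \<longlonglongrightarrow> 0" using i by simp
  show "AE x in M. norm (U n x + V n x - (u x + v x)) powr p \<le> ?w n x" for n
    using norm_powr_add_le[OF p, of "U n x - u x" "V n x - v x" for x] by (auto simp: algebra_simps)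
qed (use p U V in \<open>auto intro: Lp_add Lp_limD\<close>)

lemma Lp_lim_dominated:
  fixes U :: "nat \<Rightarrow> 's \<Rightarrow> 'b::euclidean_space"
  assumes p: "0 < p" and U: "\<And>n. Lp M p (U n)" and u: "Lp M p u"
    and w: "integrable M w" "\<And>n. AE x in M. norm (U n x - u x) powr p \<le> w x"
    and lim: "AE x in M. (\<lambda>n. U n x) \<longlonglongrightarrow> u x"
  shows "Lp_lim M p U u"
proof -
  have [measurable]: "U n \<in> borel_measurable M" "u \<in> borel_measurable M" for n
    using U u by (auto dest: LpD)
  have "(\<lambda>n. LINT x|M. norm (U n x - u x) powr p) \<longlonglongrightarrow> (LINT x|M. 0)"
  proof (rule integral_dominated_convergence[where w = w])
    show "AE x in M. (\<lambda>n. norm (U n x - u x) powr p) \<longlonglongrightarrow> 0"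
      using lim
    proof eventually_elim
      case (elim x)
      hence "(\<lambda>n. norm (U n x - u x)) \<longlonglongrightarrow> 0"
        by (simp add: LIM_zero tendsto_norm_zero)
      hence "(\<lambda>n. norm (U n x - u x) powr p) \<longlonglongrightarrow> 0 powr p"
        using p by (intro tendsto_powr' tendsto_const) auto
      thus ?case by simp
    qed
  qed (use w in \<open>auto\<close>)
  thus ?thesis using U u by (simp add: Lp_lim_def)
qed

text \<open>
  Split \<open>b U - c u\<close> into \<open>b (U - u)\<close>, controlled by the bound, and \<open>(b - c) u\<close>, to which dominated
  convergence applies.
\<close>

lemma Lp_lim_bounded_mult:
  fixes U :: "nat \<Rightarrow> 's \<Rightarrow> 'b::euclidean_space" and b :: "nat \<Rightarrow> 's \<Rightarrow> real"
  assumes p: "0 < p" and U: "Lp_lim M p U u"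
    and b: "\<And>n. b n \<in> borel_measurable M" "c \<in> borel_measurable M"
    and B: "\<And>n x. \<bar>b n x\<bar> \<le> B" "\<And>x. \<bar>c x\<bar> \<le> B"
    and lim: "AE x in M. (\<lambda>n. b n x) \<longlonglongrightarrow> c x"
  shows "Lp_lim M p (\<lambda>n x. b n x *\<^sub>R U n x) (\<lambda>x. c x *\<^sub>R u x)"
proof -
  have B0: "B \<ge> 0" using B(1)[of 0 undefined] by linarith
  note [measurable] = b
  have [measurable]: "U n \<in> borel_measurable M" "u \<in> borel_measurable M" for n
    using Lp_lim_measurable[OF U] by auto
  have Ld: "Lp M p (\<lambda>x. U n x - u x)" for n
    using p Lp_diff Lp_limD(1)[OF U] Lp_limD(2)[OF U] by (metis less_imp_le)
  have "Lp_lim M p (\<lambda>n x. b n x *\<^sub>R (U n x - u x)) (\<lambda>x. 0)"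
  proof (rule Lp_lim_compare)
    show "Lp M p (\<lambda>x. b n x *\<^sub>R (U n x - u x))" for n
      by (rule Lp_bounded_mult[where B = B]) (use p B Ld in auto)
    show "integrable M (\<lambda>x. B powr p * norm (U n x - u x) powr p)" for n
      using LpD(2)[OF Ld[of n]] by auto
    show "AE x in M. norm (b n x *\<^sub>R (U n x - u x) - 0) powr p \<le> B powr p * norm (U n x - u x) powr p" for n
      using B p by (auto simp: powr_mult intro!: mult_right_mono powr_mono2)
    show "(\<lambda>n. LINT x|M. B powr p * norm (U n x - u x) powr p) \<longlonglongrightarrow> 0"
      using tendsto_mult_left[OF Lp_limD(3)[OF U], of "B powr p"] by simp
  qed (use p in auto)
  moreover have "Lp_lim M p (\<lambda>n x. b n x *\<^sub>R u x) (\<lambda>x. c x *\<^sub>R u x)"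
  proof (rule Lp_lim_dominated[OF p])
    show "Lp M p (\<lambda>x. b n x *\<^sub>R u x)" "Lp M p (\<lambda>x. c x *\<^sub>R u x)" for n
      using p B Lp_limD(2)[OF U] by (auto intro!: Lp_bounded_mult[where B = B])
    show "integrable M (\<lambda>x. (2 * B) powr p * norm (u x) powr p)"
      using U by (auto dest: Lp_limD LpD)
    have "norm (b n x *\<^sub>R u x - c x *\<^sub>R u x) powr p \<le> (2 * B) powr p * norm (u x) powr p" for n x
    proof -
      have "norm (b n x *\<^sub>R u x - c x *\<^sub>R u x) = \<bar>b n x - c x\<bar> * norm (u x)"
        by (simp flip: scaleR_diff_left)
      also have "\<dots> \<le> (2 * B) * norm (u x)"
        using B(1)[of n x] B(2)[of x] by (intro mult_right_mono) auto
      finally have "norm (b n x *\<^sub>R u x - c x *\<^sub>R u x) powr p \<le> ((2 * B) * norm (u x)) powr p"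
        using p by (intro powr_mono2) auto
      thus ?thesis by (simp add: powr_mult)
    qed
    thus "AE x in M. norm (b n x *\<^sub>R u x - c x *\<^sub>R u x) powr p \<le> (2 * B) powr p * norm (u x) powr p" for n
      by simp
    show "AE x in M. (\<lambda>n. b n x *\<^sub>R u x) \<longlonglongrightarrow> c x *\<^sub>R u x"
      using lim by eventually_elim (intro tendsto_intros)
  qed
  ultimately have "Lp_lim M p (\<lambda>n x. b n x *\<^sub>R (U n x - u x) + b n x *\<^sub>R u x) (\<lambda>x. 0 + c x *\<^sub>R u x)"
    using p by (intro Lp_lim_add) auto
  thus ?thesis by (simp add: algebra_simps)
qed

lemma Lp_lim_AE_subseq:
  fixes U :: "nat \<Rightarrow> 's \<Rightarrow> 'b::euclidean_space"
  assumes p: "0 < p" and U: "Lp_lim M p U u"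
  obtains r :: "nat \<Rightarrow> nat" where "strict_mono r" "AE x in M. (\<lambda>n. U (r n) x) \<longlonglongrightarrow> u x"
proof -
  have "Lp M p (\<lambda>x. U n x - u x)" for n
    using p Lp_diff Lp_limD(1)[OF U] Lp_limD(2)[OF U] by (metis less_imp_le)
  hence "\<exists>r::nat\<Rightarrow>nat. strict_mono r \<and> (AE x in M. (\<lambda>n. norm (U (r n) x - u x) powr p) \<longlonglongrightarrow> 0)"
    using Lp_limD(3)[OF U] by (intro tendsto_L1_AE_subseq) (auto dest: LpD)
  then obtain r :: "nat \<Rightarrow> nat" where r: "strict_mono r"
      "AE x in M. (\<lambda>n. norm (U (r n) x - u x) powr p) \<longlonglongrightarrow> 0"
    by blast
  have "AE x in M. (\<lambda>n. U (r n) x) \<longlonglongrightarrow> u x"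
    using r(2)
  proof eventually_elim
    case (elim x)
    have "(\<lambda>n. (norm (U (r n) x - u x) powr p) powr (1/p)) \<longlonglongrightarrow> 0 powr (1/p)"
      using elim p by (intro tendsto_powr' tendsto_const) auto
    hence "(\<lambda>n. norm (U (r n) x - u x)) \<longlonglongrightarrow> 0" using p by (simp add: powr_powr)
    thus ?case using Lim_null tendsto_norm_zero_iff by blast
  qed
  thus ?thesis using that r(1) by blast
qed

lemma Lp_lim_cong_AE:
  fixes U :: "nat \<Rightarrow> 's \<Rightarrow> 'b::euclidean_space"
  assumes "Lp_lim M p U u" "u' \<in> borel_measurable M" "AE x in M. u x = u' x"
  shows "Lp_lim M p U u'"
proof -
  have [measurable]: "U n \<in> borel_measurable M" "u \<in> borel_measurable M" for n
    using Lp_lim_measurable[OF assms(1)] by auto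
  note [measurable] = assms(2)
  have "(LINT x|M. norm (U n x - u x) powr p) = (LINT x|M. norm (U n x - u' x) powr p)" for n
    by (rule integral_cong_AE) (measurable, use assms(3) in \<open>auto elim!: eventually_mono\<close>)
  thus ?thesis using assms Lp_cong_AE[OF _ assms(2,3)] by (auto simp: Lp_lim_def)
qed

lemma Lp_lim_uniform:
  fixes U :: "nat \<Rightarrow> 's \<Rightarrow> 'b::euclidean_space"
  assumes "finite_measure M" "0 < p" "\<And>n. Lp M p (U n)" "Lp M p u"
    and e: "\<And>n x. x \<in> space M \<Longrightarrow> norm (U n x - u x) \<le> e n" "\<And>n. 0 \<le> e n" "e \<longlonglongrightarrow> 0"
  shows "Lp_lim M p U u"
proof (rule Lp_lim_compare)
  interpret finite_measure M by fact
  show "integrable M (\<lambda>x. e n powr p)" for n by simp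
  show "AE x in M. norm (U n x - u x) powr p \<le> e n powr p" for n
    using e assms(2) by (intro AE_I2) (auto intro!: powr_mono2)
  have "(\<lambda>n. e n powr p) \<longlonglongrightarrow> 0 powr p"
    using assms e by (intro tendsto_powr' tendsto_const) auto
  hence "(\<lambda>n. measure M (space M) * e n powr p) \<longlonglongrightarrow> measure M (space M) * 0"
    using assms by (intro tendsto_mult tendsto_const) auto
  thus "(\<lambda>n. LINT x|M. e n powr p) \<longlonglongrightarrow> 0" by simp
qed (use assms in auto)

lemma Lp_lim_integral_powr_le:
  fixes U :: "nat \<Rightarrow> 's \<Rightarrow> 'b::euclidean_space"
  assumes p: "1 < p" and U: "Lp_lim M p U u" and "\<epsilon> > 0"
  shows "\<forall>\<^sub>F n in sequentially. (LINT x|M. norm (U n x) powr p) \<le> (LINT x|M. norm (u x) powr p) + \<epsilon>"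
proof -
  define L where "L = (LINT x|M. norm (u x) powr p)"
  have L: "L \<ge> 0" unfolding L_def by (rule Bochner_Integration.integral_nonneg) auto
  have "((\<lambda>\<tau>. (1 - \<tau>) powr (1 - p) * L) \<longlongrightarrow> (1 - 0) powr (1 - p) * L) (at_right 0)"
    by (intro tendsto_intros) auto
  hence "\<forall>\<^sub>F \<tau> in at_right 0. (1 - \<tau>) powr (1 - p) * L < L + \<epsilon> / 2"
    using \<open>\<epsilon> > 0\<close> by (intro order_tendstoD(2)) auto
  moreover have "\<forall>\<^sub>F \<tau> in at_right (0::real). 0 < \<tau> \<and> \<tau> < 1"
    by (auto simp: eventually_at_right_less eventually_at intro!: exI[of _ 1] zero_less_one)
  ultimately obtain \<tau> where \<tau>: "0 < \<tau>" "\<tau> < 1" "(1 - \<tau>) powr (1 - p) * L < L + \<epsilon> / 2"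
    using eventually_happens'[OF trivial_limit_at_right_real, OF eventually_conj] by blast
  have "(\<lambda>n. \<tau> powr (1 - p) * (LINT x|M. norm (U n x - u x) powr p)) \<longlonglongrightarrow> \<tau> powr (1 - p) * 0"
    by (intro tendsto_intros Lp_limD U)
  hence "\<forall>\<^sub>F n in sequentially. \<tau> powr (1 - p) * (LINT x|M. norm (U n x - u x) powr p) < \<epsilon> / 2"
    using \<open>\<epsilon> > 0\<close> by (intro order_tendstoD(2)) auto
  thus ?thesis
  proof eventually_elim
    case (elim n)
    have i: "integrable M (\<lambda>x. norm (U n x) powr p)" "integrable M (\<lambda>x. norm (u x) powr p)"
        "integrable M (\<lambda>x. norm (U n x - u x) powr p)"
      using p U Lp_diff[OF _ Lp_limD(1)[OF U] Lp_limD(2)[OF U]] by (auto dest: Lp_limD LpD)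
    have "(LINT x|M. norm (U n x) powr p)
      \<le> (LINT x|M. (1 - \<tau>) powr (1 - p) * norm (u x) powr p + \<tau> powr (1 - p) * norm (U n x - u x) powr p)"
    proof (rule integral_mono)
      show "norm (U n x) powr p
        \<le> (1 - \<tau>) powr (1 - p) * norm (u x) powr p + \<tau> powr (1 - p) * norm (U n x - u x) powr p" for x
        using norm_powr_add_le_weighted[OF p \<tau>(1,2), of "u x" "U n x - u x"] by simp
    qed (use i in auto)
    also have "\<dots> = (1 - \<tau>) powr (1 - p) * L + \<tau> powr (1 - p) * (LINT x|M. norm (U n x - u x) powr p)"
      using i by (simp add: L_def)
    finally show ?case using elim \<tau> by (simp add: L_def)
  qed
qed

lemma Lp_lim_integral_bounded_mult:
  fixes U :: "nat \<Rightarrow> 's \<Rightarrow> 'b::euclidean_space"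
  assumes "finite_measure M" "1 < p" "Lp_lim M p U u"
    and b: "b \<in> borel_measurable M" "\<And>x. \<bar>b x\<bar> \<le> B"
  shows "(\<lambda>n. LINT x|M. b x *\<^sub>R U n x) \<longlonglongrightarrow> (LINT x|M. b x *\<^sub>R u x)"
proof (rule metric_LIMSEQ_I)
  interpret finite_measure M by fact
  define m where "m = measure M (space M)"
  have m: "m \<ge> 0" by (simp add: m_def)
  have B: "B \<ge> 0" using b(2)[of undefined] by linarith
  fix \<epsilon> :: real assume "\<epsilon> > 0"
  define k where "k = (B + 1) * (m + 1)"
  have k: "k > 0" using m B by (simp add: k_def)
  define \<delta> where "\<delta> = \<epsilon> / (2 * k)"
  have \<delta>: "\<delta> > 0" using \<open>\<epsilon> > 0\<close> k by (simp add: \<delta>_def)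
  have "(\<lambda>n. B * \<delta> powr (1 - p) * (LINT x|M. norm (U n x - u x) powr p)) \<longlonglongrightarrow> B * \<delta> powr (1 - p) * 0"
    by (intro tendsto_intros Lp_limD assms)
  hence "\<forall>\<^sub>F n in sequentially. B * \<delta> powr (1 - p) * (LINT x|M. norm (U n x - u x) powr p) < \<epsilon> / 2"
    using \<open>\<epsilon> > 0\<close> by (intro order_tendstoD(2)) auto
  moreover have key: "dist (LINT x|M. b x *\<^sub>R U n x) (LINT x|M. b x *\<^sub>R u x)
      \<le> B * \<delta> * m + B * \<delta> powr (1 - p) * (LINT x|M. norm (U n x - u x) powr p)" for n
  proof -
    have [measurable]: "U n \<in> borel_measurable M" "u \<in> borel_measurable M"
      using Lp_lim_measurable[OF assms(3)] by auto
    note [measurable] = b(1)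
    have i: "integrable M (\<lambda>x. norm (U n x - u x) powr p)"
      using assms Lp_diff[OF _ Lp_limD(1)[OF assms(3)] Lp_limD(2)[OF assms(3)]] by (auto dest: LpD)
    have bi: "integrable M (\<lambda>x. b x *\<^sub>R w x)" if "Lp M p w" for w :: "'s \<Rightarrow> 'b"
      using Lp_imp_integrable[OF assms(1) _ Lp_bounded_mult[OF _ b(1) _ that, of B]] assms b by auto
    have sm: "norm w \<le> \<delta> + \<delta> powr (1 - p) * norm w powr p" for w :: 'b
    proof (cases "norm w \<le> \<delta>")
      case True
      thus ?thesis by (simp add: add_increasing2)
    next
      case False
      hence "1 \<le> norm w / \<delta>" using \<delta> by simp
      hence "(norm w / \<delta>) powr 1 \<le> (norm w / \<delta>) powr p" using assms by (intro powr_mono) auto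
      hence "norm w / \<delta> \<le> norm w powr p / \<delta> powr p" using \<delta> by (simp add: powr_divide)
      hence "norm w \<le> \<delta> powr (1 - p) * norm w powr p" using \<delta> by (simp add: powr_diff field_simps)
      thus ?thesis using \<delta> by simp
    qed
    have "dist (LINT x|M. b x *\<^sub>R U n x) (LINT x|M. b x *\<^sub>R u x) = norm (LINT x|M. b x *\<^sub>R (U n x - u x))"
      using bi[OF Lp_limD(1)[OF assms(3)], of n] bi[OF Lp_limD(2)[OF assms(3)]]
      by (simp add: dist_norm scaleR_diff_right)
    also have "\<dots> \<le> (LINT x|M. norm (b x *\<^sub>R (U n x - u x)))"
      by (rule integral_norm_bound)
    also have "\<dots> \<le> (LINT x|M. B * (\<delta> + \<delta> powr (1 - p) * norm (U n x - u x) powr p))"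
    proof (rule integral_mono)
      show "integrable M (\<lambda>x. norm (b x *\<^sub>R (U n x - u x)))"
        using assms by (intro integrable_norm bi Lp_lim_diff_Lp) auto
      show "norm (b x *\<^sub>R (U n x - u x)) \<le> B * (\<delta> + \<delta> powr (1 - p) * norm (U n x - u x) powr p)" for x
        unfolding norm_scaleR using b(2)[of x] sm B by (intro mult_mono) auto
    qed (use i in auto)
    also have "\<dots> = B * \<delta> * m + B * \<delta> powr (1 - p) * (LINT x|M. norm (U n x - u x) powr p)"
      using i by (simp add: m_def algebra_simps)
    finally show ?thesis .
  qed
  moreover have "B * \<delta> * m \<le> \<epsilon> / 2"
  proof -
    have "B * m \<le> k" unfolding k_def using B m by (intro mult_mono) auto
    hence "\<delta> * (B * m) \<le> \<delta> * k" using \<delta> by (intro mult_left_mono) auto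
    also have "\<dots> = \<epsilon> / 2" using k by (simp add: \<delta>_def)
    finally show ?thesis by (simp add: algebra_simps)
  qed
  ultimately have "\<forall>\<^sub>F n in sequentially. dist (LINT x|M. b x *\<^sub>R U n x) (LINT x|M. b x *\<^sub>R u x) < \<epsilon>"
    by (elim eventually_mono, intro le_less_trans[OF key]) linarith
  thus "\<exists>no. \<forall>n\<ge>no. dist (LINT x|M. b x *\<^sub>R U n x) (LINT x|M. b x *\<^sub>R u x) < \<epsilon>"
    by (simp add: eventually_sequentially)
qed

text \<open>
  By uniform convexity, a vanishing convexity deficit forces convergence. For gradients of nearly
  minimal functions, the midpoints are competitors, and this keeps the deficit small.
\<close>

lemma Lp_lim_of_midpoints:
  fixes U :: "nat \<Rightarrow> 's \<Rightarrow> 'b::euclidean_space"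
  assumes p: "1 < p" and U: "\<And>n. Lp M p (U n)" and u: "Lp M p u"
    and bnd: "\<And>n. (LINT x|M. norm (U n x) powr p) \<le> B"
    and mid: "(\<lambda>n. ((LINT x|M. norm (U n x) powr p) + (LINT x|M. norm (u x) powr p)) / 2
        - (LINT x|M. norm ((U n x + u x) /\<^sub>R 2) powr p)) \<longlonglongrightarrow> 0"
  shows "Lp_lim M p U u"
proof -
  define L where "L = (LINT x|M. norm (u x) powr p)"
  define \<Delta> where "\<Delta> n = ((LINT x|M. norm (U n x) powr p) + L) / 2
        - (LINT x|M. norm ((U n x + u x) /\<^sub>R 2) powr p)" for n
  have L: "L \<ge> 0" unfolding L_def by (rule Bochner_Integration.integral_nonneg) auto
  have B: "B \<ge> 0" using bnd[of 0] by (rule order_trans[rotated]) (rule Bochner_Integration.integral_nonneg, auto)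
  have "(\<lambda>n. LINT x|M. norm (U n x - u x) powr p) \<longlonglongrightarrow> 0"
  proof (rule metric_LIMSEQ_I)
    fix \<epsilon> :: real assume "\<epsilon> > 0"
    define \<eta> where "\<eta> = \<epsilon> / (2 * (B + L + 1))"
    have \<eta>: "\<eta> > 0" using \<open>\<epsilon> > 0\<close> B L by (simp add: \<eta>_def)
    obtain C where C: "C > 0" "\<And>x y :: 'b. norm (x - y) powr p \<le> \<eta> * (norm x powr p + norm y powr p)
       + C * ((norm x powr p + norm y powr p) / 2 - norm ((x + y) /\<^sub>R 2) powr p)"
      using norm_powr_uniformly_convex[OF p \<eta>] by blast
    have "(\<lambda>n. C * \<Delta> n) \<longlonglongrightarrow> C * 0"
      using mid unfolding \<Delta>_def L_def by (intro tendsto_mult tendsto_const)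
    hence "\<forall>\<^sub>F n in sequentially. C * \<Delta> n < \<epsilon> / 2"
      using \<open>\<epsilon> > 0\<close> by (intro order_tendstoD(2)) auto
    moreover have key: "(LINT x|M. norm (U n x - u x) powr p) \<le> \<eta> * (B + L) + C * \<Delta> n" for n
    proof -
      have i: "integrable M (\<lambda>x. norm (U n x) powr p)" "integrable M (\<lambda>x. norm (u x) powr p)"
          "integrable M (\<lambda>x. norm (U n x - u x) powr p)"
          "integrable M (\<lambda>x. norm ((U n x + u x) /\<^sub>R 2) powr p)"
        by (rule LpD(2)[OF U] LpD(2)[OF u] LpD(2)[OF Lp_diff[OF _ U u]]
            LpD(2)[OF Lp_scaleR[OF _ Lp_add[OF _ U u]]] | use p in simp)+
      have "(LINT x|M. norm (U n x - u x) powr p) \<le> (LINT x|M. \<eta> * (norm (U n x) powr p + norm (u x) powr p)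
         + C * ((norm (U n x) powr p + norm (u x) powr p) / 2 - norm ((U n x + u x) /\<^sub>R 2) powr p))"
        using i C(2) by (intro integral_mono) auto
      also have "\<dots> = \<eta> * ((LINT x|M. norm (U n x) powr p) + L) + C * \<Delta> n"
        using i by (simp add: L_def \<Delta>_def)
      also have "\<dots> \<le> \<eta> * (B + L) + C * \<Delta> n"
        using bnd \<eta> by simp
      finally show ?thesis .
    qed
    moreover have "\<eta> * (B + L) < \<epsilon> / 2"
      using \<open>\<epsilon> > 0\<close> B L by (simp add: \<eta>_def field_simps)
    ultimately have "\<forall>\<^sub>F n in sequentially. (LINT x|M. norm (U n x - u x) powr p) < \<epsilon>"
      by (elim eventually_mono, intro le_less_trans[OF key]) linarith
    moreover have "(LINT x|M. norm (U n x - u x) powr p) \<ge> 0" for n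
      by (rule Bochner_Integration.integral_nonneg) auto
    ultimately show "\<exists>no. \<forall>n\<ge>no. dist (LINT x|M. norm (U n x - u x) powr p) 0 < \<epsilon>"
      by (simp add: eventually_sequentially)
  qed
  thus ?thesis using U u by (simp add: Lp_lim_def)
qed

section \<open>Smooth functions with compact support\<close>

lemma C_k_SucI:
  assumes "\<And>x. (f has_derivative D x) (at x)" "\<And>i. i \<in> Basis \<Longrightarrow> C_k k (\<lambda>x. D x i)"
  shows "C_k (Suc k) f"
proof -
  have "frechet_derivative f (at x) = D x" for x
    using frechet_derivative_at[OF assms(1)] by simp
  thus ?thesis using assms by (auto simp: differentiable_def)
qed

lemma C_k_Suc_imp_C_k: "C_k (Suc k) f \<Longrightarrow> C_k k f"
proof (induction k arbitrary: f)
  case 0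
  thus ?case by (simp add: differentiable_imp_continuous_on differentiable_on_def differentiable_at_withinI)
next
  case (Suc k)
  have "\<forall>x. f differentiable (at x)"
    "\<forall>i\<in>Basis. C_k (Suc k) (\<lambda>x. frechet_derivative f (at x) i)"
    using C_k.simps(2)[of "Suc k" f] Suc.prems by blast+
  thus ?case using Suc.IH C_k.simps(2)[of k f] by blast
qed

lemma C_k_has_derivative:
  "C_k (Suc k) f \<Longrightarrow> (f has_derivative frechet_derivative f (at x)) (at x)"
  by (simp add: frechet_derivative_works)

lemma has_derivative_eq_gradient:
  fixes f :: "'a::euclidean_space \<Rightarrow> real"
  assumes "(f has_derivative D) (at x)"
  shows "D h = (\<Sum>i\<in>Basis. D i *\<^sub>R i) \<bullet> h"
proof -
  have "D h = D (\<Sum>i\<in>Basis. (h \<bullet> i) *\<^sub>R i)"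
    by (simp add: euclidean_representation)
  also have "\<dots> = (\<Sum>i\<in>Basis. (h \<bullet> i) * D i)"
    using has_derivative_linear[OF assms] by (simp add: linear_sum linear_scale)
  also have "\<dots> = (\<Sum>i\<in>Basis. D i *\<^sub>R i) \<bullet> h"
    unfolding inner_sum_left by (intro sum.cong) (auto simp: inner_commute)
  finally show ?thesis .
qed

lemma C_k_const [intro]: "C_k k (\<lambda>x. c)"
proof (induction k arbitrary: c)
  case (Suc k)
  show ?case by (rule C_k_SucI[of _ "\<lambda>x h. 0"]) (auto intro: Suc)
qed simp

lemma C_k_add [intro]: "C_k k f \<Longrightarrow> C_k k g \<Longrightarrow> C_k k (\<lambda>x. f x + g x)"
proof (induction k arbitrary: f g)
  case (Suc k)
  show ?case
  proof (rule C_k_SucI)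
    show "((\<lambda>x. f x + g x) has_derivative
        (\<lambda>h. frechet_derivative f (at x) h + frechet_derivative g (at x) h)) (at x)" for x
      by (intro has_derivative_add C_k_has_derivative[OF Suc.prems(1)] C_k_has_derivative[OF Suc.prems(2)])
  qed (use Suc in auto)
qed (auto intro: continuous_on_add)

lemma C_k_mult [intro]: "C_k k f \<Longrightarrow> C_k k g \<Longrightarrow> C_k k (\<lambda>x. f x * g x)"
proof (induction k arbitrary: f g)
  case (Suc k)
  note p = Suc.prems[THEN C_k_Suc_imp_C_k]
  show ?case
  proof (rule C_k_SucI)
    show "((\<lambda>x. f x * g x) has_derivative
        (\<lambda>h. f x * frechet_derivative g (at x) h + frechet_derivative f (at x) h * g x)) (at x)" for x
      by (intro has_derivative_mult C_k_has_derivative[OF Suc.prems(1)] C_k_has_derivative[OF Suc.prems(2)])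
  qed (use Suc.IH Suc.prems p in auto)
qed (auto intro: continuous_on_mult)

lemma C_k_inner_shift [intro]: "C_k k (\<lambda>x. (x - c) \<bullet> d)"
proof (cases k)
  case 0
  then show ?thesis by (auto intro!: continuous_intros)
next
  case (Suc n)
  have "C_k (Suc n) (\<lambda>x. (x - c) \<bullet> d)"
    by (rule C_k_SucI[of _ "\<lambda>x h. h \<bullet> d"]) (auto intro!: derivative_eq_intros)
  then show ?thesis using Suc by simp
qed

text \<open>
  The derivatives of \<open>exp (- 1 / t)\<close> are combinations of the functions below, whose extensions by
  zero are therefore closed under differentiation.
\<close>

definition exp_flat :: "nat \<Rightarrow> real \<Rightarrow> real" where
  "exp_flat j t = (if t > 0 then exp (- inverse t) * inverse t ^ j else 0)"

lemma exp_flat_tendsto_0: "(exp_flat j \<longlongrightarrow> 0) (at 0)"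
proof (rule filterlim_split_at_real)
  show "(exp_flat j \<longlongrightarrow> 0) (at_left 0)"
    by (rule tendsto_eventually) (auto simp: exp_flat_def eventually_at_filter)
  have "((\<lambda>t. inverse t ^ j / exp (inverse t)) \<longlongrightarrow> (0::real)) (at_right 0)"
    by (rule filterlim_compose[OF tendsto_power_div_exp_0 filterlim_inverse_at_top_right])
  moreover have "\<forall>\<^sub>F t in at_right 0. inverse t ^ j / exp (inverse t) = exp_flat j t"
    by (auto simp: exp_flat_def eventually_at_filter exp_minus field_simps)
  ultimately show "(exp_flat j \<longlongrightarrow> 0) (at_right 0)"
    using filterlim_cong by fastforce
qed

lemma exp_flat_deriv:
  "(exp_flat j has_real_derivative (exp_flat (j + 2) t - real j * exp_flat (j + 1) t)) (at t)"
proof -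
  consider "t > 0" | "t < 0" | "t = 0" by linarith
  thus ?thesis
  proof cases
    case 1
    have "((\<lambda>t. exp (- inverse t) * inverse t ^ j) has_real_derivative
        (exp_flat (j + 2) t - real j * exp_flat (j + 1) t)) (at t)"
    proof -
      have e: "((\<lambda>t. exp (- inverse t)) has_real_derivative exp (- inverse t) * (inverse t * inverse t)) (at t)"
        using 1 by (auto intro!: derivative_eq_intros)
      have i: "(inverse has_real_derivative - (inverse t * inverse t)) (at t)"
        using 1 by (auto intro!: derivative_eq_intros)
      show ?thesis
        using DERIV_mult[OF e DERIV_power[OF i, of j]] 1
        by (cases j) (simp_all add: exp_flat_def algebra_simps)
    qed
    thus ?thesis
      by (rule has_field_derivative_transform_within_open[of _ _ _ "{0<..}"])
        (use 1 in \<open>auto simp: exp_flat_def\<close>)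
  next
    case 2
    have "((\<lambda>t. 0) has_real_derivative 0) (at t)" by simp
    hence "(exp_flat j has_real_derivative 0) (at t)"
      by (rule has_field_derivative_transform_within_open[of _ _ _ "{..<0}"])
        (use 2 in \<open>auto simp: exp_flat_def\<close>)
    thus ?thesis using 2 by (simp add: exp_flat_def)
  next
    case 3
    have "\<forall>\<^sub>F h in at 0. exp_flat (Suc j) h = (exp_flat j (0 + h) - exp_flat j 0) / h"
      by (auto simp: exp_flat_def eventually_at_filter divide_inverse)
    hence "((\<lambda>h. (exp_flat j (0 + h) - exp_flat j 0) / h) \<longlongrightarrow> 0) (at 0)"
      using exp_flat_tendsto_0[of "Suc j"] filterlim_cong by fastforce
    hence "(exp_flat j has_real_derivative 0) (at 0)" by (simp add: DERIV_def)
    thus ?thesis using 3 by (simp add: exp_flat_def)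
  qed
qed

definition bump :: "real \<Rightarrow> 'a::euclidean_space \<Rightarrow> 'a \<Rightarrow> real" where
  "bump r c x = exp_flat 0 (1 - (1 / r\<^sup>2) * ((x - c) \<bullet> (x - c)))"

lemma C_k_bump: "C_k k (bump r c)"
proof -
  have "C_k k (\<lambda>x. exp_flat j (1 - a * ((x - c) \<bullet> (x - c))))" for a j
  proof (induction k arbitrary: j)
    case 0
    have "continuous_on UNIV (exp_flat j)"
      using exp_flat_deriv DERIV_isCont by (metis continuous_at_imp_continuous_on)
    moreover have "continuous_on UNIV (\<lambda>x. 1 - a * ((x - c) \<bullet> (x - c)))"
      by (intro continuous_intros)
    ultimately have "continuous_on UNIV (\<lambda>x. exp_flat j (1 - a * ((x - c) \<bullet> (x - c))))"
      by (rule continuous_on_compose2) auto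
    thus ?case by simp
  next
    case (Suc k)
    show ?case
    proof (rule C_k_SucI)
      fix x
      let ?s = "1 - a * ((x - c) \<bullet> (x - c))"
      have "((\<lambda>x. 1 - a * ((x - c) \<bullet> (x - c))) has_derivative (\<lambda>h. (- 2 * a) * ((x - c) \<bullet> h))) (at x)"
        by (auto intro!: derivative_eq_intros simp: inner_commute algebra_simps)
      moreover have "(exp_flat j has_derivative
          (\<lambda>k. (exp_flat (j + 2) ?s + (- real j) * exp_flat (j + 1) ?s) * k)) (at ?s)"
        using exp_flat_deriv[of j ?s] by (simp add: has_field_derivative_def)
      ultimately show "((\<lambda>x. exp_flat j (1 - a * ((x - c) \<bullet> (x - c)))) has_derivative
        (\<lambda>h. (exp_flat (j + 2) ?s + (- real j) * exp_flat (j + 1) ?s) * ((- 2 * a) * ((x - c) \<bullet> h)))) (at x)"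
        by (rule has_derivative_compose)
    qed (intro C_k_mult C_k_add C_k_const C_k_inner_shift Suc)
  qed
  thus ?thesis unfolding bump_def .
qed

lemma bump_nonneg: "bump r c x \<ge> 0"
  by (simp add: bump_def exp_flat_def)

lemma bump_pos_iff:
  assumes "r > 0"
  shows "bump r c x > 0 \<longleftrightarrow> norm (x - c) < r"
proof -
  have "bump r c x > 0 \<longleftrightarrow> (norm (x - c))\<^sup>2 < r\<^sup>2"
    using assms by (simp add: bump_def exp_flat_def power2_norm_eq_inner[symmetric] field_simps)
  also have "\<dots> \<longleftrightarrow> norm (x - c) < r"
    using assms by (metis norm_ge_zero power_less_imp_less_base power_strict_mono less_imp_le zero_less_numeral)
  finally show ?thesis .
qed

lemma bump_eq_0: "r > 0 \<Longrightarrow> norm (x - c) \<ge> r \<Longrightarrow> bump r c x = 0"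
  using bump_pos_iff[of r c x] bump_nonneg[of r c x] by linarith

lemma C_k_imp_continuous: "C_k k f \<Longrightarrow> continuous_on UNIV f"
proof (induction k)
  case (Suc k)
  then show ?case using C_k_Suc_imp_C_k by blast
qed simp

lemma C0_infI:
  assumes "\<And>k. C_k k f" "compact K" "K \<subseteq> \<Omega>" "\<And>x. x \<notin> K \<Longrightarrow> f x = 0"
  shows "f \<in> C0_inf \<Omega>"
proof -
  have sub: "closure (support_on UNIV f) \<subseteq> K"
    using assms by (intro closure_minimal compact_imp_closed) (auto simp: support_on_def)
  moreover have "compact (closure (support_on UNIV f))"
    by (meson assms(2) bounded_subset closed_closure compact_eq_bounded_closed sub)
  ultimately show ?thesis using assms by (auto simp: C0_inf_def)
qed

lemma C0_infD:
  assumes "f \<in> C0_inf \<Omega>"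
  obtains K where "compact K" "K \<subseteq> \<Omega>" "\<And>x. x \<notin> K \<Longrightarrow> f x = 0" "\<And>k. C_k k f"
proof -
  let ?K = "closure (support_on UNIV f)"
  have "f x = 0" if "x \<notin> ?K" for x
    using that closure_subset[of "support_on UNIV f"] unfolding support_on_def by blast
  moreover have "compact ?K" "?K \<subseteq> \<Omega>" "\<And>k. C_k k f" using assms by (simp_all add: C0_inf_def)
  ultimately show ?thesis using that by blast
qed

lemma bump_in_C0_inf:
  assumes "r > 0" "cball c r \<subseteq> \<Omega>"
  shows "bump r c \<in> C0_inf \<Omega>"
proof (rule C0_infI[OF C_k_bump compact_cball assms(2)])
  fix x assume "x \<notin> cball c r"
  hence "norm (x - c) \<ge> r" by (simp add: dist_norm norm_minus_commute)
  thus "bump r c x = 0" by (rule bump_eq_0[OF assms(1)])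
qed

subsection \<open>Integrals of compactly supported functions\<close>

lemma integrable_compact_support:
  fixes f :: "'a::euclidean_space \<Rightarrow> 'b::euclidean_space"
  assumes "continuous_on UNIV f" "compact K" "\<And>x. x \<notin> K \<Longrightarrow> f x = 0"
  shows "integrable lborel f"
proof -
  have "integrable lborel (\<lambda>x. indicator K x *\<^sub>R f x)"
    by (rule borel_integrable_compact) (use assms in \<open>auto intro: continuous_on_subset\<close>)
  moreover have "(\<lambda>x. indicator K x *\<^sub>R f x) = f"
    using assms by (auto simp: indicator_def fun_eq_iff)
  ultimately show ?thesis by simp
qed

lemma bounded_compact_support:
  fixes f :: "'a::euclidean_space \<Rightarrow> 'b::euclidean_space"
  assumes "continuous_on UNIV f" "compact K" "\<And>x. x \<notin> K \<Longrightarrow> f x = 0"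
  obtains B where "B \<ge> 0" "\<And>x. norm (f x) \<le> B"
proof -
  have "bounded (f ` K)"
    using assms by (intro compact_imp_bounded compact_continuous_image) (auto intro: continuous_on_subset)
  then obtain B where B: "B > 0" "\<And>x. x \<in> K \<Longrightarrow> norm (f x) \<le> B"
    by (auto simp: bounded_pos)
  have "norm (f x) \<le> B" for x
    using B assms(3) by (cases "x \<in> K") auto
  thus ?thesis using that B by (meson less_imp_le)
qed

lemma lborel_integral_translate:
  fixes f :: "'a::euclidean_space \<Rightarrow> 'b::euclidean_space"
  assumes "f \<in> borel_measurable borel"
  shows "(LINT x|lborel. f (c + x)) = (LINT x|lborel. f x)"
proof -
  note [measurable] = assms
  have "(LINT x|lborel. f x) = (LINT x|distr lborel borel ((+) c). f x)"
    by (simp add: lborel_distr_plus)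
  also have "\<dots> = (LINT x|lborel. f (c + x))"
    by (subst integral_distr) auto
  finally show ?thesis ..
qed

text \<open>
  By translation invariance, the difference quotients of \<open>F\<close> have integral \<open>0\<close>; they converge to the
  derivative and are bounded with bounded support.
\<close>

lemma integral_partial_derivative_eq_0:
  fixes F :: "'a::euclidean_space \<Rightarrow> real"
  assumes F: "\<And>x. (F has_derivative (\<lambda>h. G x \<bullet> h)) (at x)"
    and G: "continuous_on UNIV G" and K: "compact K" "\<And>x. x \<notin> K \<Longrightarrow> F x = 0" "\<And>x. x \<notin> K \<Longrightarrow> G x = 0"
    and i: "i \<in> Basis"
  shows "(LINT x|lborel. G x \<bullet> i) = 0"
proof -
  have Fc: "continuous_on UNIV F"
    using F has_derivative_continuous by (metis continuous_at_imp_continuous_on)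
  hence [measurable]: "F \<in> borel_measurable borel" by (rule borel_measurable_continuous_onI)
  have [measurable]: "G \<in> borel_measurable borel" using G by (rule borel_measurable_continuous_onI)
  obtain B where B: "B \<ge> 0" "\<And>x. norm (G x) \<le> B"
    using bounded_compact_support[OF G K(1,3)] by blast
  define q where "q n x = real (Suc n) * (F ((1 / real (Suc n)) *\<^sub>R i + x) - F x)" for n x
  define K' where "K' = (\<Union>x\<in>K. \<Union>y\<in>cball 0 1. {x + y})"
  have K': "compact K'" unfolding K'_def by (rule compact_sums'[OF K(1) compact_cball])
  have [measurable]: "K' \<in> sets borel" using K' by (simp add: borel_compact)
  have Fi: "integrable lborel F" by (rule integrable_compact_support[OF Fc K(1,2)])
  have q0: "(LINT x|lborel. q n x) = 0" for n
  proof -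
    have "integrable lborel (\<lambda>x. F ((1 / real (Suc n)) *\<^sub>R i + x))"
    proof -
      have "integrable (distr lborel borel ((+) ((1 / real (Suc n)) *\<^sub>R i))) F"
        using Fi by (simp add: lborel_distr_plus)
      thus ?thesis by (subst (asm) integrable_distr_eq) auto
    qed
    thus ?thesis using Fi unfolding q_def by (simp add: lborel_integral_translate)
  qed
  have "(\<lambda>n. LINT x|lborel. q n x) \<longlonglongrightarrow> (LINT x|lborel. G x \<bullet> i)"
  proof (rule integral_dominated_convergence[where w = "\<lambda>x. indicator K' x *\<^sub>R B"])
    show "integrable lborel (\<lambda>x. indicator K' x *\<^sub>R B)"
      by (rule borel_integrable_compact[OF K']) auto
    show "AE x in lborel. (\<lambda>n. q n x) \<longlonglongrightarrow> G x \<bullet> i"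
    proof (rule AE_I2)
      fix x
      have "((\<lambda>t. x + t *\<^sub>R i) has_derivative (\<lambda>t. t *\<^sub>R i)) (at 0)"
        by (auto intro!: derivative_eq_intros)
      from has_derivative_compose[OF this F]
      have "((\<lambda>t. F (x + t *\<^sub>R i)) has_derivative (\<lambda>t. G x \<bullet> (t *\<^sub>R i))) (at 0)"
        by simp
      moreover have "(\<lambda>t. G x \<bullet> (t *\<^sub>R i)) = (*) (G x \<bullet> i)" by (simp add: fun_eq_iff)
      ultimately have "((\<lambda>t. F (x + t *\<^sub>R i)) has_real_derivative G x \<bullet> i) (at 0)"
        unfolding has_field_derivative_def by simp
      hence "((\<lambda>t. (F (x + t *\<^sub>R i) - F x) / t) \<longlongrightarrow> G x \<bullet> i) (at 0)"
        by (simp add: DERIV_def)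
      moreover have "filterlim (\<lambda>n. 1 / real (Suc n)) (at 0) sequentially"
        unfolding filterlim_at using LIMSEQ_Suc[OF lim_1_over_n] by simp
      ultimately have "(\<lambda>n. (F (x + (1 / real (Suc n)) *\<^sub>R i) - F x) / (1 / real (Suc n))) \<longlonglongrightarrow> G x \<bullet> i"
        by (rule filterlim_compose)
      thus "(\<lambda>n. q n x) \<longlonglongrightarrow> G x \<bullet> i"
        by (simp add: q_def add.commute mult.commute)
    qed
    show "AE x in lborel. norm (q n x) \<le> indicator K' x *\<^sub>R B" for n
    proof (rule AE_I2)
      fix x
      define y where "y = (1 / real (Suc n)) *\<^sub>R i"
      have y: "norm y \<le> 1" using i by (simp add: y_def)
      show "norm (q n x) \<le> indicator K' x *\<^sub>R B"
      proof (cases "x \<in> K'")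
        case True
        have "norm (F (y + x) - F x) \<le> B * norm (y + x - x)"
        proof (rule differentiable_bound[of UNIV F "\<lambda>x h. G x \<bullet> h"])
          show "onorm (\<lambda>h. G z \<bullet> h) \<le> B" for z
          proof (rule onorm_le)
            fix h show "norm (G z \<bullet> h) \<le> B * norm h"
              using Cauchy_Schwarz_ineq2[of "G z" h] B(2)[of z] mult_right_mono[of "norm (G z)" B "norm h"]
              by simp
          qed
        qed (use F in auto)
        also have "norm (y + x - x) = 1 / real (Suc n)" using i by (simp add: y_def)
        finally have "norm (F (y + x) - F x) \<le> B / real (Suc n)" by simp
        hence "real (Suc n) * norm (F (y + x) - F x) \<le> B" by (simp add: field_simps)
        moreover have "norm (q n x) = real (Suc n) * norm (F (y + x) - F x)"
          unfolding q_def y_def norm_mult by simp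
        ultimately show ?thesis using True by simp
      next
        case False
        have "x \<in> K'" if "x \<in> K" unfolding K'_def using that by (intro UN_I[of x] UN_I[of 0]) auto
        hence "x \<notin> K" using False by blast
        moreover have "y + x \<notin> K"
        proof (rule notI)
          assume "y + x \<in> K"
          hence "(y + x) + (- y) \<in> K'" unfolding K'_def using y by (intro UN_I[of "y + x"] UN_I[of "- y"]) auto
          thus False using False by simp
        qed
        ultimately show ?thesis using K False by (simp add: q_def y_def)
      qed
    qed
  qed (auto simp: q_def)
  thus ?thesis using q0 by (simp add: LIMSEQ_const_iff)
qed

subsection \<open>Continuously differentiable functions with compact support\<close>

text \<open>
  Unlike \<open>C0_inf\<close>, this class is closed under composition with \<open>C\<^sup>1\<close> functions that vanish at \<open>0\<close>; the
  gradient is kept as a second component because the Sobolev space is a closure of such pairs.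
\<close>

definition C1c :: "'a::euclidean_space set \<Rightarrow> ('a \<Rightarrow> real) \<Rightarrow> ('a \<Rightarrow> 'a) \<Rightarrow> bool" where
  "C1c \<Omega> \<phi> G \<longleftrightarrow> (\<forall>x. (\<phi> has_derivative (\<lambda>h. G x \<bullet> h)) (at x)) \<and> continuous_on UNIV G \<and>
     (\<exists>K. compact K \<and> K \<subseteq> \<Omega> \<and> (\<forall>x. x \<notin> K \<longrightarrow> \<phi> x = 0))"

lemma gradient_zero_off_support:
  assumes "(\<phi> has_derivative (\<lambda>h. G \<bullet> h)) (at x)" "closed K" "\<And>x. x \<notin> K \<Longrightarrow> \<phi> x = (0::real)" "x \<notin> K"
  shows "G = (0::'a::euclidean_space)"
proof -
  have "((\<lambda>x. 0) has_derivative (\<lambda>h. G \<bullet> h)) (at x)"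
    by (rule has_derivative_transform_within_open[OF assms(1), of "- K"]) (use assms in auto)
  moreover have "((\<lambda>x. 0) has_derivative (\<lambda>h::'a. 0::real)) (at x)" by simp
  ultimately have "(\<lambda>h. G \<bullet> h) = (\<lambda>h. 0)" by (rule has_derivative_unique)
  hence "G \<bullet> G = 0" by meson
  thus ?thesis by simp
qed

lemma C1cE:
  assumes "C1c \<Omega> \<phi> G"
  obtains K B where "compact K" "K \<subseteq> \<Omega>" "\<And>x. x \<notin> K \<Longrightarrow> \<phi> x = 0" "\<And>x. x \<notin> K \<Longrightarrow> G x = 0"
    "\<And>x. (\<phi> has_derivative (\<lambda>h. G x \<bullet> h)) (at x)" "continuous_on UNIV \<phi>" "continuous_on UNIV G"
    "\<And>x. \<bar>\<phi> x\<bar> \<le> B" "\<And>x. norm (G x) \<le> B"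
proof -
  obtain K where K: "compact K" "K \<subseteq> \<Omega>" "\<And>x. x \<notin> K \<Longrightarrow> \<phi> x = 0"
    and d: "\<And>x. (\<phi> has_derivative (\<lambda>h. G x \<bullet> h)) (at x)" and G: "continuous_on UNIV G"
    using assms by (auto simp: C1c_def)
  have \<phi>: "continuous_on UNIV \<phi>"
    using d has_derivative_continuous by (metis continuous_at_imp_continuous_on)
  have G0: "G x = 0" if "x \<notin> K" for x
    using gradient_zero_off_support[OF d compact_imp_closed[OF K(1)] K(3) that] .
  obtain B1 B2 where "\<And>x. norm (\<phi> x) \<le> B1" "\<And>x. norm (G x) \<le> B2"
    using bounded_compact_support[OF \<phi> K(1,3)] bounded_compact_support[OF G K(1) G0] by metis
  thus ?thesis using that[of K "max B1 B2"] K d \<phi> G G0 by (simp add: le_max_iff_disj)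
qed

lemma C0_inf_imp_C1c:
  assumes "\<phi> \<in> C0_inf \<Omega>"
  shows "C1c \<Omega> \<phi> (\<lambda>x. \<Sum>i\<in>Basis. frechet_derivative \<phi> (at x) i *\<^sub>R i)"
proof -
  obtain K where K: "compact K" "K \<subseteq> \<Omega>" "\<And>x. x \<notin> K \<Longrightarrow> \<phi> x = 0" "\<And>k. C_k k \<phi>"
    using C0_infD[OF assms] by metis
  have d: "(\<phi> has_derivative frechet_derivative \<phi> (at x)) (at x)" for x
    by (rule C_k_has_derivative[OF K(4)[of "Suc 0"]])
  have "frechet_derivative \<phi> (at x) h = (\<Sum>i\<in>Basis. frechet_derivative \<phi> (at x) i *\<^sub>R i) \<bullet> h" for x h
    by (rule has_derivative_eq_gradient[OF d])
  moreover have "continuous_on UNIV (\<lambda>x. \<Sum>i\<in>Basis. frechet_derivative \<phi> (at x) i *\<^sub>R i)"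
    using K(4)[of "Suc 0"] by (auto intro!: continuous_intros)
  moreover have "(\<phi> has_derivative (\<lambda>h. (\<Sum>i\<in>Basis. frechet_derivative \<phi> (at x) i *\<^sub>R i) \<bullet> h)) (at x)" for x
    using d[of x] calculation(1)[of x] by (metis (no_types, lifting) ext)
  ultimately show ?thesis unfolding C1c_def using K by blast
qed

subsection \<open>Convolution with a smooth kernel\<close>

definition conv :: "('a::euclidean_space \<Rightarrow> real) \<Rightarrow> ('a \<Rightarrow> real) \<Rightarrow> 'a \<Rightarrow> real" where
  "conv \<rho> u x = (LINT y|lborel. \<rho> (x - y) * u y)"

lemma conv_eq_integral:
  assumes "continuous_on UNIV \<rho>" "continuous_on UNIV u" "\<And>y. y \<notin> cbox a b \<Longrightarrow> u y = 0"
  shows "conv \<rho> u x = integral (cbox a b) (\<lambda>y. \<rho> (x - y) * u y)"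
proof -
  have "continuous_on UNIV (\<lambda>y. \<rho> (x - y) * u y)"
    using assms(2) by (intro continuous_intros continuous_on_compose2[OF assms(1)]) auto
  hence "integrable lborel (\<lambda>y. \<rho> (x - y) * u y)"
    by (rule integrable_compact_support[of _ "cbox a b"]) (use assms in auto)
  hence "conv \<rho> u x = integral UNIV (\<lambda>y. \<rho> (x - y) * u y)"
    by (simp add: conv_def integral_lborel)
  also have "\<dots> = integral UNIV (\<lambda>y. if y \<in> cbox a b then \<rho> (x - y) * u y else 0)"
    using assms(3) by (intro integral_cong) auto
  also have "\<dots> = integral (cbox a b) (\<lambda>y. \<rho> (x - y) * u y)"
    by (rule integral_restrict_UNIV)
  finally show ?thesis .
qed

lemma conv_has_derivative:
  assumes \<rho>: "C_k (Suc 0) \<rho>" and u: "continuous_on UNIV u" "compact K" "\<And>y. y \<notin> K \<Longrightarrow> u y = 0"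
  shows "(conv \<rho> u has_derivative
    (\<lambda>h. \<Sum>i\<in>Basis. (h \<bullet> i) * conv (\<lambda>z. frechet_derivative \<rho> (at z) i) u x)) (at x)"
proof -
  obtain c where "K \<subseteq> cbox (- c) c"
    using bounded_subset_cbox_symmetric[OF compact_imp_bounded[OF u(2)]] by blast
  hence u0: "\<And>y. y \<notin> cbox (- c) c \<Longrightarrow> u y = 0" using u(3) by blast
  define d\<rho> where "d\<rho> i z = frechet_derivative \<rho> (at z) i" for i z
  have \<rho>c: "continuous_on UNIV \<rho>" using C_k_imp_continuous[OF \<rho>] .
  have d\<rho>c: "continuous_on UNIV (d\<rho> i)" if "i \<in> Basis" for i
    using \<rho> that by (simp add: d\<rho>_def[abs_def])
  have d: "(\<rho> has_derivative (\<lambda>h. \<Sum>i\<in>Basis. (h \<bullet> i) * d\<rho> i z)) (at z)" for z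
  proof -
    have d: "(\<rho> has_derivative frechet_derivative \<rho> (at z)) (at z)"
      by (rule C_k_has_derivative[OF \<rho>])
    have "frechet_derivative \<rho> (at z) h = (\<Sum>i\<in>Basis. (h \<bullet> i) * d\<rho> i z)" for h
      unfolding d\<rho>_def
      by (subst has_derivative_eq_gradient[OF d], unfold inner_sum_left inner_scaleR_left, intro sum.cong)
        (simp_all add: inner_commute)
    hence "frechet_derivative \<rho> (at z) = (\<lambda>h. \<Sum>i\<in>Basis. (h \<bullet> i) * d\<rho> i z)" by (rule ext)
    thus ?thesis using d by simp
  qed
  define fx where "fx x y = (\<Sum>i\<in>Basis. (d\<rho> i (x - y) * u y) *\<^sub>R blinfun_inner_left i)" for x y
  have app: "blinfun_apply (fx x y) h = (\<Sum>i\<in>Basis. (h \<bullet> i) * (d\<rho> i (x - y) * u y))" for x y h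
    by (simp add: fx_def blinfun.sum_left blinfun.scaleR_left mult.commute inner_commute)
  have cont: "continuous_on (UNIV \<times> cbox (- c) c) (\<lambda>(x, y). fx x y)"
    unfolding fx_def case_prod_beta
    by (intro continuous_intros continuous_on_compose2[OF d\<rho>c] continuous_on_compose2[OF u(1)]) auto
  have "((\<lambda>x. integral (cbox (- c) c) (\<lambda>y. \<rho> (x - y) * u y)) has_derivative
      blinfun_apply (integral (cbox (- c) c) (fx x))) (at x within UNIV)"
  proof (rule leibniz_rule[OF _ _ cont])
    fix x y
    have "((\<lambda>x. \<rho> (x - y)) has_derivative (\<lambda>h. \<Sum>i\<in>Basis. (h \<bullet> i) * d\<rho> i (x - y))) (at x)"
      by (rule has_derivative_compose[of "\<lambda>x. x - y" "\<lambda>h. h" x UNIV \<rho>, unfolded o_def])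
        (use d in \<open>auto intro!: derivative_eq_intros\<close>)
    from has_derivative_mult_left[OF this, of "u y"]
    show "((\<lambda>x. \<rho> (x - y) * u y) has_derivative blinfun_apply (fx x y)) (at x within UNIV)"
      by (simp add: app[abs_def] sum_distrib_right mult.assoc)
    show "(\<lambda>y. \<rho> (x - y) * u y) integrable_on cbox (- c) c"
      by (intro integrable_continuous continuous_intros continuous_on_compose2[OF \<rho>c]
          continuous_on_subset[OF u(1)]) auto
  qed auto
  moreover have "integral (cbox (- c) c) (\<lambda>y. \<rho> (x - y) * u y) = conv \<rho> u x" for x
    using conv_eq_integral[OF \<rho>c u(1) u0] by simp
  moreover have "blinfun_apply (integral (cbox (- c) c) (fx x)) h =
      (\<Sum>i\<in>Basis. (h \<bullet> i) * conv (d\<rho> i) u x)" for h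
  proof -
    have c1: "continuous_on (cbox (- c) c) (fx x)"
      unfolding fx_def
      by (intro continuous_intros continuous_on_compose2[OF d\<rho>c] continuous_on_subset[OF u(1)]) auto
    have "blinfun_apply (integral (cbox (- c) c) (fx x)) h = integral (cbox (- c) c) (\<lambda>y. blinfun_apply (fx x y) h)"
      by (intro blinfun_apply_integral integrable_continuous c1)
    also have "\<dots> = (\<Sum>i\<in>Basis. integral (cbox (- c) c) (\<lambda>y. (h \<bullet> i) * (d\<rho> i (x - y) * u y)))"
      unfolding app
      by (intro integral_sum integrable_continuous continuous_intros continuous_on_compose2[OF d\<rho>c]
          continuous_on_subset[OF u(1)]) auto
    also have "\<dots> = (\<Sum>i\<in>Basis. (h \<bullet> i) * conv (d\<rho> i) u x)"
      by (intro sum.cong refl) (simp add: conv_eq_integral[OF d\<rho>c u(1) u0])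
    finally show ?thesis .
  qed
  hence "blinfun_apply (integral (cbox (- c) c) (fx x)) = (\<lambda>h. \<Sum>i\<in>Basis. (h \<bullet> i) * conv (d\<rho> i) u x)"
    by blast
  ultimately show ?thesis unfolding d\<rho>_def[abs_def] by simp
qed

lemma C_k_conv:
  assumes "C_k k \<rho>" "continuous_on UNIV u" "compact K" "\<And>y. y \<notin> K \<Longrightarrow> u y = 0"
  shows "C_k k (conv \<rho> u)"
  using assms(1)
proof (induction k arbitrary: \<rho>)
  case 0
  obtain c where "K \<subseteq> cbox (- c) c"
    using bounded_subset_cbox_symmetric[OF compact_imp_bounded[OF assms(3)]] by blast
  hence u0: "\<And>y. y \<notin> cbox (- c) c \<Longrightarrow> u y = 0" using assms(4) by blast
  have \<rho>: "continuous_on UNIV \<rho>" using 0 by simp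
  have "continuous_on UNIV (\<lambda>x. integral (cbox (- c) c) (\<lambda>y. \<rho> (x - y) * u y))"
    unfolding case_prod_beta
    by (intro integral_continuous_on_param, unfold case_prod_beta)
      (intro continuous_intros continuous_on_compose2[OF \<rho>] continuous_on_compose2[OF assms(2)]; simp)
  moreover have "conv \<rho> u = (\<lambda>x. integral (cbox (- c) c) (\<lambda>y. \<rho> (x - y) * u y))"
    using conv_eq_integral[OF \<rho> assms(2) u0] by blast
  ultimately show ?case by simp
next
  case (Suc k)
  have "C_k (Suc 0) \<rho>" using Suc.prems C_k_imp_continuous by auto
  note d = conv_has_derivative[OF this assms(2-4)]
  show ?case
  proof (rule C_k_SucI[OF d])
    fix i :: 'a assume i: "i \<in> Basis"
    have "(\<Sum>j\<in>Basis. (i \<bullet> j) * conv (\<lambda>z. frechet_derivative \<rho> (at z) j) u x)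
        = conv (\<lambda>z. frechet_derivative \<rho> (at z) i) u x" for x
      using i by (simp add: inner_Basis if_distrib[of "\<lambda>c. c * _"] cong: if_cong)
    thus "C_k k (\<lambda>x. \<Sum>j\<in>Basis. (i \<bullet> j) * conv (\<lambda>z. frechet_derivative \<rho> (at z) j) u x)"
      using Suc i by simp
  qed
qed

section \<open>Mollification\<close>

text \<open>
  Near the support \<open>K\<close>, which is enlarged by \<open>1\<close> for this purpose, compactness applies; two points
  closer than \<open>1\<close>, one of them outside the enlarged set, are both outside \<open>K\<close>.
\<close>

lemma uniformly_continuous_compact_support:
  fixes u :: "'a::euclidean_space \<Rightarrow> 'b::euclidean_space"
  assumes u: "continuous_on UNIV u" "compact K" "\<And>x. x \<notin> K \<Longrightarrow> u x = 0" and "e > 0"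
  obtains d where "d > 0" "\<And>x y. dist x y < d \<Longrightarrow> norm (u x - u y) \<le> e"
proof -
  define K' where "K' = (\<Union>x\<in>K. \<Union>y\<in>cball 0 1. {x + y})"
  have K': "compact K'" unfolding K'_def by (rule compact_sums'[OF u(2) compact_cball])
  have KK': "x \<in> K'" if "y \<in> K" "dist x y \<le> 1" for x y
    unfolding K'_def using that by (intro UN_I[of y] UN_I[of "x - y"]) (auto simp: dist_norm norm_minus_commute)
  have "uniformly_continuous_on K' u"
    by (rule compact_uniformly_continuous[OF continuous_on_subset[OF u(1)] K']) auto
  then obtain d where d: "d > 0" "\<And>x y. x \<in> K' \<Longrightarrow> y \<in> K' \<Longrightarrow> dist x y < d \<Longrightarrow> dist (u x) (u y) < e"
    using \<open>e > 0\<close> unfolding uniformly_continuous_on_def by metis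
  have "norm (u x - u y) \<le> e" if xy: "dist x y < min d 1" for x y
  proof (cases "x \<in> K' \<and> y \<in> K'")
    case True
    then show ?thesis using d(2)[of x y] xy by (simp add: dist_norm)
  next
    case False
    have "x \<notin> K"
    proof
      assume "x \<in> K"
      hence "x \<in> K'" "y \<in> K'" using KK'[of x x] KK'[of x y] xy by (auto simp: dist_commute)
      thus False using False by simp
    qed
    moreover have "y \<notin> K"
    proof
      assume "y \<in> K"
      hence "x \<in> K'" "y \<in> K'" using KK'[of y y] KK'[of y x] xy by (auto simp: dist_commute)
      thus False using False by simp
    qed
    ultimately show ?thesis using u(3) \<open>e > 0\<close> by simp
  qed
  thus ?thesis using that[of "min d 1"] d(1) by simp
qed

definition mollifier :: "real \<Rightarrow> 'a::euclidean_space \<Rightarrow> real" where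
  "mollifier r x = bump r 0 x / (LINT y|lborel. bump r (0::'a) y)"

lemma bump_continuous: "continuous_on UNIV (bump r c)"
  using C_k_imp_continuous[OF C_k_bump[of 0]] .

lemma bump_integrable: "r > 0 \<Longrightarrow> integrable lborel (bump r c)"
proof (rule integrable_compact_support[OF bump_continuous compact_cball])
  fix x assume "r > 0" "x \<notin> cball c r"
  thus "bump r c x = 0" by (intro bump_eq_0) (auto simp: dist_norm norm_minus_commute)
qed

lemma bump_integral_pos:
  assumes "r > 0"
  shows "(LINT y|lborel. bump r (0::'a::euclidean_space) y) > 0"
proof -
  have "(LINT y|lborel. bump r (0::'a) y) \<noteq> 0"
  proof
    assume "(LINT y|lborel. bump r (0::'a) y) = 0"
    hence "AE y in lborel. bump r (0::'a) y = 0"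
      using integral_nonneg_eq_0_iff_AE[OF bump_integrable[OF assms, of "0::'a"]] bump_nonneg by auto
    hence "AE y in lborel. y \<notin> ball (0::'a) r"
    proof eventually_elim
      case (elim y)
      thus ?case using bump_pos_iff[OF assms, of 0 y] by simp
    qed
    moreover have "{x. norm x < r} = ball (0::'a) r" by auto
    ultimately have "emeasure lborel (ball (0::'a) r) = 0"
      by (subst (asm) AE_iff_measurable[OF _ refl]) auto
    moreover have "\<not> negligible (ball (0::'a) r)"
      using assms by (simp add: open_not_negligible)
    ultimately show False
      by (simp add: negligible_iff_emeasure0)
  qed
  moreover have "(LINT y|lborel. bump r (0::'a) y) \<ge> 0"
    by (rule Bochner_Integration.integral_nonneg) (simp add: bump_nonneg)
  ultimately show ?thesis by simp
qed

lemma C_k_mollifier: "C_k k (mollifier r)"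
proof -
  have "C_k k (\<lambda>x. bump r 0 x * (1 / (LINT y|lborel. bump r (0::'a) y)))"
    by (intro C_k_mult C_k_bump C_k_const)
  thus ?thesis by (simp add: mollifier_def[abs_def])
qed

lemma mollifier_props:
  assumes "r > 0"
  shows "mollifier r x \<ge> 0" "norm x \<ge> r \<Longrightarrow> mollifier r x = 0" "mollifier r (- x) = mollifier r x"
    "(LINT y|lborel. mollifier r (x - y)) = 1" "integrable lborel (\<lambda>y. mollifier r (x - y))"
proof -
  note pos = bump_integral_pos[OF assms, where 'a = 'a]
  show "mollifier r x \<ge> 0" using pos bump_nonneg[of r 0 x] by (simp add: mollifier_def)
  show "norm x \<ge> r \<Longrightarrow> mollifier r x = 0" using bump_eq_0[OF assms, of x 0] by (simp add: mollifier_def)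
  have sym: "mollifier r (- x) = mollifier r x" for x :: 'a by (simp add: mollifier_def bump_def)
  show "mollifier r (- x) = mollifier r x" by (rule sym)
  have eq: "mollifier r (x - y) = mollifier r (- x + y)" for y using sym[of "x - y"] by simp
  have c: "continuous_on UNIV (mollifier r :: 'a \<Rightarrow> real)" using C_k_imp_continuous[OF C_k_mollifier[of 0]] .
  have "(LINT y|lborel. mollifier r (x - y)) = (LINT y|lborel. mollifier r (y::'a))"
    unfolding eq by (rule lborel_integral_translate) (use c borel_measurable_continuous_onI in blast)
  thus "(LINT y|lborel. mollifier r (x - y)) = 1" using pos by (simp add: mollifier_def)
  show "integrable lborel (\<lambda>y. mollifier r (x - y))"
  proof (rule integrable_compact_support[OF _ compact_cball[of x r]])
    show "continuous_on UNIV (\<lambda>y. mollifier r (x - y))"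
      by (intro continuous_on_compose2[OF c] continuous_intros) auto
    show "mollifier r (x - y) = 0" if "y \<notin> cball x r" for y
      using that bump_eq_0[OF assms, of "x - y" 0] by (simp add: mollifier_def dist_norm)
  qed
qed

lemma mollify_close:
  fixes u :: "'a::euclidean_space \<Rightarrow> real"
  assumes "r > 0" and u: "continuous_on UNIV u" "compact K" "\<And>x. x \<notin> K \<Longrightarrow> u x = 0"
    and e: "\<And>y. dist x y < r \<Longrightarrow> \<bar>u x - u y\<bar> \<le> e"
  shows "\<bar>conv (mollifier r) u x - u x\<bar> \<le> e"
proof -
  note m = mollifier_props[OF assms(1)]
  have c: "continuous_on UNIV (mollifier r :: 'a \<Rightarrow> real)" using C_k_imp_continuous[OF C_k_mollifier[of 0]] .
  have i1: "integrable lborel (\<lambda>y. mollifier r (x - y) * u y)"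
    by (rule integrable_compact_support[OF _ u(2)])
      (use u in \<open>auto intro!: continuous_intros continuous_on_compose2[OF c]\<close>)
  have i2: "integrable lborel (\<lambda>y. mollifier r (x - y) * c)" for c
    using m(5)[of x] by simp
  have "conv (mollifier r) u x - u x = (LINT y|lborel. mollifier r (x - y) * u y) - (LINT y|lborel. mollifier r (x - y) * u x)"
    using m(4,5)[of x] by (simp add: conv_def)
  also have "\<dots> = (LINT y|lborel. mollifier r (x - y) * u y - mollifier r (x - y) * u x)"
    using i1 i2 by simp
  finally have eq: "conv (mollifier r) u x - u x = (LINT y|lborel. mollifier r (x - y) * u y - mollifier r (x - y) * u x)" .
  have "norm (LINT y|lborel. mollifier r (x - y) * u y - mollifier r (x - y) * u x)
      \<le> (LINT y|lborel. norm (mollifier r (x - y) * u y - mollifier r (x - y) * u x))"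
    by (rule integral_norm_bound)
  also have "\<dots> \<le> (LINT y|lborel. mollifier r (x - y) * e)"
  proof (rule integral_mono)
    fix y
    show "norm (mollifier r (x - y) * u y - mollifier r (x - y) * u x) \<le> mollifier r (x - y) * e"
    proof (cases "dist x y < r")
      case True
      have "norm (mollifier r (x - y) * u y - mollifier r (x - y) * u x) = mollifier r (x - y) * \<bar>u x - u y\<bar>"
        using m(1)[of "x - y"] by (simp add: abs_mult abs_minus_commute flip: right_diff_distrib)
      also have "\<dots> \<le> mollifier r (x - y) * e" using m(1)[of "x - y"] e[OF True] by (rule mult_left_mono[rotated])
      finally show ?thesis .
    next
      case False
      then show ?thesis using m(2)[of "x - y"] by (simp add: dist_norm)
    qed
  qed (use i1 i2 in auto)
  also have "\<dots> = e" using m(4,5)[of x] by simp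
  finally show ?thesis by (simp add: eq)
qed

lemma mollify_support:
  assumes "r > 0" "\<And>x. x \<notin> K \<Longrightarrow> u x = 0" "x \<notin> (\<Union>y\<in>K. cball y r)"
  shows "conv (mollifier r) u x = 0"
proof -
  have "mollifier r (x - y) * u y = 0" for y
  proof (cases "y \<in> K")
    case True
    hence "\<not> dist y x \<le> r" using assms(3) by auto
    thus ?thesis using mollifier_props(2)[OF assms(1), of "x - y"] by (simp add: dist_norm norm_minus_commute)
  qed (use assms in auto)
  hence "(\<lambda>y. mollifier r (x - y) * u y) = (\<lambda>y. 0)" by blast
  thus ?thesis by (simp add: conv_def)
qed

lemma integration_by_parts:
  assumes "\<And>x. (\<phi> has_derivative (\<lambda>h. G x \<bullet> h)) (at x)" "continuous_on UNIV G"
    and "\<And>x. (\<psi> has_derivative (\<lambda>h. H x \<bullet> h)) (at x)" "continuous_on UNIV H"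
    and K: "compact K" "\<And>x. x \<notin> K \<Longrightarrow> \<phi> x = (0::real)" and "i \<in> Basis"
  shows "(LINT x|lborel. \<phi> x * (H x \<bullet> i)) = - (LINT x|lborel. (G x \<bullet> i) * \<psi> x)"
proof -
  have G0: "G x = 0" if "x \<notin> K" for x
    using gradient_zero_off_support[OF assms(1) compact_imp_closed[OF K(1)] K(2) that] .
  have c: "continuous_on UNIV \<phi>" "continuous_on UNIV \<psi>"
    using assms(1,3) has_derivative_continuous by (metis continuous_at_imp_continuous_on)+
  have "(LINT x|lborel. (\<phi> x *\<^sub>R H x + \<psi> x *\<^sub>R G x) \<bullet> i) = 0"
  proof (rule integral_partial_derivative_eq_0[where F = "\<lambda>x. \<phi> x * \<psi> x" and K = K])
    show "((\<lambda>x. \<phi> x * \<psi> x) has_derivative (\<lambda>h. (\<phi> x *\<^sub>R H x + \<psi> x *\<^sub>R G x) \<bullet> h)) (at x)" for x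
      using has_derivative_mult[OF assms(1)[of x] assms(3)[of x]] by (simp add: inner_add_left mult.commute)
    show "continuous_on UNIV (\<lambda>x. \<phi> x *\<^sub>R H x + \<psi> x *\<^sub>R G x)"
      by (intro continuous_intros c assms)
  qed (simp_all add: K G0 \<open>i \<in> Basis\<close>)
  moreover have "integrable lborel (\<lambda>x. \<phi> x * (H x \<bullet> i))" "integrable lborel (\<lambda>x. (G x \<bullet> i) * \<psi> x)"
    by (rule integrable_compact_support[OF _ K(1)];
        (intro continuous_intros c assms | simp add: K G0))+
  ultimately show ?thesis by (simp add: inner_add_left mult.commute add_eq_0_iff2)
qed

text \<open>
  Differentiation first falls on the kernel; integration by parts moves it to \<open>u\<close>.
\<close>

lemma mollify_derivative:
  assumes r: "r > 0" and u: "\<And>x. (u has_derivative (\<lambda>h. G x \<bullet> h)) (at x)" "continuous_on UNIV G"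
    and K: "compact K" "\<And>x. x \<notin> K \<Longrightarrow> u x = 0" and i: "i \<in> Basis"
  shows "frechet_derivative (conv (mollifier r) u) (at x) i = conv (mollifier r) (\<lambda>y. G y \<bullet> i) x"
proof -
  let ?\<rho> = "mollifier r :: 'a \<Rightarrow> real"
  let ?d = "\<lambda>z. frechet_derivative ?\<rho> (at z)"
  have uc: "continuous_on UNIV u"
    using u(1) has_derivative_continuous by (metis continuous_at_imp_continuous_on)
  have "frechet_derivative (conv ?\<rho> u) (at x) i = (\<Sum>j\<in>Basis. (i \<bullet> j) * conv (\<lambda>z. ?d z j) u x)"
    by (rule fun_cong[where x = i, OF frechet_derivative_at[OF
          conv_has_derivative[OF C_k_mollifier[of "Suc 0" r] uc K]], symmetric])
  also have "\<dots> = conv (\<lambda>z. ?d z i) u x"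
    using i by (simp add: inner_Basis if_distrib[of "\<lambda>c. c * _"] cong: if_cong)
  also have "\<dots> = (LINT y|lborel. u y * ?d (x - y) i)"
    by (simp add: conv_def mult.commute)
  also have "\<dots> = (LINT y|lborel. (G y \<bullet> i) * ?\<rho> (x - y))"
  proof -
    define Q where "Q y = (\<Sum>j\<in>Basis. ?d y j *\<^sub>R j)" for y
    have d: "(?\<rho> has_derivative ?d y) (at y)" for y
      by (rule C_k_has_derivative[OF C_k_mollifier])
    have Q: "?d y h = Q y \<bullet> h" for y h
      unfolding Q_def by (rule has_derivative_eq_gradient[OF d])
    have Qc: "continuous_on UNIV Q"
      unfolding Q_def using C_k_mollifier[of "Suc 0" r, where 'a = 'a]
      by (intro continuous_intros) simp
    have "((\<lambda>y. ?\<rho> (x - y)) has_derivative (\<lambda>h. (- Q (x - y)) \<bullet> h)) (at y)" for y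
    proof -
      have "((\<lambda>y. x - y) has_derivative (\<lambda>h. - h)) (at y)"
        by (auto intro!: derivative_eq_intros)
      from has_derivative_compose[OF this d] show ?thesis by (simp add: Q)
    qed
    moreover have "continuous_on UNIV (\<lambda>y. - Q (x - y))"
      by (intro continuous_intros continuous_on_compose2[OF Qc]) auto
    ultimately have "(LINT y|lborel. u y * ((- Q (x - y)) \<bullet> i)) = - (LINT y|lborel. (G y \<bullet> i) * ?\<rho> (x - y))"
      by (rule integration_by_parts[OF u _ _ K i])
    thus ?thesis by (simp add: Q)
  qed
  also have "\<dots> = conv ?\<rho> (\<lambda>y. G y \<bullet> i) x" by (simp add: conv_def mult.commute)
  finally show ?thesis .
qed

text \<open>
  The kernels have support radius below the distance from \<open>K\<close> to the complement of \<open>\<Omega>\<close>, so one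
  compact set \<open>K'\<close> supports all approximations.
\<close>

lemma mollified_approximation:
  assumes "open \<Omega>" "compact K" "K \<subseteq> \<Omega>"
  obtains K' where "compact K'" "K' \<subseteq> \<Omega>" "K \<subseteq> K'"
    "\<And>u e. continuous_on UNIV u \<Longrightarrow> (\<And>x. x \<notin> K \<Longrightarrow> u x = 0) \<Longrightarrow> e > 0 \<Longrightarrow>
       \<exists>\<psi>\<in>C0_inf \<Omega>. (\<forall>x. x \<notin> K' \<longrightarrow> \<psi> x = 0) \<and> (\<forall>x. \<bar>\<psi> x - u x\<bar> \<le> e)"
    "\<And>u G e. (\<And>x. (u has_derivative (\<lambda>h. G x \<bullet> h)) (at x)) \<Longrightarrow> continuous_on UNIV G \<Longrightarrow>
       (\<And>x. x \<notin> K \<Longrightarrow> u x = 0) \<Longrightarrow> e > 0 \<Longrightarrow>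
       \<exists>\<psi>\<in>C0_inf \<Omega>. (\<forall>x. \<bar>\<psi> x - u x\<bar> \<le> e) \<and>
         (\<forall>x. \<forall>i\<in>Basis. \<bar>frechet_derivative \<psi> (at x) i - G x \<bullet> i\<bar> \<le> e)"
proof -
  obtain r0 where r0: "r0 > 0" "(\<Union>x\<in>K. cball x r0) \<subseteq> \<Omega>"
    using compact_subset_open_imp_cball_epsilon_subset[OF assms(2,1,3)] by blast
  define K' where "K' = (\<Union>x\<in>K. \<Union>y\<in>cball 0 r0. {x + y})"
  have K'_eq: "K' = (\<Union>x\<in>K. cball x r0)"
  proof safe
    fix x assume "x \<in> K'"
    thus "x \<in> (\<Union>x\<in>K. cball x r0)" unfolding K'_def by (force simp: dist_norm)
  next
    fix x y assume "x \<in> K" "y \<in> cball x r0"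
    thus "y \<in> K'" unfolding K'_def
      by (intro UN_I[of x] UN_I[of "y - x"]) (auto simp: dist_norm norm_minus_commute)
  qed
  have K': "compact K'" unfolding K'_def by (rule compact_sums'[OF assms(2) compact_cball])
  have in_C0: "conv (mollifier r) u \<in> C0_inf \<Omega>" "\<forall>x. x \<notin> K' \<longrightarrow> conv (mollifier r) u x = 0"
    if u: "continuous_on UNIV u" "\<And>x. x \<notin> K \<Longrightarrow> u x = 0" and r: "0 < r" "r \<le> r0" for u r
  proof -
    have *: "conv (mollifier r) u x = 0" if "x \<notin> K'" for x
    proof (rule mollify_support[OF r(1) u(2)])
      show "x \<notin> (\<Union>y\<in>K. cball y r)" using that r(2) unfolding K'_eq by fastforce
    qed
    show "conv (mollifier r) u \<in> C0_inf \<Omega>"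
      by (rule C0_infI[OF C_k_conv[OF C_k_mollifier u(1) assms(2) u(2)] K' _ *])
        (use r0 K'_eq in auto)
    show "\<forall>x. x \<notin> K' \<longrightarrow> conv (mollifier r) u x = 0" using * by blast
  qed
  show ?thesis
  proof (rule that[OF K'])
    show "K' \<subseteq> \<Omega>" "K \<subseteq> K'" using r0 by (auto simp: K'_eq)
  next
    fix u :: "'a \<Rightarrow> real" and e :: real
    assume u: "continuous_on UNIV u" "\<And>x. x \<notin> K \<Longrightarrow> u x = 0" and e: "e > 0"
    obtain d where d: "d > 0" "\<And>x y. dist x y < d \<Longrightarrow> norm (u x - u y) \<le> e"
      using uniformly_continuous_compact_support[OF u(1) assms(2) u(2) e] by blast
    define r where "r = min d r0"
    have r: "0 < r" "r \<le> r0" "r \<le> d" using d r0 by (auto simp: r_def)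
    have "\<bar>conv (mollifier r) u x - u x\<bar> \<le> e" for x
      by (rule mollify_close[OF r(1) u(1) assms(2) u(2)]) (use d(2)[of x] r in auto)
    thus "\<exists>\<psi>\<in>C0_inf \<Omega>. (\<forall>x. x \<notin> K' \<longrightarrow> \<psi> x = 0) \<and> (\<forall>x. \<bar>\<psi> x - u x\<bar> \<le> e)"
      using in_C0[OF u r(1,2)] by blast
  next
    fix u :: "'a \<Rightarrow> real" and G :: "'a \<Rightarrow> 'a" and e :: real
    assume G: "\<And>x. (u has_derivative (\<lambda>h. G x \<bullet> h)) (at x)" "continuous_on UNIV G"
      and u0: "\<And>x. x \<notin> K \<Longrightarrow> u x = 0" and e: "e > 0"
    have uc: "continuous_on UNIV u"
      using G(1) has_derivative_continuous by (metis continuous_at_imp_continuous_on)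
    have G0: "G x = 0" if "x \<notin> K" for x
      using gradient_zero_off_support[OF G(1) compact_imp_closed[OF assms(2)] u0 that] .
    obtain d where d: "d > 0" "\<And>x y. dist x y < d \<Longrightarrow> norm (u x - u y) \<le> e"
      using uniformly_continuous_compact_support[OF uc assms(2) u0 e] by blast
    obtain d' where d': "d' > 0" "\<And>x y. dist x y < d' \<Longrightarrow> norm (G x - G y) \<le> e"
      using uniformly_continuous_compact_support[OF G(2) assms(2) G0 e] by blast
    define r where "r = min (min d d') r0"
    have r: "0 < r" "r \<le> r0" "r \<le> d" "r \<le> d'" using d d' r0 by (auto simp: r_def)
    have "\<bar>conv (mollifier r) u x - u x\<bar> \<le> e" for x
      by (rule mollify_close[OF r(1) uc assms(2) u0]) (use d(2)[of x] r in auto)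
    moreover have "\<bar>frechet_derivative (conv (mollifier r) u) (at x) i - G x \<bullet> i\<bar> \<le> e" if i: "i \<in> Basis" for x i
    proof (subst mollify_derivative[OF r(1) G assms(2) _ i], erule u0, rule mollify_close[where u = "\<lambda>y. G y \<bullet> i", OF r(1) _ assms(2)])
      show "continuous_on UNIV (\<lambda>y. G y \<bullet> i)" by (intro continuous_intros G(2))
      show "\<bar>G x \<bullet> i - G y \<bullet> i\<bar> \<le> e" if "dist x y < r" for y
      proof -
        have "\<bar>G x \<bullet> i - G y \<bullet> i\<bar> \<le> norm (G x - G y)"
          using Basis_le_norm[OF i, of "G x - G y"] by (simp add: inner_diff_left)
        thus ?thesis using d'(2)[of x y] that r by simp
      qed
    qed (simp add: G0)
    ultimately show "\<exists>\<psi>\<in>C0_inf \<Omega>. (\<forall>x. \<bar>\<psi> x - u x\<bar> \<le> e) \<and>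
         (\<forall>x. \<forall>i\<in>Basis. \<bar>frechet_derivative \<psi> (at x) i - G x \<bullet> i\<bar> \<le> e)"
      using in_C0(1)[OF uc u0 r(1,2)] by blast
  qed
qed

section \<open>Weak gradients\<close>

lemma continuous_measurable_lebesgue_on:
  fixes f :: "'a::euclidean_space \<Rightarrow> 'b::euclidean_space"
  assumes "continuous_on UNIV f"
  shows "f \<in> borel_measurable (lebesgue_on \<Omega>)" "f \<in> borel_measurable lebesgue"
proof -
  have "f \<in> borel_measurable lborel" using borel_measurable_continuous_onI[OF assms] by simp
  thus "f \<in> borel_measurable lebesgue" by (rule measurable_completion)
  thus "f \<in> borel_measurable (lebesgue_on \<Omega>)" by (rule measurable_restrict_space1)
qed

lemma integral_lebesgue_on_support:
  fixes f :: "'a::euclidean_space \<Rightarrow> 'b::euclidean_space"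
  assumes "open \<Omega>" "\<And>x. x \<notin> \<Omega> \<Longrightarrow> f x = 0"
  shows "(LINT x|lebesgue_on \<Omega>. f x) = (LINT x|lebesgue. f x)"
proof -
  have "(LINT x|lebesgue_on \<Omega>. f x) = (LINT x|lebesgue. indicator \<Omega> x *\<^sub>R f x)"
    using assms(1) by (intro integral_restrict_space) auto
  also have "(\<lambda>x. indicator \<Omega> x *\<^sub>R f x) = f"
    using assms(2) by (auto simp: indicator_def fun_eq_iff)
  finally show ?thesis .
qed

lemma integrable_lebesgue_on_support:
  fixes f :: "'a::euclidean_space \<Rightarrow> 'b::euclidean_space"
  assumes "open \<Omega>" "\<And>x. x \<notin> \<Omega> \<Longrightarrow> f x = 0" "integrable lebesgue f"
  shows "integrable (lebesgue_on \<Omega>) f"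
proof -
  have "(\<lambda>x. indicator \<Omega> x *\<^sub>R f x) = f"
    using assms(2) by (auto simp: indicator_def fun_eq_iff)
  thus ?thesis using assms by (subst integrable_restrict_space) auto
qed

lemma locally_integrable_times_test:
  fixes g :: "'a::euclidean_space \<Rightarrow> real"
  assumes "open \<Omega>" "locally_integrable \<Omega> g" "compact K" "K \<subseteq> \<Omega>"
    and u: "continuous_on UNIV u" "\<And>x. x \<notin> K \<Longrightarrow> u x = 0"
  shows "integrable (lebesgue_on \<Omega>) (\<lambda>x. g x * u x)"
    and "(LINT x|lebesgue_on \<Omega>. g x * u x) = (LINT x|lebesgue. (indicator K x *\<^sub>R g x) * u x)"
proof -
  have i: "integrable lebesgue (\<lambda>x. indicator K x *\<^sub>R g x)"
    using assms unfolding locally_integrable_def set_integrable_def by blast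
  have eq: "(\<lambda>x. g x * u x) = (\<lambda>x. (indicator K x *\<^sub>R g x) * u x)"
    using u(2) by (auto simp: indicator_def fun_eq_iff)
  have z: "g x * u x = 0" if "x \<notin> \<Omega>" for x using that assms(4) u(2)[of x] by auto
  obtain B where "\<And>x. norm (u x) \<le> B"
    using bounded_compact_support[OF u(1) assms(3) u(2)] by blast
  hence "integrable lebesgue (\<lambda>x. (indicator K x *\<^sub>R g x) * u x)"
    using i continuous_measurable_lebesgue_on(2)[OF u(1)]
    by (intro integrable_mult_AE_bounded[where B = B]) auto
  thus "integrable (lebesgue_on \<Omega>) (\<lambda>x. g x * u x)"
    using integrable_lebesgue_on_support[OF assms(1), of "\<lambda>x. g x * u x"] z eq by simp
  show "(LINT x|lebesgue_on \<Omega>. g x * u x) = (LINT x|lebesgue. (indicator K x *\<^sub>R g x) * u x)"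
    using integral_lebesgue_on_support[OF assms(1), of "\<lambda>x. g x * u x"] z eq by simp
qed

lemma fundamental_lemma_continuous:
  fixes g :: "'a::euclidean_space \<Rightarrow> real"
  assumes "open \<Omega>" "locally_integrable \<Omega> g"
    and test: "\<And>\<phi>. \<phi> \<in> C0_inf \<Omega> \<Longrightarrow> (LINT x|lebesgue_on \<Omega>. g x * \<phi> x) = 0"
    and K: "compact K" "K \<subseteq> \<Omega>" and u: "continuous_on UNIV u" "\<And>x. x \<notin> K \<Longrightarrow> u x = 0"
  shows "(LINT x|lebesgue. (indicator K x *\<^sub>R g x) * u x) = 0"
proof -
  obtain K' where K': "compact K'" "K' \<subseteq> \<Omega>" "K \<subseteq> K'" and
    moll: "\<And>u e. continuous_on UNIV u \<Longrightarrow> (\<And>x. x \<notin> K \<Longrightarrow> u x = 0) \<Longrightarrow> e > 0 \<Longrightarrow>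
       \<exists>\<psi>\<in>C0_inf \<Omega>. (\<forall>x. x \<notin> K' \<longrightarrow> \<psi> x = 0) \<and> (\<forall>x. \<bar>\<psi> x - u x\<bar> \<le> e)"
    by (rule mollified_approximation[OF assms(1) K]) blast
  have "\<forall>n. \<exists>\<psi>. \<psi> \<in> C0_inf \<Omega> \<and> (\<forall>x. x \<notin> K' \<longrightarrow> \<psi> x = 0) \<and> (\<forall>x. \<bar>\<psi> x - u x\<bar> \<le> inverse (real (Suc n)))"
    using moll[OF u] by (meson inverse_positive_iff_positive of_nat_0_less_iff zero_less_Suc)
  then obtain \<psi> where \<psi>: "\<And>n. \<psi> n \<in> C0_inf \<Omega>" "\<And>n x. x \<notin> K' \<Longrightarrow> \<psi> n x = 0"
      "\<And>n x. \<bar>\<psi> n x - u x\<bar> \<le> inverse (real (Suc n))"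
    by metis
  define gK where "gK x = indicator K' x *\<^sub>R g x" for x
  have gK: "integrable lebesgue gK"
    using assms(2) K' unfolding gK_def locally_integrable_def set_integrable_def by blast
  have uK': "\<And>x. x \<notin> K' \<Longrightarrow> u x = 0" using u(2) K'(3) by blast
  obtain B where B: "\<And>x. norm (u x) \<le> B"
    using bounded_compact_support[OF u(1) K(1) u(2)] by blast
  have \<psi>c: "continuous_on UNIV (\<psi> n)" for n
    using C0_infD[OF \<psi>(1)[of n]] C_k_imp_continuous by metis
  have m: "u \<in> borel_measurable lebesgue" "\<psi> n \<in> borel_measurable lebesgue" for n
    using u(1) \<psi>c by (simp_all add: continuous_measurable_lebesgue_on(2))
  have lim: "(\<lambda>n. \<psi> n x) \<longlonglongrightarrow> u x" for x
  proof -
    have "(\<lambda>n. \<bar>\<psi> n x - u x\<bar>) \<longlonglongrightarrow> 0"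
      by (rule tendsto_sandwich[OF _ _ tendsto_const LIMSEQ_inverse_real_of_nat])
        (use \<psi>(3) in auto)
    thus ?thesis by (simp add: LIM_zero_iff tendsto_rabs_zero_iff)
  qed
  have "(\<lambda>n. LINT x|lebesgue. gK x * \<psi> n x) \<longlonglongrightarrow> (LINT x|lebesgue. gK x * u x)"
  proof (rule integral_dominated_convergence[where w = "\<lambda>x. \<bar>gK x\<bar> * (B + 1)"])
    show "AE x in lebesgue. (\<lambda>n. gK x * \<psi> n x) \<longlonglongrightarrow> gK x * u x"
      by (intro AE_I2 tendsto_intros lim)
    show "AE x in lebesgue. norm (gK x * \<psi> n x) \<le> \<bar>gK x\<bar> * (B + 1)" for n
    proof (rule AE_I2)
      fix x
      have "inverse (real (Suc n)) \<le> 1" by (simp add: inverse_le_1_iff)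
      hence "\<bar>\<psi> n x\<bar> \<le> B + 1" using \<psi>(3)[of n x] B[of x] by (simp del: of_nat_Suc)
      thus "norm (gK x * \<psi> n x) \<le> \<bar>gK x\<bar> * (B + 1)" by (simp add: abs_mult mult_left_mono)
    qed
  qed (use gK in \<open>auto intro!: borel_measurable_times m\<close>)
  moreover have "(LINT x|lebesgue. gK x * \<psi> n x) = 0" for n
    using locally_integrable_times_test(2)[OF assms(1,2)  K'(1,2) \<psi>c[of n] \<psi>(2)[where n = n]] test[OF \<psi>(1)[of n]]
    by (simp add: gK_def)
  ultimately have "(LINT x|lebesgue. gK x * u x) = 0"
    by (simp add: LIMSEQ_const_iff)
  moreover have "(\<lambda>x. gK x * u x) = (\<lambda>x. (indicator K x *\<^sub>R g x) * u x)"
    using u(2) K'(3) by (auto simp: gK_def indicator_def fun_eq_iff)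
  ultimately show ?thesis by simp
qed

text \<open>
  If smooth functions were enough to represent \<open>sgn g\<close> on \<open>K\<close>, the test would give \<open>\<integral> |g| = 0\<close>. By
  measurability, \<open>sgn g\<close> is an almost everywhere limit of continuous functions, which are
  truncated to \<open>[-1, 1]\<close> and cut off outside a neighbourhood of \<open>K\<close>.
\<close>

lemma fundamental_lemma_compact:
  fixes g :: "'a::euclidean_space \<Rightarrow> real"
  assumes "open \<Omega>" "locally_integrable \<Omega> g"
    and test: "\<And>\<phi>. \<phi> \<in> C0_inf \<Omega> \<Longrightarrow> (LINT x|lebesgue_on \<Omega>. g x * \<phi> x) = 0"
    and K: "compact K" "K \<subseteq> \<Omega>"
  shows "AE x in lebesgue. indicator K x *\<^sub>R g x = 0"
proof (cases "K = {}")
  case False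
  obtain r where r: "r > 0" "(\<Union>x\<in>K. cball x r) \<subseteq> \<Omega>"
    using compact_subset_open_imp_cball_epsilon_subset[OF K(1) assms(1) K(2)] by blast
  define K' where "K' = {x. infdist x K \<le> r}"
  have "compact K'" unfolding K'_def by (rule compact_infdist_le[OF False K(1) r(1)])
  have "K' \<subseteq> \<Omega>"
  proof
    fix x assume "x \<in> K'"
    obtain y where y: "y \<in> K" "infdist x K = dist x y"
      using infdist_attains_inf[OF compact_imp_closed[OF K(1)] False] by blast
    hence "x \<in> cball y r" using \<open>x \<in> K'\<close> by (simp add: K'_def dist_commute)
    thus "x \<in> \<Omega>" using r(2) y(1) by blast
  qed
  have "K \<subseteq> K'" using r by (auto simp: K'_def)
  \<comment> \<open>A continuous cutoff function, \<open>1\<close> on \<open>K\<close> and \<open>0\<close> outside \<open>K'\<close>.\<close>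
  define \<theta> where "\<theta> x = max 0 (1 - infdist x K / r)" for x
  have \<theta>: "continuous_on UNIV \<theta>" "\<bar>\<theta> x\<bar> \<le> 1" "x \<notin> K' \<Longrightarrow> \<theta> x = 0" "x \<in> K \<Longrightarrow> \<theta> x = 1" for x
  proof -
    show "continuous_on UNIV \<theta>"
      unfolding \<theta>_def using r(1) by (intro continuous_intros) auto
    have "infdist x K / r \<ge> 0" using r(1) infdist_nonneg[of x K] by simp
    thus "\<bar>\<theta> x\<bar> \<le> 1" by (simp add: \<theta>_def)
    show "x \<notin> K' \<Longrightarrow> \<theta> x = 0" "x \<in> K \<Longrightarrow> \<theta> x = 1"
      using r(1) by (simp_all add: \<theta>_def K'_def)
  qed
  define gK where "gK x = indicator K' x *\<^sub>R g x" for x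
  have gK: "integrable lebesgue gK" "integrable lebesgue (\<lambda>x. indicator K x *\<^sub>R g x)"
    using assms(2) K \<open>compact K'\<close> \<open>K' \<subseteq> \<Omega>\<close>
    unfolding gK_def locally_integrable_def set_integrable_def by blast+
  define h where "h x = sgn (indicator K x *\<^sub>R g x)" for x
  have h: "h \<in> borel_measurable lebesgue"
    unfolding h_def sgn_real_def using borel_measurable_integrable[OF gK(2)] by measurable
  hence "h measurable_on UNIV"
    by (simp add: lebesgue_measurable_imp_measurable_on)
  then obtain N H where N: "negligible N" and H: "\<And>n. continuous_on UNIV (H n)"
      "\<And>x. x \<notin> N \<Longrightarrow> (\<lambda>n. H n x) \<longlonglongrightarrow> h x"
    unfolding measurable_on_def by auto
  have hb: "- 1 \<le> h x" "h x \<le> 1" for x by (auto simp: h_def sgn_real_def)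
  define c where "c n x = max (- 1) (min 1 (H n x))" for n x
  have c: "continuous_on UNIV (c n)" "\<bar>c n x\<bar> \<le> 1" "x \<notin> N \<Longrightarrow> (\<lambda>n. c n x) \<longlonglongrightarrow> h x" for n x
  proof -
    show "continuous_on UNIV (c n)" unfolding c_def by (intro continuous_intros H)
    show "\<bar>c n x\<bar> \<le> 1" by (auto simp: c_def)
    assume "x \<notin> N"
    hence "(\<lambda>n. c n x) \<longlonglongrightarrow> max (- 1) (min 1 (h x))"
      unfolding c_def by (intro tendsto_intros H)
    thus "(\<lambda>n. c n x) \<longlonglongrightarrow> h x" using hb[of x] by simp
  qed
  have m: "\<theta> \<in> borel_measurable lebesgue" "c n \<in> borel_measurable lebesgue" for n
    using \<theta>(1) c(1) by (simp_all add: continuous_measurable_lebesgue_on(2))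
  have AEN: "AE x in lebesgue. x \<notin> N"
    using N by (intro AE_not_in) (simp add: negligible_iff_null_sets)
  have "(\<lambda>n. LINT x|lebesgue. gK x * (\<theta> x * c n x)) \<longlonglongrightarrow> (LINT x|lebesgue. gK x * (\<theta> x * h x))"
  proof (rule integral_dominated_convergence[where w = "\<lambda>x. \<bar>gK x\<bar>"])
    show "AE x in lebesgue. (\<lambda>n. gK x * (\<theta> x * c n x)) \<longlonglongrightarrow> gK x * (\<theta> x * h x)"
      using AEN by eventually_elim (intro tendsto_intros c)
    show "AE x in lebesgue. norm (gK x * (\<theta> x * c n x)) \<le> \<bar>gK x\<bar>" for n
    proof (rule AE_I2)
      fix x
      have "\<bar>\<theta> x * c n x\<bar> \<le> 1 * 1" unfolding abs_mult using \<theta>(2) c(2) by (intro mult_mono) auto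
      thus "norm (gK x * (\<theta> x * c n x)) \<le> \<bar>gK x\<bar>" by (simp add: abs_mult mult_left_le)
    qed
  qed (use gK in \<open>auto intro!: borel_measurable_times m h\<close>)
  moreover have "(LINT x|lebesgue. gK x * (\<theta> x * c n x)) = 0" for n
    unfolding gK_def
  proof (rule fundamental_lemma_continuous[OF assms(1-2) test \<open>compact K'\<close> \<open>K' \<subseteq> \<Omega>\<close>])
    show "continuous_on UNIV (\<lambda>x. \<theta> x * c n x)" by (intro continuous_on_mult \<theta>(1) c(1))
  qed (simp_all add: \<theta>(3))
  ultimately have "(LINT x|lebesgue. gK x * (\<theta> x * h x)) = 0"
    by (simp add: LIMSEQ_const_iff)
  moreover have "gK x * (\<theta> x * h x) = \<bar>indicator K x *\<^sub>R g x\<bar>" for x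
    using \<theta>(4)[of x] \<open>K \<subseteq> K'\<close> by (auto simp: gK_def h_def indicator_def sgn_real_def)
  ultimately have "(LINT x|lebesgue. \<bar>indicator K x *\<^sub>R g x\<bar>) = 0" by simp
  hence "AE x in lebesgue. \<bar>indicator K x *\<^sub>R g x\<bar> = 0"
    using gK(2) by (subst (asm) integral_nonneg_eq_0_iff_AE) auto
  thus ?thesis by simp
qed simp

lemma fundamental_lemma:
  fixes g :: "'a::euclidean_space \<Rightarrow> real"
  assumes "open \<Omega>" "locally_integrable \<Omega> g"
    and test: "\<And>\<phi>. \<phi> \<in> C0_inf \<Omega> \<Longrightarrow> (LINT x|lebesgue_on \<Omega>. g x * \<phi> x) = 0"
  shows "AE x in lebesgue_on \<Omega>. g x = 0"
proof -
  obtain C :: "nat \<Rightarrow> 'a set" where C: "\<And>n. compact (C n)" "\<And>n. C n \<subseteq> \<Omega>" "\<Union>(range C) = \<Omega>"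
    using open_Union_compact_subsets[OF assms(1)] by metis
  have "AE x in lebesgue. \<forall>n. indicator (C n) x *\<^sub>R g x = 0"
    unfolding AE_all_countable by (intro allI fundamental_lemma_compact[OF assms(1,2) test C(1,2)])
  hence "AE x in lebesgue. x \<in> \<Omega> \<longrightarrow> g x = 0"
  proof eventually_elim
    case (elim x)
    show ?case
    proof
      assume "x \<in> \<Omega>"
      then obtain n where "x \<in> C n" using C(3) by blast
      thus "g x = 0" using elim[rule_format, of n] by simp
    qed
  qed
  thus ?thesis using assms(1) by (subst AE_restrict_space_iff) auto
qed

lemma locally_integrable_inner:
  fixes g :: "'a::euclidean_space \<Rightarrow> 'a"
  assumes "locally_integrable \<Omega> g"
  shows "locally_integrable \<Omega> (\<lambda>x. g x \<bullet> i)"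
  unfolding locally_integrable_def set_integrable_def
proof safe
  fix K assume "compact K" "K \<subseteq> \<Omega>"
  hence "integrable lebesgue (\<lambda>x. (indicator K x *\<^sub>R g x) \<bullet> i)"
    using assms unfolding locally_integrable_def set_integrable_def by (intro integrable_inner_left) blast
  thus "integrable lebesgue (\<lambda>x. indicator K x *\<^sub>R (g x \<bullet> i))" by simp
qed

lemma locally_integrable_diff:
  assumes "locally_integrable \<Omega> g" "locally_integrable \<Omega> h"
  shows "locally_integrable \<Omega> (\<lambda>x. g x - h x)"
  using assms unfolding locally_integrable_def by (simp add: set_integral_diff)

lemma locally_integrable_of_integrable:
  assumes "open \<Omega>" "integrable (lebesgue_on \<Omega>) g"
  shows "locally_integrable \<Omega> g"
  unfolding locally_integrable_def
proof safe
  fix K assume K: "compact K" "K \<subseteq> \<Omega>"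
  have "set_integrable lebesgue \<Omega> g"
    using assms unfolding set_integrable_def by (subst (asm) integrable_restrict_space) auto
  thus "set_integrable lebesgue K g"
    by (rule set_integrable_subset) (use K in \<open>auto simp: compact_imp_closed borel_closed\<close>)
qed

lemma C0_inf_partial:
  assumes "\<phi> \<in> C0_inf \<Omega>" "i \<in> Basis"
  obtains K where "compact K" "K \<subseteq> \<Omega>" "continuous_on UNIV \<phi>" "\<And>x. x \<notin> K \<Longrightarrow> \<phi> x = 0"
    "continuous_on UNIV (\<lambda>x. frechet_derivative \<phi> (at x) i)" "\<And>x. x \<notin> K \<Longrightarrow> frechet_derivative \<phi> (at x) i = 0"
proof -
  let ?G = "\<lambda>x. \<Sum>i\<in>Basis. frechet_derivative \<phi> (at x) i *\<^sub>R i"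
  obtain K B where K: "compact K" "K \<subseteq> \<Omega>" "\<And>x. x \<notin> K \<Longrightarrow> \<phi> x = 0" "\<And>x. x \<notin> K \<Longrightarrow> ?G x = 0"
      "continuous_on UNIV \<phi>" "continuous_on UNIV ?G"
    using C1cE[OF C0_inf_imp_C1c[OF assms(1)]] by metis
  have G: "frechet_derivative \<phi> (at x) i = ?G x \<bullet> i" for x
    using assms(2) by simp
  have "continuous_on UNIV (\<lambda>x. ?G x \<bullet> i)" by (intro continuous_on_inner K(6) continuous_on_const)
  thus ?thesis using that[OF K(1,2,5,3)] K(4) unfolding G by simp
qed

lemma has_weak_gradient_unique:
  assumes "open \<Omega>" and u: "has_weak_gradient \<Omega> u g" and v: "has_weak_gradient \<Omega> v h"
    and "u \<in> borel_measurable (lebesgue_on \<Omega>)" "v \<in> borel_measurable (lebesgue_on \<Omega>)"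
    and ae: "AE x in lebesgue_on \<Omega>. u x = v x"
  shows "AE x in lebesgue_on \<Omega>. g x = h x"
proof -
  have gh: "locally_integrable \<Omega> g" "locally_integrable \<Omega> h"
    using u v by (auto simp: has_weak_gradient_def)
  have "AE x in lebesgue_on \<Omega>. (g x - h x) \<bullet> i = 0" if i: "i \<in> Basis" for i
  proof (rule fundamental_lemma[OF assms(1)])
    show "locally_integrable \<Omega> (\<lambda>x. (g x - h x) \<bullet> i)"
      by (intro locally_integrable_inner locally_integrable_diff gh)
    fix \<phi> assume \<phi>: "\<phi> \<in> C0_inf \<Omega>"
    obtain K where K: "compact K" "K \<subseteq> \<Omega>" "continuous_on UNIV \<phi>" "\<And>x. x \<notin> K \<Longrightarrow> \<phi> x = 0"
      "continuous_on UNIV (\<lambda>x. frechet_derivative \<phi> (at x) i)"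
      using C0_inf_partial[OF \<phi> i] by metis
    note t = locally_integrable_times_test(1)[OF assms(1) _ K(1,2,3,4)]
    have m: "(\<lambda>x. frechet_derivative \<phi> (at x) i) \<in> borel_measurable (lebesgue_on \<Omega>)"
      using K(5) by (rule continuous_measurable_lebesgue_on)
    have "(LINT x|lebesgue_on \<Omega>. ((g x - h x) \<bullet> i) * \<phi> x)
        = (LINT x|lebesgue_on \<Omega>. (g x \<bullet> i) * \<phi> x) - (LINT x|lebesgue_on \<Omega>. (h x \<bullet> i) * \<phi> x)"
      using t[OF locally_integrable_inner[OF gh(1)]] t[OF locally_integrable_inner[OF gh(2)]]
      by (simp add: inner_diff_left left_diff_distrib)
    also have "\<dots> = (LINT x|lebesgue_on \<Omega>. v x * frechet_derivative \<phi> (at x) i)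
        - (LINT x|lebesgue_on \<Omega>. u x * frechet_derivative \<phi> (at x) i)"
      using u v \<phi> i by (simp add: has_weak_gradient_def)
    also have "\<dots> = 0"
    proof -
      have "(LINT x|lebesgue_on \<Omega>. v x * frechet_derivative \<phi> (at x) i)
        = (LINT x|lebesgue_on \<Omega>. u x * frechet_derivative \<phi> (at x) i)"
        by (intro integral_cong_AE borel_measurable_times assms m)
          (use ae in \<open>eventually_elim, simp\<close>)
      thus ?thesis by simp
    qed
    finally show "(LINT x|lebesgue_on \<Omega>. ((g x - h x) \<bullet> i) * \<phi> x) = 0" .
  qed
  hence "AE x in lebesgue_on \<Omega>. \<forall>i\<in>Basis. (g x - h x) \<bullet> i = 0"
    by (simp add: AE_finite_all)
  thus ?thesis
    by eventually_elim (metis euclidean_eqI inner_zero_left right_minus_eq)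
qed

section \<open>Functions of zero boundary trace\<close>

text \<open>
  \<open>W0 \<Omega> p u g\<close> says that \<open>u\<close> belongs to the closure of the test functions and that \<open>g\<close> is its gradient.
  Carrying \<open>g\<close> as an argument avoids the choice in \<open>weak_grad\<close>.
\<close>

definition W0 :: "'a::euclidean_space set \<Rightarrow> real \<Rightarrow> ('a \<Rightarrow> real) \<Rightarrow> ('a \<Rightarrow> 'a) \<Rightarrow> bool" where
  "W0 \<Omega> p u g \<longleftrightarrow> (\<exists>\<phi> G. (\<forall>n::nat. C1c \<Omega> (\<phi> n) (G n)) \<and>
     Lp_lim (lebesgue_on \<Omega>) p \<phi> u \<and> Lp_lim (lebesgue_on \<Omega>) p G g)"

lemma borel_measurable_lebesgue_on_AE:
  fixes f g :: "'a::euclidean_space \<Rightarrow> 'b::euclidean_space"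
  assumes "open \<Omega>" "f \<in> borel_measurable (lebesgue_on \<Omega>)" "AE x in lebesgue_on \<Omega>. f x = g x"
  shows "g \<in> borel_measurable (lebesgue_on \<Omega>)"
proof -
  have S: "\<Omega> \<in> sets lebesgue" using assms(1) by auto
  have ae: "AE x in lebesgue. (if x \<in> \<Omega> then f x else 0) = (if x \<in> \<Omega> then g x else 0)"
    using assms(3) S by (subst (asm) AE_restrict_space_iff) (auto elim!: eventually_mono)
  show ?thesis
    using borel_measurable_AE[OF _ ae] assms(2) S by (simp add: borel_measurable_if)
qed

locale bounded_open =
  fixes \<Omega> :: "'a::euclidean_space set" and p :: real
  assumes open_dom: "open \<Omega>" and bounded_dom: "bounded \<Omega>" and exponent_gt_1: "1 < p"
begin

abbreviation "M \<equiv> lebesgue_on \<Omega>"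

lemma finite_M: "finite_measure M"
  using open_dom bounded_dom by (intro finite_measure_lebesgue_on bounded_set_imp_lmeasurable) auto

lemma exponent_pos: "0 < p" "0 \<le> p" "1 \<le> p"
  using exponent_gt_1 by auto

lemma bounded_imp_Lp:
  fixes f :: "'a \<Rightarrow> 'b::euclidean_space"
  assumes "f \<in> borel_measurable M" "\<And>x. norm (f x) \<le> B"
  shows "Lp M p f"
  by (rule Lp_of_bounded[OF finite_M exponent_pos(2) assms(1)]) (use assms(2) in auto)

lemma C1c_Lp:
  assumes "C1c \<Omega> \<phi> G"
  shows "Lp M p \<phi>" "Lp M p G"
proof -
  obtain K B where K: "continuous_on UNIV \<phi>" "continuous_on UNIV G"
    "\<And>x. \<bar>\<phi> x\<bar> \<le> B" "\<And>x. norm (G x) \<le> B"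
    using C1cE[OF assms] by metis
  show "Lp M p \<phi>" "Lp M p G"
    using K by (auto intro!: bounded_imp_Lp[where B = B] continuous_measurable_lebesgue_on(1))
qed

lemma Lp_limI_inverse:
  fixes U :: "nat \<Rightarrow> 'a \<Rightarrow> 'b::euclidean_space"
  assumes "\<And>n. Lp M p (U n)" "Lp M p u"
    "\<And>n. (LINT x|M. norm (U n x - u x) powr p) \<le> inverse (real (Suc n))"
  shows "Lp_lim M p U u"
  unfolding Lp_lim_def
proof (intro conjI allI assms)
  show "(\<lambda>n. LINT x|M. norm (U n x - u x) powr p) \<longlonglongrightarrow> 0"
    by (rule tendsto_sandwich[OF _ _ tendsto_const LIMSEQ_inverse_real_of_nat])
      (use assms(3) in \<open>auto intro!: always_eventually Bochner_Integration.integral_nonneg\<close>)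
qed

lemma W0_approx:
  "W0 \<Omega> p u g \<longleftrightarrow> Lp M p u \<and> Lp M p g \<and>
    (\<forall>e>0. \<exists>\<phi> G. C1c \<Omega> \<phi> G \<and> (LINT x|M. norm (\<phi> x - u x) powr p) < e \<and>
       (LINT x|M. norm (G x - g x) powr p) < e)"
proof (intro iffI conjI allI impI)
  assume "W0 \<Omega> p u g"
  then obtain \<phi> G where *: "\<And>n::nat. C1c \<Omega> (\<phi> n) (G n)" "Lp_lim M p \<phi> u" "Lp_lim M p G g"
    unfolding W0_def by blast
  show "Lp M p u" "Lp M p g" using Lp_limD(2)[OF *(2)] Lp_limD(2)[OF *(3)] by auto
  fix e :: real assume "e > 0"
  have "\<forall>\<^sub>F n in sequentially. (LINT x|M. norm (\<phi> n x - u x) powr p) < e"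
    using Lp_limD(3)[OF *(2)] \<open>e > 0\<close> by (rule order_tendstoD)
  moreover have "\<forall>\<^sub>F n in sequentially. (LINT x|M. norm (G n x - g x) powr p) < e"
    using Lp_limD(3)[OF *(3)] \<open>e > 0\<close> by (rule order_tendstoD)
  ultimately obtain n where "(LINT x|M. norm (\<phi> n x - u x) powr p) < e"
      "(LINT x|M. norm (G n x - g x) powr p) < e"
    using eventually_happens'[OF sequentially_bot eventually_conj] by blast
  thus "\<exists>\<phi> G. C1c \<Omega> \<phi> G \<and> (LINT x|M. norm (\<phi> x - u x) powr p) < e \<and>
       (LINT x|M. norm (G x - g x) powr p) < e"
    using *(1) by blast
next
  assume *: "Lp M p u \<and> Lp M p g \<and>
    (\<forall>e>0. \<exists>\<phi> G. C1c \<Omega> \<phi> G \<and> (LINT x|M. norm (\<phi> x - u x) powr p) < e \<and>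
       (LINT x|M. norm (G x - g x) powr p) < e)"
  have "\<forall>n::nat. \<exists>\<phi> G. C1c \<Omega> \<phi> G \<and> (LINT x|M. norm (\<phi> x - u x) powr p) < inverse (real (Suc n)) \<and>
       (LINT x|M. norm (G x - g x) powr p) < inverse (real (Suc n))"
    using * by (meson inverse_positive_iff_positive of_nat_0_less_iff zero_less_Suc)
  then obtain \<phi> G where \<phi>: "\<And>n. C1c \<Omega> (\<phi> n) (G n)"
      "\<And>n. (LINT x|M. norm (\<phi> n x - u x) powr p) < inverse (real (Suc n))"
      "\<And>n. (LINT x|M. norm (G n x - g x) powr p) < inverse (real (Suc n))"
    unfolding choice_iff by blast
  have "Lp_lim M p \<phi> u" "Lp_lim M p G g"
    using * C1c_Lp[OF \<phi>(1)] \<phi>(2,3) by (auto intro!: Lp_limI_inverse less_imp_le)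
  thus "W0 \<Omega> p u g" using \<phi>(1) unfolding W0_def by blast
qed

lemma W0_Lp: "W0 \<Omega> p u g \<Longrightarrow> Lp M p u" "W0 \<Omega> p u g \<Longrightarrow> Lp M p g"
  by (auto simp: W0_approx)

lemma W0_measurable:
  "W0 \<Omega> p u g \<Longrightarrow> u \<in> borel_measurable M" "W0 \<Omega> p u g \<Longrightarrow> g \<in> borel_measurable M"
  by (blast dest: W0_Lp LpD)+

lemma C1c_imp_W0: "C1c \<Omega> \<phi> G \<Longrightarrow> W0 \<Omega> p \<phi> G"
  using C1c_Lp[of \<phi> G] unfolding W0_def by (intro exI[of _ "\<lambda>n. \<phi>"] exI[of _ "\<lambda>n. G"]) simp

lemma W0_cong_AE:
  assumes "W0 \<Omega> p u g" "AE x in M. u x = u' x" "AE x in M. g x = g' x"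
  shows "W0 \<Omega> p u' g'"
proof -
  note m = borel_measurable_lebesgue_on_AE[OF open_dom]
  obtain \<phi> G where *: "\<And>n::nat. C1c \<Omega> (\<phi> n) (G n)" "Lp_lim M p \<phi> u" "Lp_lim M p G g"
    using assms(1) unfolding W0_def by blast
  have "Lp_lim M p \<phi> u'" "Lp_lim M p G g'"
    using Lp_lim_cong_AE[OF *(2) m[OF Lp_lim_measurable(2)[OF *(2)] assms(2)] assms(2)]
      Lp_lim_cong_AE[OF *(3) m[OF Lp_lim_measurable(2)[OF *(3)] assms(3)] assms(3)] by auto
  thus ?thesis using *(1) unfolding W0_def by blast
qed

lemma Lp_dist_triangle:
  fixes u v w :: "'a \<Rightarrow> 'b::euclidean_space"
  assumes "Lp M p u" "Lp M p v" "Lp M p w"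
  shows "(LINT x|M. norm (u x - w x) powr p)
    \<le> 2 powr p * ((LINT x|M. norm (u x - v x) powr p) + (LINT x|M. norm (v x - w x) powr p))"
proof -
  have i: "integrable M (\<lambda>x. norm (u x - v x) powr p)" "integrable M (\<lambda>x. norm (v x - w x) powr p)"
    "integrable M (\<lambda>x. norm (u x - w x) powr p)"
    by (intro LpD(2) Lp_diff exponent_pos assms)+
  have "(LINT x|M. norm (u x - w x) powr p)
     \<le> (LINT x|M. 2 powr p * (norm (u x - v x) powr p + norm (v x - w x) powr p))"
  proof (rule integral_mono)
    show "norm (u x - w x) powr p \<le> 2 powr p * (norm (u x - v x) powr p + norm (v x - w x) powr p)" for x
      using norm_powr_add_le[OF exponent_pos(2), of "u x - v x" "v x - w x"] by simp
  qed (use i in auto)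
  thus ?thesis using i by simp
qed

lemma W0_closed:
  assumes "\<And>n::nat. W0 \<Omega> p (U n) (G n)" "Lp_lim M p U u" "Lp_lim M p G g"
  shows "W0 \<Omega> p u g"
  unfolding W0_approx
proof (intro conjI allI impI Lp_limD(2)[OF assms(2)] Lp_limD(2)[OF assms(3)])
  fix e :: real assume "e > 0"
  \<comment> \<open>Two distances below \<open>d\<close> add up, by \<open>Lp_dist_triangle\<close>, to one below \<open>e\<close>.\<close>
  define d where "d = e / (2 powr p * 2)"
  have d: "d > 0" using \<open>e > 0\<close> by (simp add: d_def)
  have "\<forall>\<^sub>F n in sequentially. (LINT x|M. norm (U n x - u x) powr p) < d"
    using Lp_limD(3)[OF assms(2)] d by (rule order_tendstoD)
  moreover have "\<forall>\<^sub>F n in sequentially. (LINT x|M. norm (G n x - g x) powr p) < d"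
    using Lp_limD(3)[OF assms(3)] d by (rule order_tendstoD)
  ultimately obtain n where n: "(LINT x|M. norm (U n x - u x) powr p) < d"
      "(LINT x|M. norm (G n x - g x) powr p) < d"
    using eventually_happens'[OF sequentially_bot eventually_conj] by blast
  obtain \<phi> H where \<phi>: "C1c \<Omega> \<phi> H" "(LINT x|M. norm (\<phi> x - U n x) powr p) < d"
      "(LINT x|M. norm (H x - G n x) powr p) < d"
    using assms(1)[of n] d unfolding W0_approx by blast
  have "2 powr p * (a + b) < e" if "a < d" "b < d" for a b
  proof -
    have "2 powr p * (a + b) < 2 powr p * (d + d)" using that by simp
    thus ?thesis by (simp add: d_def)
  qed
  hence "(LINT x|M. norm (\<phi> x - u x) powr p) < e" "(LINT x|M. norm (H x - g x) powr p) < e"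
    using Lp_dist_triangle[OF C1c_Lp(1)[OF \<phi>(1)] Lp_limD(1)[OF assms(2)] Lp_limD(2)[OF assms(2)], of n]
      Lp_dist_triangle[OF C1c_Lp(2)[OF \<phi>(1)] Lp_limD(1)[OF assms(3)] Lp_limD(2)[OF assms(3)], of n]
      n \<phi>(2,3) by (meson le_less_trans)+
  thus "\<exists>\<phi> G. C1c \<Omega> \<phi> G \<and> (LINT x|M. norm (\<phi> x - u x) powr p) < e \<and>
       (LINT x|M. norm (G x - g x) powr p) < e"
    using \<phi>(1) by blast
qed

lemma integral_M_eq_lborel:
  fixes f :: "'a \<Rightarrow> real"
  assumes "continuous_on UNIV f" "K \<subseteq> \<Omega>" "\<And>x. x \<notin> K \<Longrightarrow> f x = 0"
  shows "(LINT x|M. f x) = (LINT x|lborel. f x)"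
proof -
  have "(LINT x|M. f x) = (LINT x|lebesgue. f x)"
    by (rule integral_lebesgue_on_support[OF open_dom]) (use assms in blast)
  also have "\<dots> = (LINT x|lborel. f x)"
    using borel_measurable_continuous_onI[OF assms(1)] by (intro integral_completion) simp
  finally show ?thesis .
qed

lemma C1c_integration_by_parts:
  assumes \<phi>: "C1c \<Omega> \<phi> G" and \<psi>: "\<psi> \<in> C0_inf \<Omega>" and i: "i \<in> Basis"
  shows "(LINT x|M. \<phi> x * frechet_derivative \<psi> (at x) i) = - (LINT x|M. (G x \<bullet> i) * \<psi> x)"
proof -
  let ?H = "\<lambda>x. \<Sum>i\<in>Basis. frechet_derivative \<psi> (at x) i *\<^sub>R i"
  obtain K where K: "compact K" "K \<subseteq> \<Omega>" "\<And>x. x \<notin> K \<Longrightarrow> \<phi> x = 0" "\<And>x. x \<notin> K \<Longrightarrow> G x = 0"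
    "\<And>x. (\<phi> has_derivative (\<lambda>h. G x \<bullet> h)) (at x)" "continuous_on UNIV \<phi>" "continuous_on UNIV G"
    using C1cE[OF \<phi>] by metis
  obtain L where L: "\<And>x. (\<psi> has_derivative (\<lambda>h. ?H x \<bullet> h)) (at x)" "continuous_on UNIV \<psi>" "continuous_on UNIV ?H"
    using C1cE[OF C0_inf_imp_C1c[OF \<psi>]] by metis
  have H: "frechet_derivative \<psi> (at x) i = ?H x \<bullet> i" for x
    using i by simp
  have "(LINT x|M. \<phi> x * (?H x \<bullet> i)) = (LINT x|lborel. \<phi> x * (?H x \<bullet> i))"
    by (rule integral_M_eq_lborel[OF _ K(2)]) (intro continuous_intros K L, simp add: K(3))
  also have "\<dots> = - (LINT x|lborel. (G x \<bullet> i) * \<psi> x)"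
    by (rule integration_by_parts[OF K(5,7) L(1,3) K(1,3) i])
  also have "(LINT x|lborel. (G x \<bullet> i) * \<psi> x) = (LINT x|M. (G x \<bullet> i) * \<psi> x)"
    by (rule integral_M_eq_lborel[symmetric, OF _ K(2)]) (intro continuous_intros K L, simp add: K(4))
  finally show ?thesis unfolding H .
qed

text \<open>
  Integration by parts holds for the approximating pairs, and both sides are continuous in \<open>L\<^sup>p\<close>.
\<close>

lemma W0_has_weak_gradient:
  assumes "W0 \<Omega> p u g"
  shows "has_weak_gradient \<Omega> u g"
  unfolding has_weak_gradient_def
proof (intro conjI ballI)
  have i: "integrable M u" "integrable M g"
    using W0_Lp[OF assms] finite_M exponent_pos by (auto intro: Lp_imp_integrable)
  thus "locally_integrable \<Omega> u" "locally_integrable \<Omega> g"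
    using open_dom by (auto intro: locally_integrable_of_integrable)
  fix \<psi> and i :: 'a assume \<psi>: "\<psi> \<in> C0_inf \<Omega>" and i: "i \<in> Basis"
  obtain \<phi> G where *: "\<And>n::nat. C1c \<Omega> (\<phi> n) (G n)" "Lp_lim M p \<phi> u" "Lp_lim M p G g"
    using assms unfolding W0_def by blast
  obtain K where K: "compact K" "continuous_on UNIV \<psi>" "\<And>x. x \<notin> K \<Longrightarrow> \<psi> x = 0"
    "continuous_on UNIV (\<lambda>x. frechet_derivative \<psi> (at x) i)" "\<And>x. x \<notin> K \<Longrightarrow> frechet_derivative \<psi> (at x) i = 0"
    using C0_inf_partial[OF \<psi> i] by metis
  obtain B1 where B1: "\<And>x. norm (\<psi> x) \<le> B1"
    using bounded_compact_support[OF K(2,1,3)] by blast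
  obtain B2 where B2: "\<And>x. norm (frechet_derivative \<psi> (at x) i) \<le> B2"
    using bounded_compact_support[OF K(4,1,5)] by blast
  have L1: "(\<lambda>n. LINT x|M. frechet_derivative \<psi> (at x) i *\<^sub>R \<phi> n x)
      \<longlonglongrightarrow> (LINT x|M. frechet_derivative \<psi> (at x) i *\<^sub>R u x)"
    using B2 by (intro Lp_lim_integral_bounded_mult[OF finite_M exponent_gt_1 *(2)]
        continuous_measurable_lebesgue_on(1)[OF K(4)]) auto
  moreover have "(\<lambda>n. (LINT x|M. \<psi> x *\<^sub>R G n x) \<bullet> i) \<longlonglongrightarrow> (LINT x|M. \<psi> x *\<^sub>R g x) \<bullet> i"
    using B1 by (intro tendsto_intros Lp_lim_integral_bounded_mult[OF finite_M exponent_gt_1 *(3)]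
        continuous_measurable_lebesgue_on(1)[OF K(2)]) auto
  moreover have "(LINT x|M. \<psi> x *\<^sub>R h x) \<bullet> i = (LINT x|M. (h x \<bullet> i) * \<psi> x)" if "Lp M p h" for h
  proof -
    have "integrable M (\<lambda>x. \<psi> x *\<^sub>R h x)"
      using B1 by (intro Lp_imp_integrable[OF finite_M exponent_pos(3)] Lp_bounded_mult[where B = B1]
          exponent_pos that continuous_measurable_lebesgue_on(1)[OF K(2)]) auto
    hence "(LINT x|M. \<psi> x *\<^sub>R h x) \<bullet> i = (LINT x|M. (\<psi> x *\<^sub>R h x) \<bullet> i)"
      by (intro integral_inner_left[symmetric])
    thus ?thesis by (simp add: mult.commute)
  qed
  moreover have "- (LINT x|M. frechet_derivative \<psi> (at x) i *\<^sub>R \<phi> n x) = (LINT x|M. (G n x \<bullet> i) * \<psi> x)" for n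
    using C1c_integration_by_parts[OF *(1)[of n] \<psi> i] by (simp add: mult.commute)
  ultimately have L2: "(\<lambda>n. - (LINT x|M. frechet_derivative \<psi> (at x) i *\<^sub>R \<phi> n x)) \<longlonglongrightarrow> (LINT x|M. (g x \<bullet> i) * \<psi> x)"
    using Lp_limD(1)[OF *(3)] Lp_limD(2)[OF *(3)] by simp
  have "(LINT x|M. (g x \<bullet> i) * \<psi> x) = - (LINT x|M. frechet_derivative \<psi> (at x) i *\<^sub>R u x)"
    by (rule LIMSEQ_unique[OF L2 tendsto_minus[OF L1]])
  thus "(LINT x|M. u x * frechet_derivative \<psi> (at x) i) = - (LINT x|M. (g x \<bullet> i) * \<psi> x)"
    by (simp add: mult.commute)
qed

lemma W0_unique:
  assumes "W0 \<Omega> p u g" "W0 \<Omega> p v h" "AE x in M. u x = v x"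
  shows "AE x in M. g x = h x"
  using has_weak_gradient_unique[OF open_dom W0_has_weak_gradient[OF assms(1)]
      W0_has_weak_gradient[OF assms(2)] W0_measurable(1)[OF assms(1)] W0_measurable(1)[OF assms(2)] assms(3)] .

lemma Lp_space_eq: "u \<in> Lp_space \<Omega> p \<longleftrightarrow> Lp M p u" for u :: "'a \<Rightarrow> 'b::euclidean_space"
  by (simp add: Lp_space_def Lp_def)

lemma weak_grad_AE:
  assumes "has_weak_gradient \<Omega> u g" "u \<in> borel_measurable M"
  shows "AE x in M. weak_grad \<Omega> u x = g x"
proof -
  have "has_weak_gradient \<Omega> u (weak_grad \<Omega> u)"
    unfolding weak_grad_def by (rule someI[where P = "has_weak_gradient \<Omega> u", OF assms(1)])
  thus ?thesis by (rule has_weak_gradient_unique[OF open_dom _ assms(1) assms(2) assms(2)]) simp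
qed

lemma has_weak_gradient_diff:
  assumes "has_weak_gradient \<Omega> u g" "has_weak_gradient \<Omega> v h"
  shows "has_weak_gradient \<Omega> (\<lambda>x. u x - v x) (\<lambda>x. g x - h x)"
  unfolding has_weak_gradient_def
proof (intro conjI ballI)
  have l: "locally_integrable \<Omega> u" "locally_integrable \<Omega> v" "locally_integrable \<Omega> g" "locally_integrable \<Omega> h"
    using assms by (auto simp: has_weak_gradient_def)
  thus "locally_integrable \<Omega> (\<lambda>x. u x - v x)" "locally_integrable \<Omega> (\<lambda>x. g x - h x)"
    by (auto intro: locally_integrable_diff)
  fix \<psi> and i :: 'a assume \<psi>: "\<psi> \<in> C0_inf \<Omega>" and i: "i \<in> Basis"
  obtain K where K: "compact K" "K \<subseteq> \<Omega>" "continuous_on UNIV \<psi>" "\<And>x. x \<notin> K \<Longrightarrow> \<psi> x = 0"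
    "continuous_on UNIV (\<lambda>x. frechet_derivative \<psi> (at x) i)" "\<And>x. x \<notin> K \<Longrightarrow> frechet_derivative \<psi> (at x) i = 0"
    using C0_inf_partial[OF \<psi> i] by metis
  note t = locally_integrable_times_test(1)[OF open_dom _ K(1,2)]
  show "(LINT x|M. (u x - v x) * frechet_derivative \<psi> (at x) i) = - (LINT x|M. ((g x - h x) \<bullet> i) * \<psi> x)"
    using t[OF l(1) K(5,6)] t[OF l(2) K(5,6)] t[OF locally_integrable_inner[OF l(3)] K(3,4)]
      t[OF locally_integrable_inner[OF l(4)] K(3,4)] assms \<psi> i
    by (simp add: left_diff_distrib inner_diff_left has_weak_gradient_def)
qed

lemma W1p_norm_powr:
  assumes "has_weak_gradient \<Omega> u g" "Lp M p u" "Lp M p g"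
  shows "W1p_norm \<Omega> p u powr p = (LINT x|M. \<bar>u x\<bar> powr p) + (LINT x|M. norm (g x) powr p)"
proof -
  note ae = weak_grad_AE[OF assms(1) LpD(1)[OF assms(2)]]
  have [measurable]: "g \<in> borel_measurable M" using assms(3) by (rule LpD)
  have [measurable]: "weak_grad \<Omega> u \<in> borel_measurable M"
    by (rule borel_measurable_lebesgue_on_AE[OF open_dom LpD(1)[OF assms(3)]]) (use ae in auto)
  have "(LINT x|M. norm (weak_grad \<Omega> u x) powr p) = (LINT x|M. norm (g x) powr p)"
    by (rule integral_cong_AE) (measurable, use ae in \<open>auto elim!: eventually_mono\<close>)
  moreover have "(LINT x|M. \<bar>u x\<bar> powr p) \<ge> 0" "(LINT x|M. norm (g x) powr p) \<ge> 0"
    by (auto intro!: Bochner_Integration.integral_nonneg)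
  ultimately show ?thesis using exponent_gt_1 by (simp add: W1p_norm_def powr_powr)
qed

text \<open>
  Mollification is uniformly close with its partial derivatives; on a set of finite measure this
  bounds the \<open>L\<^sup>p\<close> distances. The factor \<open>N\<close> comes from estimating the norm by the sum of the components.
\<close>

lemma C1c_approximation_C0_inf:
  assumes "C1c \<Omega> \<phi> G" "e > 0"
  obtains \<psi> H where "\<psi> \<in> C0_inf \<Omega>" "C1c \<Omega> \<psi> H" "(LINT x|M. norm (\<psi> x - \<phi> x) powr p) < e"
    "(LINT x|M. norm (H x - G x) powr p) < e"
proof -
  interpret finite_measure M by (rule finite_M)
  obtain K where K: "compact K" "K \<subseteq> \<Omega>" "\<And>x. x \<notin> K \<Longrightarrow> \<phi> x = 0"
    "\<And>x. (\<phi> has_derivative (\<lambda>h. G x \<bullet> h)) (at x)" "continuous_on UNIV G"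
    using C1cE[OF assms(1)] by metis
  define N where "N = real DIM('a)"
  define \<mu> where "\<mu> = measure M (space M)"
  have \<mu>: "\<mu> \<ge> 0" by (simp add: \<mu>_def)
  have "((\<lambda>d. (N * d) powr p * \<mu>) \<longlongrightarrow> (N * 0) powr p * \<mu>) (at_right 0)"
    using exponent_gt_1 by (intro tendsto_intros tendsto_powr' tendsto_const)
      (auto simp: eventually_at_right_less eventually_at N_def intro!: exI[of _ 1] mult_nonneg_nonneg)
  hence "\<forall>\<^sub>F d in at_right 0. (N * d) powr p * \<mu> < e"
    using assms(2) exponent_gt_1 by (intro order_tendstoD(2)) auto
  moreover have "\<forall>\<^sub>F d in at_right (0::real). d > 0" by (simp add: eventually_at_right_less)
  ultimately obtain d where d: "(N * d) powr p * \<mu> < e" "d > 0"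
    using eventually_happens'[OF trivial_limit_at_right_real, OF eventually_conj] by blast
  have N: "N \<ge> 1" using DIM_positive[where 'a = 'a] unfolding N_def by linarith
  obtain \<psi> where \<psi>: "\<psi> \<in> C0_inf \<Omega>" "\<And>x. \<bar>\<psi> x - \<phi> x\<bar> \<le> d"
     "\<And>x i. i \<in> Basis \<Longrightarrow> \<bar>frechet_derivative \<psi> (at x) i - G x \<bullet> i\<bar> \<le> d"
  proof (rule mollified_approximation[OF open_dom K(1,2)])
    fix K'
    assume *: "\<And>u G e. (\<And>x. (u has_derivative (\<lambda>h. G x \<bullet> h)) (at x)) \<Longrightarrow> continuous_on UNIV G \<Longrightarrow>
       (\<And>x. x \<notin> K \<Longrightarrow> u x = 0) \<Longrightarrow> e > 0 \<Longrightarrow>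
       \<exists>\<psi>\<in>C0_inf \<Omega>. (\<forall>x. \<bar>\<psi> x - u x\<bar> \<le> e) \<and>
         (\<forall>x. \<forall>i\<in>Basis. \<bar>frechet_derivative \<psi> (at x) i - G x \<bullet> i\<bar> \<le> e)"
    show thesis using *[OF K(4,5,3) d(2)] that by blast
  qed
  define H where "H x = (\<Sum>i\<in>Basis. frechet_derivative \<psi> (at x) i *\<^sub>R i)" for x
  have \<psi>C: "C1c \<Omega> \<psi> H" using C0_inf_imp_C1c[OF \<psi>(1)] by (simp add: H_def[abs_def])
  have HG: "norm (H x - G x) \<le> N * d" for x
  proof -
    have "norm (H x - G x) \<le> (\<Sum>i\<in>Basis. \<bar>(H x - G x) \<bullet> i\<bar>)" by (rule norm_le_l1)
    also have "\<dots> \<le> (\<Sum>i\<in>(Basis::'a set). d)"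
      using \<psi>(3) by (intro sum_mono) (simp add: H_def inner_diff_left)
    finally show ?thesis by (simp add: N_def)
  qed
  have "1 * d \<le> N * d" using N d(2) by (intro mult_right_mono) auto
  hence \<psi>\<phi>: "norm (\<psi> x - \<phi> x) \<le> N * d" for x using \<psi>(2)[of x] by simp
  have bnd: "(LINT x|M. norm (f x) powr p) < e"
    if "Lp M p f" "\<And>x. norm (f x) \<le> N * d" for f :: "'a \<Rightarrow> 'b::euclidean_space"
  proof -
    have "(LINT x|M. norm (f x) powr p) \<le> (LINT x|M. (N * d) powr p)"
      using that exponent_pos by (intro integral_mono) (auto dest: LpD intro!: powr_mono2)
    also have "\<dots> = (N * d) powr p * \<mu>" by (simp add: \<mu>_def)
    finally show ?thesis using d(1) by simp
  qed
  show ?thesis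
  proof (rule that[OF \<psi>(1) \<psi>C])
    show "(LINT x|M. norm (\<psi> x - \<phi> x) powr p) < e"
      by (intro bnd Lp_diff exponent_pos C1c_Lp(1)[OF \<psi>C] C1c_Lp(1)[OF assms(1)] \<psi>\<phi>)
    show "(LINT x|M. norm (H x - G x) powr p) < e"
      by (intro bnd Lp_diff exponent_pos C1c_Lp(2)[OF \<psi>C] C1c_Lp(2)[OF assms(1)] HG)
  qed
qed

lemma W01p_imp_W0:
  assumes "u \<in> W01p \<Omega> p"
  shows "W0 \<Omega> p u (weak_grad \<Omega> u)"
proof -
  have u: "Lp M p u" using assms by (simp add: W01p_def W1p_def Lp_space_eq)
  obtain g where g: "Lp M p g" "has_weak_gradient \<Omega> u g"
    using assms by (auto simp: W01p_def W1p_def Lp_space_eq)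
  have "W0 \<Omega> p u g"
    unfolding W0_approx
  proof (intro conjI allI impI u g)
    fix e :: real assume "e > 0"
    define d where "d = e powr (1 / p)"
    have d: "d > 0" "d powr p = e" using \<open>e > 0\<close> exponent_gt_1 by (auto simp: d_def powr_powr)
    obtain \<phi> where \<phi>: "\<phi> \<in> C0_inf \<Omega>" "W1p_norm \<Omega> p (\<lambda>x. u x - \<phi> x) < d"
      using assms d(1) by (auto simp: W01p_def)
    define G where "G x = (\<Sum>i\<in>Basis. frechet_derivative \<phi> (at x) i *\<^sub>R i)" for x
    have G: "C1c \<Omega> \<phi> G" using C0_inf_imp_C1c[OF \<phi>(1)] by (simp add: G_def[abs_def])
    have "W1p_norm \<Omega> p (\<lambda>x. u x - \<phi> x) powr p
        = (LINT x|M. \<bar>u x - \<phi> x\<bar> powr p) + (LINT x|M. norm (g x - G x) powr p)"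
      by (intro W1p_norm_powr has_weak_gradient_diff g W0_has_weak_gradient C1c_imp_W0 G Lp_diff u C1c_Lp[OF G] exponent_pos)
    moreover have "W1p_norm \<Omega> p (\<lambda>x. u x - \<phi> x) powr p < d powr p"
      using \<phi>(2) exponent_gt_1 by (intro powr_less_mono2) (auto simp: W1p_norm_def)
    moreover have "(LINT x|M. \<bar>u x - \<phi> x\<bar> powr p) \<ge> 0" "(LINT x|M. norm (g x - G x) powr p) \<ge> 0"
      by (auto intro!: Bochner_Integration.integral_nonneg)
    ultimately have "(LINT x|M. \<bar>u x - \<phi> x\<bar> powr p) < e" "(LINT x|M. norm (g x - G x) powr p) < e"
      using d(2) by linarith+
    hence "(LINT x|M. norm (\<phi> x - u x) powr p) < e" "(LINT x|M. norm (G x - g x) powr p) < e"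
      by (simp_all add: norm_minus_commute abs_minus_commute)
    thus "\<exists>\<phi> G. C1c \<Omega> \<phi> G \<and> (LINT x|M. norm (\<phi> x - u x) powr p) < e \<and>
       (LINT x|M. norm (G x - g x) powr p) < e"
      using G by blast
  qed
  moreover have "AE x in M. g x = weak_grad \<Omega> u x"
    using weak_grad_AE[OF g(2) LpD(1)[OF u]] by (auto elim!: eventually_mono)
  ultimately show ?thesis using W0_cong_AE[of u g u "weak_grad \<Omega> u"] by simp
qed

lemma W0_imp_W01p:
  assumes "W0 \<Omega> p u g"
  shows "u \<in> W01p \<Omega> p" "AE x in M. weak_grad \<Omega> u x = g x"
proof -
  note L = W0_Lp[OF assms] and w = W0_has_weak_gradient[OF assms]
  show "AE x in M. weak_grad \<Omega> u x = g x"
    by (rule weak_grad_AE[OF w W0_measurable(1)[OF assms]])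
  have "\<exists>\<psi>\<in>C0_inf \<Omega>. W1p_norm \<Omega> p (\<lambda>x. u x - \<psi> x) < e" if "e > 0" for e
  proof -
    define d where "d = e powr p / (2 powr p * 4)"
    have d: "d > 0" using that by (simp add: d_def)
    obtain \<phi> G where \<phi>: "C1c \<Omega> \<phi> G" "(LINT x|M. norm (\<phi> x - u x) powr p) < d"
       "(LINT x|M. norm (G x - g x) powr p) < d"
      using assms d unfolding W0_approx by blast
    obtain \<psi> H where \<psi>: "\<psi> \<in> C0_inf \<Omega>" "C1c \<Omega> \<psi> H" "(LINT x|M. norm (\<psi> x - \<phi> x) powr p) < d"
        "(LINT x|M. norm (H x - G x) powr p) < d"
      using C1c_approximation_C0_inf[OF \<phi>(1) d] by blast
    have "(LINT x|M. norm (\<psi> x - u x) powr p) \<le> 2 powr p * ((LINT x|M. norm (\<psi> x - \<phi> x) powr p) + (LINT x|M. norm (\<phi> x - u x) powr p))"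
      "(LINT x|M. norm (H x - g x) powr p) \<le> 2 powr p * ((LINT x|M. norm (H x - G x) powr p) + (LINT x|M. norm (G x - g x) powr p))"
      by (intro Lp_dist_triangle C1c_Lp[OF \<phi>(1)] C1c_Lp[OF \<psi>(2)] L)+
    moreover have "2 powr p * (a + b) < e powr p / 2" if "a < d" "b < d" for a b
    proof -
      have "2 powr p * (a + b) < 2 powr p * (d + d)" using that by simp
      thus ?thesis by (simp add: d_def)
    qed
    ultimately have "(LINT x|M. norm (\<psi> x - u x) powr p) < e powr p / 2" "(LINT x|M. norm (H x - g x) powr p) < e powr p / 2"
      using \<phi>(2,3) \<psi>(3,4) by (meson le_less_trans)+
    moreover have "W1p_norm \<Omega> p (\<lambda>x. u x - \<psi> x) powr p
        = (LINT x|M. \<bar>u x - \<psi> x\<bar> powr p) + (LINT x|M. norm (g x - H x) powr p)"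
      by (intro W1p_norm_powr has_weak_gradient_diff w W0_has_weak_gradient C1c_imp_W0 \<psi> Lp_diff L C1c_Lp[OF \<psi>(2)] exponent_pos)
    ultimately have "W1p_norm \<Omega> p (\<lambda>x. u x - \<psi> x) powr p < e powr p"
      by (simp add: norm_minus_commute abs_minus_commute)
    hence "W1p_norm \<Omega> p (\<lambda>x. u x - \<psi> x) < e"
      using powr_mono2[OF exponent_pos(2) less_imp_le[OF that], of "W1p_norm \<Omega> p (\<lambda>x. u x - \<psi> x)"]
      by linarith
    thus ?thesis using \<psi>(1) by blast
  qed
  thus "u \<in> W01p \<Omega> p"
    using L w by (auto simp: W01p_def W1p_def Lp_space_eq)
qed

end

section \<open>Calculus for functions of zero trace\<close>

locale C1_Lipschitz =
  fixes F D1 D2 :: "real \<times> real \<Rightarrow> real" and B :: real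
  assumes deriv: "\<And>z. (F has_derivative (\<lambda>h. D1 z * fst h + D2 z * snd h)) (at z)"
    and cont: "continuous_on UNIV D1" "continuous_on UNIV D2"
    and bounds: "\<And>z. \<bar>D1 z\<bar> \<le> B" "\<And>z. \<bar>D2 z\<bar> \<le> B"
    and at_0: "F (0, 0) = 0"
begin

lemma lipschitz: "\<bar>F (s, t) - F (s', t')\<bar> \<le> 2 * B * (\<bar>s - s'\<bar> + \<bar>t - t'\<bar>)"
proof -
  have B: "B \<ge> 0" using bounds(1)[of "(0, 0)"] by linarith
  have "norm (F (s, t) - F (s', t')) \<le> 2 * B * norm ((s, t) - (s', t'))"
  proof (rule differentiable_bound[of UNIV F "\<lambda>z h. D1 z * fst h + D2 z * snd h"])
    fix z
    show "onorm (\<lambda>h. D1 z * fst h + D2 z * snd h) \<le> 2 * B"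
    proof (rule onorm_le)
      fix h :: "real \<times> real"
      have "\<bar>D1 z * fst h + D2 z * snd h\<bar> \<le> \<bar>D1 z\<bar> * \<bar>fst h\<bar> + \<bar>D2 z\<bar> * \<bar>snd h\<bar>"
        using abs_triangle_ineq[of "D1 z * fst h" "D2 z * snd h"] by (simp add: abs_mult)
      also have "\<dots> \<le> B * norm h + B * norm h"
        using bounds[of z] norm_fst_le[of "fst h" "snd h"] norm_snd_le[of "snd h" "fst h"]
        by (intro add_mono mult_mono) auto
      finally show "norm (D1 z * fst h + D2 z * snd h) \<le> 2 * B * norm h" by simp
    qed
  qed (use deriv in auto)
  also have "norm ((s, t) - (s', t')) \<le> \<bar>s - s'\<bar> + \<bar>t - t'\<bar>"
    using norm_Pair_le[of "s - s'" "t - t'"] by simp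
  finally show ?thesis using B by (simp add: mult_left_mono)
qed

lemma C1c_compose:
  assumes "C1c \<Omega> \<phi> G" "C1c \<Omega> \<psi> H"
  shows "C1c \<Omega> (\<lambda>x. F (\<phi> x, \<psi> x)) (\<lambda>x. D1 (\<phi> x, \<psi> x) *\<^sub>R G x + D2 (\<phi> x, \<psi> x) *\<^sub>R H x)"
  unfolding C1c_def
proof (intro conjI allI)
  obtain K where K: "compact K" "K \<subseteq> \<Omega>" "\<And>x. x \<notin> K \<Longrightarrow> \<phi> x = 0"
    "\<And>x. (\<phi> has_derivative (\<lambda>h. G x \<bullet> h)) (at x)" "continuous_on UNIV \<phi>" "continuous_on UNIV G"
    using C1cE[OF assms(1)] by metis
  obtain L where L: "compact L" "L \<subseteq> \<Omega>" "\<And>x. x \<notin> L \<Longrightarrow> \<psi> x = 0"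
    "\<And>x. (\<psi> has_derivative (\<lambda>h. H x \<bullet> h)) (at x)" "continuous_on UNIV \<psi>" "continuous_on UNIV H"
    using C1cE[OF assms(2)] by metis
  fix x
  have "((\<lambda>x. (\<phi> x, \<psi> x)) has_derivative (\<lambda>h. (G x \<bullet> h, H x \<bullet> h))) (at x)"
    by (intro has_derivative_Pair K L)
  from has_derivative_compose[OF this deriv]
  show "((\<lambda>x. F (\<phi> x, \<psi> x)) has_derivative
      (\<lambda>h. (D1 (\<phi> x, \<psi> x) *\<^sub>R G x + D2 (\<phi> x, \<psi> x) *\<^sub>R H x) \<bullet> h)) (at x)"
    by (simp add: inner_add_left)
  show "continuous_on UNIV (\<lambda>x. D1 (\<phi> x, \<psi> x) *\<^sub>R G x + D2 (\<phi> x, \<psi> x) *\<^sub>R H x)"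
    by (intro continuous_intros K L continuous_on_compose2[OF cont(1)] continuous_on_compose2[OF cont(2)]) auto
  show "\<exists>K. compact K \<and> K \<subseteq> \<Omega> \<and> (\<forall>x. x \<notin> K \<longrightarrow> F (\<phi> x, \<psi> x) = 0)"
    using K L at_0 by (intro exI[of _ "K \<union> L"]) auto
qed

end

context bounded_open
begin

text \<open>
  The gradient of the composition is a sum of products of bounded factors, which converge almost
  everywhere along a subsequence, with gradients that converge in \<open>L\<^sup>p\<close>.
\<close>

lemma W0_chain:
  assumes F: "C1_Lipschitz F D1 D2 B" and u: "W0 \<Omega> p u g" and v: "W0 \<Omega> p v h"
  shows "W0 \<Omega> p (\<lambda>x. F (u x, v x)) (\<lambda>x. D1 (u x, v x) *\<^sub>R g x + D2 (u x, v x) *\<^sub>R h x)"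
proof -
  interpret C1_Lipschitz F D1 D2 B by (rule F)
  have B: "B \<ge> 0" using bounds(1)[of "(0, 0)"] by linarith
  obtain \<phi>0 G0 where \<phi>0: "\<And>n::nat. C1c \<Omega> (\<phi>0 n) (G0 n)" "Lp_lim M p \<phi>0 u" "Lp_lim M p G0 g"
    using u unfolding W0_def by blast
  obtain \<psi>0 H0 where \<psi>0: "\<And>n::nat. C1c \<Omega> (\<psi>0 n) (H0 n)" "Lp_lim M p \<psi>0 v" "Lp_lim M p H0 h"
    using v unfolding W0_def by blast
  obtain r :: "nat \<Rightarrow> nat" where r: "strict_mono r" "AE x in M. (\<lambda>n. \<phi>0 (r n) x) \<longlonglongrightarrow> u x"
    using Lp_lim_AE_subseq[OF exponent_pos(1) \<phi>0(2)] by blast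
  obtain s :: "nat \<Rightarrow> nat" where s: "strict_mono s" "AE x in M. (\<lambda>n. \<psi>0 (r (s n)) x) \<longlonglongrightarrow> v x"
    using Lp_lim_AE_subseq[OF exponent_pos(1) Lp_lim_subseq[OF \<psi>0(2) r(1)]] by blast
  have rs: "strict_mono (\<lambda>n. r (s n))" using strict_mono_compose[OF r(1) s(1)] .
  define \<phi> G \<psi> H where "\<phi> n = \<phi>0 (r (s n))" and "G n = G0 (r (s n))"
    and "\<psi> n = \<psi>0 (r (s n))" and "H n = H0 (r (s n))" for n
  have C: "C1c \<Omega> (\<phi> n) (G n)" "C1c \<Omega> (\<psi> n) (H n)" for n
    by (simp_all add: \<phi>_def G_def \<psi>_def H_def \<phi>0 \<psi>0)
  have lim: "Lp_lim M p \<phi> u" "Lp_lim M p G g" "Lp_lim M p \<psi> v" "Lp_lim M p H h"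
    unfolding \<phi>_def G_def \<psi>_def H_def
    by (rule Lp_lim_subseq[OF _ rs], rule \<phi>0 \<psi>0)+
  have ae: "AE x in M. (\<lambda>n. (\<phi> n x, \<psi> n x)) \<longlonglongrightarrow> (u x, v x)"
    using r(2) s(2)
  proof eventually_elim
    case (elim x)
    show ?case unfolding \<phi>_def \<psi>_def
      using LIMSEQ_subseq_LIMSEQ[OF elim(1) s(1)] elim(2) by (intro tendsto_Pair) (simp_all add: o_def)
  qed
  have [measurable]: "u \<in> borel_measurable M" "v \<in> borel_measurable M"
    "\<phi> n \<in> borel_measurable M" "\<psi> n \<in> borel_measurable M" for n
    using u v C1c_Lp[OF C(1)] C1c_Lp[OF C(2)] by (auto dest: W0_measurable LpD)
  have Fc: "continuous_on UNIV F"
    using deriv has_derivative_continuous by (metis continuous_at_imp_continuous_on)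
  have [measurable]: "F \<in> borel_measurable borel" "D1 \<in> borel_measurable borel" "D2 \<in> borel_measurable borel"
    using Fc cont by (auto intro: borel_measurable_continuous_onI)
  have m: "(\<lambda>x. f (a x, b x)) \<in> borel_measurable M"
    if "f \<in> borel_measurable borel" "a \<in> borel_measurable M" "b \<in> borel_measurable M" for f :: "real \<times> real \<Rightarrow> real" and a b
    using that borel_measurable_Pair measurable_compose by blast
  have FL: "Lp M p (\<lambda>x. F (u x, v x))"
  proof (rule Lp_bound[OF exponent_pos(2)])
    show "(\<lambda>x. F (u x, v x)) \<in> borel_measurable M" by (intro m) measurable
    show "integrable M (\<lambda>x. (2 * B) powr p * (2 powr p * (\<bar>u x\<bar> powr p + \<bar>v x\<bar> powr p)))"
      using LpD(2)[OF W0_Lp(1)[OF u]] LpD(2)[OF W0_Lp(1)[OF v]] by auto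
    show "AE x in M. norm (F (u x, v x)) powr p \<le> (2 * B) powr p * (2 powr p * (\<bar>u x\<bar> powr p + \<bar>v x\<bar> powr p))"
    proof (rule AE_I2)
      fix x
      have "\<bar>F (u x, v x)\<bar> \<le> 2 * B * (\<bar>u x\<bar> + \<bar>v x\<bar>)"
        using lipschitz[of "u x" "v x" 0 0] at_0 by simp
      hence "norm (F (u x, v x)) powr p \<le> (2 * B * (\<bar>u x\<bar> + \<bar>v x\<bar>)) powr p"
        using exponent_pos by (intro powr_mono2) auto
      also have "\<dots> = (2 * B) powr p * (\<bar>u x\<bar> + \<bar>v x\<bar>) powr p" by (simp add: powr_mult)
      also have "\<dots> \<le> (2 * B) powr p * (2 powr p * (\<bar>u x\<bar> powr p + \<bar>v x\<bar> powr p))"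
        using norm_powr_add_le[OF exponent_pos(2), of "\<bar>u x\<bar>" "\<bar>v x\<bar>"] by (intro mult_left_mono) auto
      finally show "norm (F (u x, v x)) powr p \<le> (2 * B) powr p * (2 powr p * (\<bar>u x\<bar> powr p + \<bar>v x\<bar> powr p))" .
    qed
  qed
  have "Lp_lim M p (\<lambda>n x. F (\<phi> n x, \<psi> n x)) (\<lambda>x. F (u x, v x))"
  proof (rule Lp_lim_compare[OF exponent_pos(2) _ FL])
    let ?w = "\<lambda>n x. (2 * B) powr p * (2 powr p * (norm (\<phi> n x - u x) powr p + norm (\<psi> n x - v x) powr p))"
    show "Lp M p (\<lambda>x. F (\<phi> n x, \<psi> n x))" for n
      by (rule C1c_Lp(1)[OF C1c_compose[OF C]])
    have i: "integrable M (\<lambda>x. norm (\<phi> n x - u x) powr p)" "integrable M (\<lambda>x. norm (\<psi> n x - v x) powr p)" for n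
      by (intro LpD(2) Lp_lim_diff_Lp exponent_pos lim)+
    thus "integrable M (?w n)" for n by auto
    have "(\<lambda>n. (2 * B) powr p * (2 powr p * ((LINT x|M. norm (\<phi> n x - u x) powr p) + (LINT x|M. norm (\<psi> n x - v x) powr p))))
        \<longlonglongrightarrow> (2 * B) powr p * (2 powr p * (0 + 0))"
      by (intro tendsto_intros Lp_limD(3) lim)
    thus "(\<lambda>n. LINT x|M. ?w n x) \<longlonglongrightarrow> 0" using i by simp
    show "AE x in M. norm (F (\<phi> n x, \<psi> n x) - F (u x, v x)) powr p \<le> ?w n x" for n
    proof (rule AE_I2)
      fix x
      have "norm (F (\<phi> n x, \<psi> n x) - F (u x, v x)) powr p \<le> (2 * B * (\<bar>\<phi> n x - u x\<bar> + \<bar>\<psi> n x - v x\<bar>)) powr p"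
        using exponent_pos lipschitz by (intro powr_mono2) auto
      also have "\<dots> = (2 * B) powr p * (\<bar>\<phi> n x - u x\<bar> + \<bar>\<psi> n x - v x\<bar>) powr p" by (simp add: powr_mult)
      also have "\<dots> \<le> ?w n x"
        using norm_powr_add_le[OF exponent_pos(2), of "\<bar>\<phi> n x - u x\<bar>" "\<bar>\<psi> n x - v x\<bar>"]
        by (intro mult_left_mono) auto
      finally show "norm (F (\<phi> n x, \<psi> n x) - F (u x, v x)) powr p \<le> ?w n x" .
    qed
  qed
  moreover have "Lp_lim M p (\<lambda>n x. D1 (\<phi> n x, \<psi> n x) *\<^sub>R G n x + D2 (\<phi> n x, \<psi> n x) *\<^sub>R H n x)
      (\<lambda>x. D1 (u x, v x) *\<^sub>R g x + D2 (u x, v x) *\<^sub>R h x)"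
  proof (intro Lp_lim_add exponent_pos Lp_lim_bounded_mult[where B = B] lim bounds m)
    show "AE x in M. (\<lambda>n. D1 (\<phi> n x, \<psi> n x)) \<longlonglongrightarrow> D1 (u x, v x)"
      using ae by eventually_elim (rule continuous_on_tendsto_compose[OF cont(1)], auto)
    show "AE x in M. (\<lambda>n. D2 (\<phi> n x, \<psi> n x)) \<longlonglongrightarrow> D2 (u x, v x)"
      using ae by eventually_elim (rule continuous_on_tendsto_compose[OF cont(2)], auto)
  qed measurable
  ultimately show ?thesis
    unfolding W0_def by (intro exI conjI allI) (rule C1c_compose[OF C], assumption+)
qed

lemma W0_linear:
  assumes "W0 \<Omega> p u g" "W0 \<Omega> p v h"
  shows "W0 \<Omega> p (\<lambda>x. a * u x + b * v x) (\<lambda>x. a *\<^sub>R g x + b *\<^sub>R h x)"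
proof -
  have "C1_Lipschitz (\<lambda>z. a * fst z + b * snd z) (\<lambda>z. a) (\<lambda>z. b) (max \<bar>a\<bar> \<bar>b\<bar>)"
    by unfold_locales (auto intro!: derivative_eq_intros)
  from W0_chain[OF this assms] show ?thesis by simp
qed

lemma W0_diff: "W0 \<Omega> p u g \<Longrightarrow> W0 \<Omega> p v h \<Longrightarrow> W0 \<Omega> p (\<lambda>x. u x - v x) (\<lambda>x. g x - h x)"
  using W0_linear[of u g v h 1 "- 1"] by simp

lemma W0_add: "W0 \<Omega> p u g \<Longrightarrow> W0 \<Omega> p v h \<Longrightarrow> W0 \<Omega> p (\<lambda>x. u x + v x) (\<lambda>x. g x + h x)"
  using W0_linear[of u g v h 1 1] by simp

end

subsection \<open>The positive part\<close>

text \<open>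
  A \<open>C\<^sup>1\<close> approximation of the positive part that vanishes on the negative axis and lies within \<open>d\<close>
  below the positive part.
\<close>

definition soft_pos :: "real \<Rightarrow> real \<Rightarrow> real" where
  "soft_pos d s = sqrt ((max 0 s)\<^sup>2 + d\<^sup>2) - d"

definition soft_pos' :: "real \<Rightarrow> real \<Rightarrow> real" where
  "soft_pos' d s = max 0 s / sqrt ((max 0 s)\<^sup>2 + d\<^sup>2)"

lemma pos_part_square_deriv: "((\<lambda>s::real. (max 0 s)\<^sup>2) has_real_derivative 2 * max 0 s) (at s)"
proof -
  consider "s > 0" | "s < 0" | "s = 0" by linarith
  thus ?thesis
  proof cases
    case 1
    have "((\<lambda>s::real. s\<^sup>2) has_real_derivative 2 * s) (at s)"
      by (auto intro!: derivative_eq_intros)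
    from has_field_derivative_transform_within_open[OF this, of "{0<..}"] 1
    show ?thesis by (auto simp: max_def)
  next
    case 2
    have "((\<lambda>s::real. 0) has_real_derivative 0) (at s)" by simp
    from has_field_derivative_transform_within_open[OF this, of "{..<0}" "\<lambda>s. (max 0 s)\<^sup>2"] 2
    show ?thesis by (auto simp: max_def)
  next
    case 3
    have "((\<lambda>h::real. max 0 h) \<longlongrightarrow> max 0 0) (at 0)" by (intro tendsto_intros)
    moreover have eq: "max 0 h = ((max 0 (0 + h))\<^sup>2 - (max 0 0)\<^sup>2) / h" if "h \<noteq> 0" for h :: real
      using that by (cases "h > 0") (auto simp: max_def power2_eq_square)
    have "\<forall>\<^sub>F h in at 0. max 0 h = ((max 0 (0 + h))\<^sup>2 - (max 0 0)\<^sup>2) / (h::real)"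
      unfolding eventually_at_filter by (intro always_eventually allI impI eq)
    with calculation have "((\<lambda>h::real. ((max 0 (0 + h))\<^sup>2 - (max 0 0)\<^sup>2) / h) \<longlongrightarrow> 0) (at 0)"
      using filterlim_cong[OF refl refl, of "\<lambda>h. max 0 h" "\<lambda>h. ((max 0 (0 + h))\<^sup>2 - (max 0 0)\<^sup>2) / h" "at (0::real)"] by simp
    thus ?thesis using 3 by (simp add: DERIV_def)
  qed
qed

lemma soft_pos_deriv:
  assumes "d > 0"
  shows "(soft_pos d has_real_derivative soft_pos' d s) (at s)"
proof -
  have "(max 0 s)\<^sup>2 + d\<^sup>2 > 0" using assms by (simp add: add_nonneg_pos)
  note sq = DERIV_real_sqrt[OF this]
  have "((\<lambda>s. (max 0 s)\<^sup>2 + d\<^sup>2) has_real_derivative 2 * max 0 s) (at s)"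
    using DERIV_add[OF pos_part_square_deriv DERIV_const] by simp
  hence "((\<lambda>s. sqrt ((max 0 s)\<^sup>2 + d\<^sup>2)) has_real_derivative
      inverse (sqrt ((max 0 s)\<^sup>2 + d\<^sup>2)) / 2 * (2 * max 0 s)) (at s)"
    by (rule DERIV_chain2[where g = "\<lambda>s. (max 0 s)\<^sup>2 + d\<^sup>2", OF sq])
  from DERIV_diff[OF this DERIV_const[of d]]
  show ?thesis unfolding soft_pos_def[abs_def]
    by (rule DERIV_cong) (unfold soft_pos'_def divide_inverse, simp only: mult_ac diff_zero, simp)
qed

lemma soft_pos'_bounds:
  assumes "d > 0"
  shows "0 \<le> soft_pos' d s" "soft_pos' d s \<le> 1"
proof -
  have "max 0 s \<le> sqrt ((max 0 s)\<^sup>2 + d\<^sup>2)" by (rule real_le_rsqrt) simp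
  moreover have "sqrt ((max 0 s)\<^sup>2 + d\<^sup>2) > 0" using assms by (simp add: add_nonneg_pos)
  ultimately show "0 \<le> soft_pos' d s" "soft_pos' d s \<le> 1"
    by (auto simp: soft_pos'_def)
qed

lemma soft_pos'_continuous:
  assumes "d > 0"
  shows "continuous_on UNIV (soft_pos' d)"
proof -
  have "(max 0 s)\<^sup>2 + d\<^sup>2 > 0" for s using assms by (simp add: add_nonneg_pos)
  thus ?thesis unfolding soft_pos'_def[abs_def]
    by (intro continuous_intros) (auto simp: less_imp_neq[symmetric])
qed

lemma soft_pos_bounds:
  assumes "d > 0"
  shows "0 \<le> soft_pos d s" "soft_pos d s \<le> max 0 s" "max 0 s \<le> soft_pos d s + d" "s \<le> 0 \<Longrightarrow> soft_pos d s = 0"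
proof -
  have "d \<le> sqrt ((max 0 s)\<^sup>2 + d\<^sup>2)" by (rule real_le_rsqrt) simp
  thus "0 \<le> soft_pos d s" by (simp add: soft_pos_def)
  have "(max 0 s)\<^sup>2 + d\<^sup>2 \<le> (max 0 s + d)\<^sup>2" using assms by (simp add: power2_sum)
  hence "sqrt ((max 0 s)\<^sup>2 + d\<^sup>2) \<le> max 0 s + d" using assms by (intro real_le_lsqrt) auto
  thus "soft_pos d s \<le> max 0 s" by (simp add: soft_pos_def)
  have "max 0 s \<le> sqrt ((max 0 s)\<^sup>2 + d\<^sup>2)" by (rule real_le_rsqrt) simp
  thus "max 0 s \<le> soft_pos d s + d" by (simp add: soft_pos_def)
  show "s \<le> 0 \<Longrightarrow> soft_pos d s = 0" using assms by (simp add: soft_pos_def)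
qed

lemma soft_pos'_tendsto:
  assumes "d \<longlonglongrightarrow> 0" "\<And>n. d n > 0"
  shows "(\<lambda>n. soft_pos' (d n) s) \<longlonglongrightarrow> (if s > 0 then 1 else 0)"
proof (cases "s > 0")
  case True
  have "(\<lambda>n. s / sqrt (s\<^sup>2 + (d n)\<^sup>2)) \<longlonglongrightarrow> s / sqrt (s\<^sup>2 + 0\<^sup>2)"
    using True by (intro tendsto_intros assms) auto
  thus ?thesis using True by (simp add: soft_pos'_def max_def)
next
  case False
  thus ?thesis by (simp add: soft_pos'_def max_def)
qed

lemma C1_Lipschitz_fst:
  assumes "\<And>s. (f has_real_derivative f' s) (at s)" "continuous_on UNIV f'" "\<And>s. \<bar>f' s\<bar> \<le> B" "f 0 = 0"
  shows "C1_Lipschitz (\<lambda>z. f (fst z)) (\<lambda>z. f' (fst z)) (\<lambda>z. 0) B"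
proof
  fix z :: "real \<times> real"
  have "(fst has_derivative fst) (at z)" by (intro derivative_intros)
  moreover have "(f has_derivative (\<lambda>h. f' (fst z) * h)) (at (fst z))"
    using assms(1) by (simp add: has_field_derivative_def)
  ultimately have "((\<lambda>z. f (fst z)) has_derivative (\<lambda>h. f' (fst z) * fst h)) (at z)"
    by (rule has_derivative_compose)
  thus "((\<lambda>z. f (fst z)) has_derivative (\<lambda>h. f' (fst z) * fst h + 0 * snd h)) (at z)" by simp
  show "continuous_on UNIV (\<lambda>z :: real \<times> real. f' (fst z))"
    by (intro continuous_on_compose2[OF assms(2)] continuous_intros) auto
  show "\<bar>0\<bar> \<le> B" using assms(3)[of 0] by simp
qed (use assms in auto)

context bounded_open
begin

text \<open>
  The positive part is the limit of \<open>soft_pos d\<close> as \<open>d\<close> tends to \<open>0\<close>, and the derivatives tend to the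
  indicator of the positive numbers, with value \<open>0\<close> at \<open>0\<close>.
\<close>

lemma W0_pos_part:
  assumes u: "W0 \<Omega> p u g"
  shows "W0 \<Omega> p (\<lambda>x. max 0 (u x)) (\<lambda>x. (if u x > 0 then 1 else 0) *\<^sub>R g x)"
proof -
  define d where "d n = inverse (real (Suc n))" for n
  have d: "d \<longlonglongrightarrow> 0" "\<And>n. d n > 0" unfolding d_def[abs_def] using LIMSEQ_inverse_real_of_nat by simp_all
  have [measurable]: "u \<in> borel_measurable M" using W0_measurable(1)[OF u] .
  have W: "W0 \<Omega> p (\<lambda>x. soft_pos (d n) (u x)) (\<lambda>x. soft_pos' (d n) (u x) *\<^sub>R g x)" for n
  proof -
    have "C1_Lipschitz (\<lambda>z. soft_pos (d n) (fst z)) (\<lambda>z. soft_pos' (d n) (fst z)) (\<lambda>z. 0) 1"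
      using soft_pos'_bounds[OF d(2)[of n]] d(2)[of n]
      by (intro C1_Lipschitz_fst soft_pos_deriv soft_pos'_continuous) (auto simp: soft_pos_def)
    from W0_chain[OF this u u] show ?thesis by simp
  qed
  have "Lp_lim M p (\<lambda>n x. soft_pos (d n) (u x)) (\<lambda>x. max 0 (u x))"
  proof (rule Lp_lim_uniform[OF finite_M exponent_pos(1) W0_Lp(1)[OF W]])
    show "Lp M p (\<lambda>x. max 0 (u x))"
      by (rule Lp_bound[OF exponent_pos(2) _ LpD(2)[OF W0_Lp(1)[OF u]]])
        (auto intro!: powr_mono2 exponent_pos)
    show "norm (soft_pos (d n) (u x) - max 0 (u x)) \<le> d n" for n x
      using soft_pos_bounds(2,3)[OF d(2)[of n], of "u x"] by (auto simp: abs_le_iff)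
  qed (use d in \<open>auto intro: less_imp_le\<close>)
  moreover have "Lp_lim M p (\<lambda>n x. soft_pos' (d n) (u x) *\<^sub>R g x) (\<lambda>x. (if u x > 0 then 1 else 0) *\<^sub>R g x)"
  proof (rule Lp_lim_bounded_mult[where B = 1])
    have "soft_pos' (d n) \<in> borel_measurable borel" for n
      by (intro borel_measurable_continuous_onI soft_pos'_continuous d)
    thus "(\<lambda>x. soft_pos' (d n) (u x)) \<in> borel_measurable M" for n by measurable
    show "\<bar>soft_pos' (d n) (u x)\<bar> \<le> 1" for n x using soft_pos'_bounds[OF d(2)[of n], of "u x"] by simp
    show "AE x in M. (\<lambda>n. soft_pos' (d n) (u x)) \<longlonglongrightarrow> (if u x > 0 then 1 else 0)"
      by (intro AE_I2 soft_pos'_tendsto d)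
  qed (use exponent_pos W0_Lp(2)[OF u] in auto)
  ultimately show ?thesis by (rule W0_closed[OF W])
qed

text \<open>
  A nonnegative \<open>u\<close> equals its positive part, whose gradient is \<open>0\<close> where \<open>u = 0\<close>; gradients are unique.
\<close>

lemma W0_gradient_on_zero_set:
  assumes u: "W0 \<Omega> p u g" and nn: "AE x in M. u x \<ge> 0"
  shows "AE x in M. u x = 0 \<longrightarrow> g x = 0"
proof -
  have "AE x in M. g x = (if u x > 0 then 1 else 0) *\<^sub>R g x"
    by (rule W0_unique[OF u W0_pos_part[OF u]]) (use nn in \<open>auto elim!: eventually_mono\<close>)
  thus ?thesis by eventually_elim auto
qed

end

subsection \<open>The Poincare inequality\<close>

text \<open>
  The tangent inequality at \<open>s\<close> and at \<open>s + h\<close> encloses the difference quotient between two values of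
  the continuous function \<open>pflux p\<close>.
\<close>

lemma abs_powr_deriv:
  assumes "1 < p"
  shows "((\<lambda>s::real. \<bar>s\<bar> powr p) has_real_derivative p * pflux p s) (at s)"
proof -
  have lb: "p * (pflux p y * (x - y)) \<le> \<bar>x\<bar> powr p - \<bar>y\<bar> powr p" for x y :: real
    using norm_powr_ge_pflux_tangent[OF assms, of y x] by simp
  have "((\<lambda>h. p * (pflux p (s + h) - pflux p s)) \<longlongrightarrow> p * (pflux p (s + 0) - pflux p s)) (at 0)"
  proof (intro tendsto_intros)
    show "((\<lambda>h. pflux p (s + h)) \<longlongrightarrow> pflux p (s + 0)) (at 0)"
      using continuous_pflux[OF assms, where 'b = real]
      by (intro continuous_on_tendsto_compose[OF continuous_pflux[OF assms]] tendsto_intros) auto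
  qed
  hence "((\<lambda>h. \<bar>p * (pflux p (s + h) - pflux p s)\<bar>) \<longlongrightarrow> 0) (at 0)"
    by (simp add: tendsto_rabs_zero_iff)
  hence "((\<lambda>h. (\<bar>s + h\<bar> powr p - \<bar>s\<bar> powr p) / h - p * pflux p s) \<longlongrightarrow> 0) (at 0)"
  proof (rule Lim_null_comparison[rotated])
    have "\<bar>(\<bar>s + h\<bar> powr p - \<bar>s\<bar> powr p) / h - p * pflux p s\<bar> \<le> \<bar>p * (pflux p (s + h) - pflux p s)\<bar>" if "h \<noteq> 0" for h
    proof -
      have "\<bar>\<bar>s + h\<bar> powr p - \<bar>s\<bar> powr p - p * pflux p s * h\<bar> \<le> \<bar>p * (pflux p (s + h) - pflux p s) * h\<bar>"
        using lb[of s "s + h"] lb[of "s + h" s] by (simp add: algebra_simps)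
      hence "\<bar>\<bar>s + h\<bar> powr p - \<bar>s\<bar> powr p - p * pflux p s * h\<bar> / \<bar>h\<bar> \<le> \<bar>p * (pflux p (s + h) - pflux p s)\<bar>"
        using that by (simp add: pos_divide_le_eq flip: abs_mult)
      moreover have "(\<bar>s + h\<bar> powr p - \<bar>s\<bar> powr p) / h - p * pflux p s
          = (\<bar>s + h\<bar> powr p - \<bar>s\<bar> powr p - p * pflux p s * h) / h"
        using that by (simp add: field_simps)
      ultimately show ?thesis by (simp add: abs_divide)
    qed
    thus "\<forall>\<^sub>F h in at 0. norm ((\<bar>s + h\<bar> powr p - \<bar>s\<bar> powr p) / h - p * pflux p s) \<le> \<bar>p * (pflux p (s + h) - pflux p s)\<bar>"
      by (auto simp: eventually_at_filter)
  qed
  thus ?thesis by (simp add: DERIV_def LIM_zero_iff)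
qed

context bounded_open
begin

text \<open>
  Integrate the \<open>i\<close>-th partial derivative of \<open>x\<^sub>i |\<phi>|\<^sup>p\<close>. As \<open>\<Omega>\<close> is bounded, the term with the gradient of
  \<open>\<phi>\<close> is at most a multiple of \<open>|\<phi>|\<^sup>p\<^sup>-\<^sup>1 |\<nabla>\<phi>|\<close>, and Young's inequality absorbs half of \<open>|\<phi>|\<^sup>p\<close>.
\<close>

lemma poincare_C1c:
  obtains C where "C \<ge> 0" "\<And>\<phi> G. C1c \<Omega> \<phi> G \<Longrightarrow> (LINT x|M. norm (\<phi> x) powr p) \<le> C * (LINT x|M. norm (G x) powr p)"
proof -
  obtain R where R: "R > 0" "\<And>x. x \<in> \<Omega> \<Longrightarrow> norm x \<le> R"
    using bounded_dom by (auto simp: bounded_pos)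
  \<comment> \<open>The weight in Young's inequality for which the factor of \<open>|\<phi>|\<^sup>p\<close> is \<open>1 / 2\<close>.\<close>
  define \<kappa> where "\<kappa> = (1 / (2 * (p - 1))) powr (1 / p)"
  have \<kappa>: "\<kappa> > 0" "\<kappa> powr p = 1 / (2 * (p - 1))"
    using exponent_gt_1 by (auto simp: \<kappa>_def powr_powr)
  define C where "C = 2 * (R / \<kappa> powr (p - 1)) powr p"
  obtain i :: 'a where i: "i \<in> Basis" using nonempty_Basis by blast
  have "(LINT x|M. norm (\<phi> x) powr p) \<le> C * (LINT x|M. norm (G x) powr p)" if \<phi>: "C1c \<Omega> \<phi> G" for \<phi> G
  proof -
    obtain K where K: "compact K" "K \<subseteq> \<Omega>" "\<And>x. x \<notin> K \<Longrightarrow> \<phi> x = 0" "\<And>x. x \<notin> K \<Longrightarrow> G x = 0"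
      "\<And>x. (\<phi> has_derivative (\<lambda>h. G x \<bullet> h)) (at x)" "continuous_on UNIV \<phi>" "continuous_on UNIV G"
      using C1cE[OF \<phi>] by metis
    define P where "P x = (\<bar>\<phi> x\<bar> powr p) *\<^sub>R i + ((x \<bullet> i) * (p * pflux p (\<phi> x))) *\<^sub>R G x" for x
    have pc: "continuous_on UNIV (\<lambda>x. \<bar>\<phi> x\<bar> powr p)" "continuous_on UNIV (\<lambda>x. pflux p (\<phi> x))"
      by (intro continuous_on_powr' continuous_intros K(6); use exponent_pos in simp)
        (intro continuous_on_compose2[OF continuous_pflux[OF exponent_gt_1] K(6)]; simp)
    have "(LINT x|lborel. P x \<bullet> i) = 0"
    proof (rule integral_partial_derivative_eq_0[where F = "\<lambda>x. (x \<bullet> i) * \<bar>\<phi> x\<bar> powr p" and K = K])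
      fix x
      have "((\<lambda>s::real. \<bar>s\<bar> powr p) has_derivative (\<lambda>h. p * pflux p (\<phi> x) * h)) (at (\<phi> x))"
        using abs_powr_deriv[OF exponent_gt_1] by (simp add: has_field_derivative_def)
      from has_derivative_compose[OF K(5) this]
      have 1: "((\<lambda>x. \<bar>\<phi> x\<bar> powr p) has_derivative (\<lambda>h. p * pflux p (\<phi> x) * (G x \<bullet> h))) (at x)" .
      have 2: "((\<lambda>x. x \<bullet> i) has_derivative (\<lambda>h. h \<bullet> i)) (at x)"
        by (intro derivative_intros)
      have eq: "(\<lambda>h. P x \<bullet> h) = (\<lambda>h. (x \<bullet> i) * (p * pflux p (\<phi> x) * (G x \<bullet> h)) + (h \<bullet> i) * \<bar>\<phi> x\<bar> powr p)"
        by (rule ext) (simp add: P_def inner_add_left inner_commute[of i])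
      show "((\<lambda>x. (x \<bullet> i) * \<bar>\<phi> x\<bar> powr p) has_derivative (\<lambda>h. P x \<bullet> h)) (at x)"
        unfolding eq by (rule has_derivative_mult[OF 2 1])
      show "continuous_on UNIV P"
        unfolding P_def by (intro continuous_intros pc K)
    qed (use K i in \<open>auto simp: P_def\<close>)
    moreover have "P x \<bullet> i = \<bar>\<phi> x\<bar> powr p + (x \<bullet> i) * (p * pflux p (\<phi> x)) * (G x \<bullet> i)" for x
      using i by (simp add: P_def inner_add_left)
    moreover have "(LINT x|M. P x \<bullet> i) = (LINT x|lborel. P x \<bullet> i)"
      by (rule integral_M_eq_lborel[OF _ K(2)])
        (unfold P_def, intro continuous_intros pc K, simp add: K(3))
    moreover define Q where "Q x = - ((x \<bullet> i) * (p * pflux p (\<phi> x)) * (G x \<bullet> i))" for x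
    ultimately have z: "(LINT x|M. \<bar>\<phi> x\<bar> powr p - Q x) = 0" by simp
    have i1: "integrable M (\<lambda>x. \<bar>\<phi> x\<bar> powr p)" "integrable M (\<lambda>x. norm (G x) powr p)"
      using C1c_Lp[OF \<phi>] by (auto dest: LpD)
    have i2: "integrable M Q"
    proof -
      have c: "continuous_on UNIV Q" unfolding Q_def[abs_def] by (intro continuous_intros pc K)
      have "Q x = 0" if "x \<notin> K" for x using K(4)[OF that] by (simp add: Q_def)
      from bounded_compact_support[OF c K(1) this] obtain B where "\<And>x. norm (Q x) \<le> B" by blast
      from Lp_imp_integrable[OF finite_M exponent_pos(3) bounded_imp_Lp[OF continuous_measurable_lebesgue_on(1)[OF c] this]]
      show ?thesis .
    qed
    have "Q x \<le> \<bar>\<phi> x\<bar> powr p / 2 + (R / \<kappa> powr (p - 1)) powr p * norm (G x) powr p" if "x \<in> \<Omega>" for x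
    proof -
      define a where "a = R / \<kappa> powr (p - 1) * norm (G x)"
      have a: "a \<ge> 0" using R \<kappa> by (simp add: a_def)
      have "\<bar>Q x\<bar> = \<bar>x \<bullet> i\<bar> * (p * \<bar>\<phi> x\<bar> powr (p - 1)) * \<bar>G x \<bullet> i\<bar>"
        using exponent_pos norm_pflux[of p "\<phi> x"] by (simp add: Q_def abs_mult)
      also have "\<dots> \<le> R * (p * \<bar>\<phi> x\<bar> powr (p - 1)) * norm (G x)"
        using R(2)[OF that] Basis_le_norm[OF i, of x] Basis_le_norm[OF i, of "G x"] R(1) exponent_pos
        by (intro mult_mono) auto
      also have "\<dots> = p * (\<kappa> * \<bar>\<phi> x\<bar>) powr (p - 1) * a"
        using \<kappa> by (simp add: a_def powr_mult)
      also have "\<dots> \<le> (p - 1) * (\<kappa> * \<bar>\<phi> x\<bar>) powr p + a powr p"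
        using \<kappa> a by (intro scalar_young exponent_gt_1) auto
      also have "\<dots> = \<bar>\<phi> x\<bar> powr p / 2 + (R / \<kappa> powr (p - 1)) powr p * norm (G x) powr p"
      proof -
        have "(p - 1) * (1 / (2 * (p - 1))) = 1 / 2" using exponent_gt_1 by simp
        thus ?thesis by (simp add: powr_mult a_def \<kappa>(2) del: times_divide_eq_left times_divide_eq_right
            flip: mult.assoc)
      qed
      finally show ?thesis by linarith
    qed
    hence "(LINT x|M. Q x) \<le> (LINT x|M. \<bar>\<phi> x\<bar> powr p / 2 + (R / \<kappa> powr (p - 1)) powr p * norm (G x) powr p)"
      using i1 i2 by (intro integral_mono) auto
    moreover have "(LINT x|M. Q x) = (LINT x|M. \<bar>\<phi> x\<bar> powr p)" using z i1 i2 by simp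
    ultimately show ?thesis using i1 by (simp add: C_def)
  qed
  thus ?thesis using that[of C] by (simp add: C_def)
qed

lemma poincare:
  obtains C where "C \<ge> 0" "\<And>u g. W0 \<Omega> p u g \<Longrightarrow> (LINT x|M. norm (u x) powr p) \<le> C * (LINT x|M. norm (g x) powr p)"
proof -
  obtain C where C: "C \<ge> 0" "\<And>\<phi> G. C1c \<Omega> \<phi> G \<Longrightarrow> (LINT x|M. norm (\<phi> x) powr p) \<le> C * (LINT x|M. norm (G x) powr p)"
    using poincare_C1c by blast
  define A where "A = (2::real) powr p"
  have A: "A > 0" by (simp add: A_def)
  have "(LINT x|M. norm (u x) powr p) \<le> A * C * A * (LINT x|M. norm (g x) powr p)" if u: "W0 \<Omega> p u g" for u g
  proof (rule field_le_epsilon)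
    fix e :: real assume "e > 0"
    define d where "d = e / (A + A * C * A + 1)"
    have pos: "A + A * C * A + 1 > 0" using A C by (simp add: add_pos_nonneg)
    have d: "d > 0" using \<open>e > 0\<close> pos by (simp add: d_def)
    obtain \<phi> G where \<phi>: "C1c \<Omega> \<phi> G" "(LINT x|M. norm (\<phi> x - u x) powr p) < d"
      "(LINT x|M. norm (G x - g x) powr p) < d"
      using u d unfolding W0_approx by blast
    have "(LINT x|M. norm (u x - 0) powr p) \<le> A * ((LINT x|M. norm (u x - \<phi> x) powr p) + (LINT x|M. norm (\<phi> x - 0) powr p))"
      "(LINT x|M. norm (G x - 0) powr p) \<le> A * ((LINT x|M. norm (G x - g x) powr p) + (LINT x|M. norm (g x - 0) powr p))"
      unfolding A_def by (rule Lp_dist_triangle; (rule W0_Lp[OF u] C1c_Lp[OF \<phi>(1)] Lp_zero)+)+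
    hence 1: "(LINT x|M. norm (u x) powr p) \<le> A * (d + (LINT x|M. norm (\<phi> x) powr p))"
      and 2: "(LINT x|M. norm (G x) powr p) \<le> A * (d + (LINT x|M. norm (g x) powr p))"
      using \<phi>(2,3) A by (simp_all add: norm_minus_commute abs_minus_commute)
        (smt (verit) mult_left_mono)+
    have "(LINT x|M. norm (u x) powr p) \<le> A * (d + C * (A * (d + (LINT x|M. norm (g x) powr p))))"
      using 1 C(2)[OF \<phi>(1)] mult_left_mono[OF 2 C(1)] A
      by (meson add_left_mono less_imp_le mult_left_mono order_trans)
    also have "\<dots> = (A + A * C * A) * d + A * C * A * (LINT x|M. norm (g x) powr p)"
      by (simp add: algebra_simps)
    also have "(A + A * C * A) * d \<le> (A + A * C * A + 1) * d" using d by simp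
    also have "(A + A * C * A + 1) * d = e" using pos by (simp add: d_def)
    finally show "(LINT x|M. norm (u x) powr p) \<le> A * C * A * (LINT x|M. norm (g x) powr p) + e"
      by simp
  qed
  thus ?thesis using that[of "A * C * A"] A C by simp
qed

lemma W0_Lp_lim_of_gradients:
  assumes "\<And>n. W0 \<Omega> p (U n) (G n)" "W0 \<Omega> p u g" "Lp_lim M p G g"
  shows "Lp_lim M p U u"
  unfolding Lp_lim_def
proof (intro conjI allI W0_Lp(1)[OF assms(1)] W0_Lp(1)[OF assms(2)])
  obtain C where "C \<ge> 0" and C: "\<And>u g. W0 \<Omega> p u g \<Longrightarrow> (LINT x|M. norm (u x) powr p) \<le> C * (LINT x|M. norm (g x) powr p)"
    using poincare by blast
  have lim: "(\<lambda>n. C * (LINT x|M. norm (G n x - g x) powr p)) \<longlonglongrightarrow> 0"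
    using tendsto_mult_left[OF Lp_limD(3)[OF assms(3)], of C] by simp
  show "(\<lambda>n. LINT x|M. norm (U n x - u x) powr p) \<longlonglongrightarrow> 0"
    by (rule tendsto_sandwich[OF _ _ tendsto_const lim])
      (use C[OF W0_diff[OF assms(1,2)]] in \<open>auto intro!: always_eventually Bochner_Integration.integral_nonneg\<close>)
qed

end

section \<open>Near-minimizers with compact support\<close>

lemma (in bounded_open) pflux_inner_integrable:
  fixes h k :: "'a \<Rightarrow> 'a"
  assumes "Lp M p h" "Lp M p k"
  shows "integrable M (\<lambda>x. pflux p (h x) \<bullet> k x)"
proof (rule Bochner_Integration.integrable_bound)
  have [measurable]: "h \<in> borel_measurable M" "k \<in> borel_measurable M"
    using assms by (auto dest: LpD)
  have [measurable]: "pflux p \<in> borel_measurable (borel :: 'a measure)"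
    by (rule borel_measurable_continuous_onI[OF continuous_pflux[OF exponent_gt_1]])
  show "(\<lambda>x. pflux p (h x) \<bullet> k x) \<in> borel_measurable M" by measurable
  show "integrable M (\<lambda>x. norm (h x) powr p + norm (k x) powr p)"
    using assms[THEN LpD(2)] by simp
  show "AE x in M. norm (pflux p (h x) \<bullet> k x) \<le> norm (norm (h x) powr p + norm (k x) powr p)"
  proof (rule AE_I2)
    fix x
    show "norm (pflux p (h x) \<bullet> k x) \<le> norm (norm (h x) powr p + norm (k x) powr p)"
      using pflux_inner_le[of p "h x" "k x"] powr_pm1_mult_le[OF exponent_gt_1, of "norm (h x)" "norm (k x)"]
      by simp
  qed
qed

context bounded_open
begin

lemma energy_cong:
  assumes "W0 \<Omega> p u g" "AE x in M. g' x = g x"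
  shows "(LINT x|M. norm (g' x) powr p) = (LINT x|M. norm (g x) powr p)"
proof -
  have [measurable]: "g \<in> borel_measurable M" by (rule W0_measurable(2)[OF assms(1)])
  have [measurable]: "g' \<in> borel_measurable M"
    by (rule borel_measurable_lebesgue_on_AE[OF open_dom W0_measurable(2)[OF assms(1)]])
      (use assms(2) in \<open>auto elim!: eventually_mono\<close>)
  show ?thesis
    by (rule integral_cong_AE) (measurable, use assms(2) in \<open>auto elim!: eventually_mono\<close>)
qed

lemma flux_cong:
  assumes "W0 \<Omega> p u h" "W0 \<Omega> p \<xi> k" "AE x in M. k' x = k x"
  shows "(LINT x|M. pflux p (h x) \<bullet> k' x) = (LINT x|M. pflux p (h x) \<bullet> k x)"
proof -
  have [measurable]: "h \<in> borel_measurable M" "k \<in> borel_measurable M"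
    using W0_measurable(2)[OF assms(1)] W0_measurable(2)[OF assms(2)] by auto
  have [measurable]: "k' \<in> borel_measurable M"
    by (rule borel_measurable_lebesgue_on_AE[OF open_dom W0_measurable(2)[OF assms(2)]])
      (use assms(3) in \<open>auto elim!: eventually_mono\<close>)
  have [measurable]: "pflux p \<in> borel_measurable (borel :: 'a measure)"
    by (rule borel_measurable_continuous_onI[OF continuous_pflux[OF exponent_gt_1]])
  show ?thesis
    by (rule integral_cong_AE) (measurable, use assms(3) in \<open>auto elim!: eventually_mono\<close>)
qed

end

text \<open>
  The function \<open>\<phi>\<close> minimizes the Rayleigh quotient. The inequality \<open>minimal\<close> is multiplied
  out, so that it makes sense for functions of zero mass.
\<close>

locale first_eigen = bounded_open +
  fixes m \<phi> :: "'a \<Rightarrow> real" and D\<phi> :: "'a \<Rightarrow> 'a" and \<Lambda>\<^sub>1 :: real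
  assumes m_integrable: "integrable M m" and m_nonneg: "AE x in M. 0 \<le> m x"
    and \<phi>_W0: "W0 \<Omega> p \<phi> D\<phi>" and \<phi>_range: "AE x in M. 0 \<le> \<phi> x \<and> \<phi> x \<le> 1"
    and \<phi>_pos: "(LINT x|M. m x * \<bar>\<phi> x\<bar> powr p) > 0"
    and minimal: "\<And>u g. W0 \<Omega> p u g \<Longrightarrow>
      \<Lambda>\<^sub>1 * (LINT x|M. m x * \<bar>u x\<bar> powr p) \<le> (LINT x|M. norm (g x) powr p)"
    and attained: "(LINT x|M. norm (D\<phi> x) powr p) = \<Lambda>\<^sub>1 * (LINT x|M. m x * \<bar>\<phi> x\<bar> powr p)"
begin

abbreviation energy :: "('a \<Rightarrow> 'a) \<Rightarrow> real" where
  "energy g \<equiv> LINT x|M. norm (g x) powr p"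

abbreviation mass :: "('a \<Rightarrow> real) \<Rightarrow> real" where
  "mass u \<equiv> LINT x|M. m x * \<bar>u x\<bar> powr p"

definition admissible :: "'a set \<Rightarrow> ('a \<Rightarrow> real) \<Rightarrow> ('a \<Rightarrow> 'a) \<Rightarrow> bool" where
  "admissible K w g \<longleftrightarrow> W0 \<Omega> p w g \<and> (AE x in M. 0 \<le> w x \<and> w x \<le> \<phi> x) \<and>
     (AE x in M. x \<notin> K \<longrightarrow> w x = 0)"

lemma energy_nonneg: "energy g \<ge> 0"
  by (rule Bochner_Integration.integral_nonneg) auto

lemma eigenvalue_nonneg: "\<Lambda>\<^sub>1 \<ge> 0"
  using energy_nonneg[of D\<phi>] \<phi>_pos attained by (simp add: zero_le_mult_iff)

lemma mass_integrable:
  assumes "u \<in> borel_measurable M" "AE x in M. \<bar>u x\<bar> \<le> B"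
  shows "integrable M (\<lambda>x. m x * \<bar>u x\<bar> powr p)"
proof (rule integrable_mult_AE_bounded[OF m_integrable])
  note [measurable] = assms(1)
  show "(\<lambda>x. \<bar>u x\<bar> powr p) \<in> borel_measurable M" by measurable
  show "AE x in M. \<bar>\<bar>u x\<bar> powr p\<bar> \<le> B powr p"
    using assms(2) by eventually_elim (use exponent_pos in \<open>auto intro!: powr_mono2\<close>)
qed

lemma mass_mono:
  assumes "u \<in> borel_measurable M" "v \<in> borel_measurable M"
    and "AE x in M. \<bar>u x\<bar> \<le> \<bar>v x\<bar>" "AE x in M. \<bar>v x\<bar> \<le> B"
  shows "mass u \<le> mass v"
proof (rule integral_mono_AE)
  show "integrable M (\<lambda>x. m x * \<bar>v x\<bar> powr p)" by (rule mass_integrable[OF assms(2,4)])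
  show "integrable M (\<lambda>x. m x * \<bar>u x\<bar> powr p)"
    by (rule mass_integrable[OF assms(1), of B]) (use assms(3,4) in \<open>eventually_elim, simp\<close>)
  show "AE x in M. m x * \<bar>u x\<bar> powr p \<le> m x * \<bar>v x\<bar> powr p"
    using assms(3) m_nonneg by eventually_elim (use exponent_pos in \<open>auto intro!: mult_left_mono powr_mono2\<close>)
qed

lemma \<phi>_measurable: "\<phi> \<in> borel_measurable M"
  by (rule W0_measurable(1)[OF \<phi>_W0])

lemma below_\<phi>:
  assumes "AE x in M. 0 \<le> w x \<and> w x \<le> \<phi> x"
  shows "AE x in M. \<bar>w x\<bar> \<le> \<bar>\<phi> x\<bar>" "AE x in M. \<bar>w x\<bar> \<le> 1" "AE x in M. \<bar>\<phi> x\<bar> \<le> 1"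
proof -
  show "AE x in M. \<bar>w x\<bar> \<le> \<bar>\<phi> x\<bar>" using assms by eventually_elim auto
  show "AE x in M. \<bar>w x\<bar> \<le> 1" using assms \<phi>_range by eventually_elim auto
  show "AE x in M. \<bar>\<phi> x\<bar> \<le> 1" using \<phi>_range by eventually_elim auto
qed

text \<open>
  The energies of \<open>min a \<phi>\<close> and \<open>max a \<phi>\<close> add up to those of \<open>a\<close> and \<open>\<phi>\<close>. Since \<open>\<phi>\<close> is a minimizer and
  \<open>max a \<phi> \<ge> \<phi>\<close>, the maximum has at least the energy of \<open>\<phi>\<close>.
\<close>

lemma energy_truncation_le:
  assumes a: "W0 \<Omega> p a g" and nn: "AE x in M. 0 \<le> a x" and B: "AE x in M. a x \<le> B"
  obtains h where "W0 \<Omega> p (\<lambda>x. min (a x) (\<phi> x)) h" "energy h \<le> energy g"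
proof -
  define d where "d x = (if a x - \<phi> x > 0 then 1 else 0) *\<^sub>R (g x - D\<phi> x)" for x
  have D: "W0 \<Omega> p (\<lambda>x. max 0 (a x - \<phi> x)) d"
    unfolding d_def by (rule W0_pos_part[OF W0_diff[OF a \<phi>_W0]])
  define h k where "h x = g x - d x" and "k x = D\<phi> x + d x" for x
  have h: "W0 \<Omega> p (\<lambda>x. min (a x) (\<phi> x)) h"
  proof -
    have "(\<lambda>x. a x - max 0 (a x - \<phi> x)) = (\<lambda>x. min (a x) (\<phi> x))" by (auto simp: fun_eq_iff)
    thus ?thesis using W0_diff[OF a D] unfolding h_def by simp
  qed
  have k: "W0 \<Omega> p (\<lambda>x. max (a x) (\<phi> x)) k"
  proof -
    have "(\<lambda>x. \<phi> x + max 0 (a x - \<phi> x)) = (\<lambda>x. max (a x) (\<phi> x))" by (auto simp: fun_eq_iff)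
    thus ?thesis using W0_add[OF \<phi>_W0 D] unfolding k_def by simp
  qed
  have i: "integrable M (\<lambda>x. norm (f x) powr p)" if "Lp M p f" for f :: "'a \<Rightarrow> 'a" using that by (rule LpD)
  have "energy h + energy k = energy g + energy D\<phi>"
  proof -
    have "norm (h x) powr p + norm (k x) powr p = norm (g x) powr p + norm (D\<phi> x) powr p" for x
      by (simp add: h_def k_def d_def)
    hence "(LINT x|M. norm (h x) powr p + norm (k x) powr p) = (LINT x|M. norm (g x) powr p + norm (D\<phi> x) powr p)"
      by simp
    thus ?thesis using i[OF W0_Lp(2)[OF h]] i[OF W0_Lp(2)[OF k]] i[OF W0_Lp(2)[OF a]] i[OF W0_Lp(2)[OF \<phi>_W0]]
      by simp
  qed
  moreover have "energy D\<phi> \<le> energy k"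
  proof -
    have "mass \<phi> \<le> mass (\<lambda>x. max (a x) (\<phi> x))"
    proof (rule mass_mono[OF \<phi>_measurable W0_measurable(1)[OF k]])
      show "AE x in M. \<bar>\<phi> x\<bar> \<le> \<bar>max (a x) (\<phi> x)\<bar>" using \<phi>_range by eventually_elim auto
      show "AE x in M. \<bar>max (a x) (\<phi> x)\<bar> \<le> max B 1" using \<phi>_range B nn by eventually_elim auto
    qed
    hence "\<Lambda>\<^sub>1 * mass \<phi> \<le> \<Lambda>\<^sub>1 * mass (\<lambda>x. max (a x) (\<phi> x))"
      using eigenvalue_nonneg by (rule mult_left_mono)
    thus ?thesis using minimal[OF k] attained by simp
  qed
  ultimately show ?thesis using that[OF h] by simp
qed

text \<open>
  Truncate a compactly supported approximation of \<open>\<phi>\<close> to values between \<open>0\<close> and \<open>\<phi>\<close>: by the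
  previous lemma the energy does not increase, and the truncation still converges to \<open>\<phi>\<close>.
\<close>

lemma admissible_approximation:
  assumes "\<kappa> > 0"
  obtains K w g where "compact K" "K \<subseteq> \<Omega>" "admissible K w g"
    "energy g \<le> energy D\<phi> + \<kappa>" "mass w \<ge> mass \<phi> - \<kappa>"
proof -
  obtain \<psi>0 G0 where \<psi>0: "\<And>n::nat. C1c \<Omega> (\<psi>0 n) (G0 n)" "Lp_lim M p \<psi>0 \<phi>" "Lp_lim M p G0 D\<phi>"
    using \<phi>_W0 unfolding W0_def by blast
  obtain r :: "nat \<Rightarrow> nat" where r: "strict_mono r" "AE x in M. (\<lambda>n. \<psi>0 (r n) x) \<longlonglongrightarrow> \<phi> x"
    using Lp_lim_AE_subseq[OF exponent_pos(1) \<psi>0(2)] by blast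
  define \<psi> G where "\<psi> n = \<psi>0 (r n)" and "G n = G0 (r n)" for n
  have C: "C1c \<Omega> (\<psi> n) (G n)" for n by (simp add: \<psi>_def G_def \<psi>0)
  have limG: "Lp_lim M p G D\<phi>" unfolding G_def using Lp_lim_subseq[OF \<psi>0(3) r(1)] by simp
  have ae: "AE x in M. (\<lambda>n. \<psi> n x) \<longlonglongrightarrow> \<phi> x" using r(2) by (simp add: \<psi>_def)
  define w where "w n x = min (max 0 (\<psi> n x)) (\<phi> x)" for n x
  have [measurable]: "\<psi> n \<in> borel_measurable M" for n using C1c_Lp(1)[OF C] by (rule LpD)
  note [measurable] = \<phi>_measurable borel_measurable_integrable[OF m_integrable]
  have wm [measurable]: "w n \<in> borel_measurable M" for n unfolding w_def by measurable
  have rng: "AE x in M. 0 \<le> w n x \<and> w n x \<le> \<phi> x" for n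
    using \<phi>_range by eventually_elim (auto simp: w_def)
  have "(\<lambda>n. mass (w n)) \<longlonglongrightarrow> mass \<phi>"
  proof (rule integral_dominated_convergence[where w = "\<lambda>x. \<bar>m x\<bar>"])
    show "AE x in M. (\<lambda>n. m x * \<bar>w n x\<bar> powr p) \<longlonglongrightarrow> m x * \<bar>\<phi> x\<bar> powr p"
      using ae \<phi>_range
    proof eventually_elim
      case (elim x)
      have "(\<lambda>n. w n x) \<longlonglongrightarrow> min (max 0 (\<phi> x)) (\<phi> x)"
        unfolding w_def using elim by (intro tendsto_intros) auto
      hence "(\<lambda>n. w n x) \<longlonglongrightarrow> \<phi> x" using elim by simp
      thus ?case using exponent_pos by (intro tendsto_intros tendsto_powr') auto
    qed
    show "AE x in M. norm (m x * \<bar>w n x\<bar> powr p) \<le> \<bar>m x\<bar>" for n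
      using below_\<phi>(2)[OF rng[of n]]
    proof eventually_elim
      case (elim x)
      hence "\<bar>w n x\<bar> powr p \<le> 1 powr p" using exponent_pos by (intro powr_mono2) auto
      thus ?case by (simp add: abs_mult mult_left_le)
    qed
    show "integrable M (\<lambda>x. \<bar>m x\<bar>)" using m_integrable by simp
  qed measurable
  hence "\<forall>\<^sub>F n in sequentially. mass (w n) > mass \<phi> - \<kappa>"
    by (rule order_tendstoD) (use assms in simp)
  moreover have "\<forall>\<^sub>F n in sequentially. energy (G n) \<le> energy D\<phi> + \<kappa>"
    by (rule Lp_lim_integral_powr_le[OF exponent_gt_1 limG assms])
  ultimately obtain n where n: "mass (w n) > mass \<phi> - \<kappa>" "energy (G n) \<le> energy D\<phi> + \<kappa>"
    using eventually_happens'[OF sequentially_bot eventually_conj] by blast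
  obtain K B where K: "compact K" "K \<subseteq> \<Omega>" "\<And>x. x \<notin> K \<Longrightarrow> \<psi> n x = 0" "\<And>x. \<bar>\<psi> n x\<bar> \<le> B"
    using C1cE[OF C[of n]] by metis
  let ?g = "\<lambda>x. (if \<psi> n x > 0 then 1 else 0) *\<^sub>R G n x"
  have pos: "W0 \<Omega> p (\<lambda>x. max 0 (\<psi> n x)) ?g"
    by (rule W0_pos_part[OF C1c_imp_W0[OF C]])
  have "B \<ge> 0" using K(4)[of undefined] by linarith
  hence "max 0 (\<psi> n x) \<le> B" for x using K(4)[of x] by (simp add: abs_le_iff)
  then obtain h where h: "W0 \<Omega> p (w n) h" "energy h \<le> energy ?g"
    using energy_truncation_le[OF pos, of B] unfolding w_def by auto
  have "energy ?g \<le> energy (G n)"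
    using LpD(2)[OF W0_Lp(2)[OF pos]] LpD(2)[OF C1c_Lp(2)[OF C[of n]]] by (intro integral_mono) auto
  moreover have "admissible K (w n) h"
    unfolding admissible_def
  proof (intro conjI h(1) rng)
    show "AE x in M. x \<notin> K \<longrightarrow> w n x = 0"
      using \<phi>_range by eventually_elim (use K(3) in \<open>auto simp: w_def\<close>)
  qed
  ultimately show ?thesis using that[OF K(1,2)] h(2) n by fastforce
qed

text \<open>
  The midpoint of \<open>w\<close> and \<open>\<phi>\<close> lies above \<open>w\<close>, so its energy is at least \<open>\<Lambda>\<^sub>1\<close> times the mass of \<open>w\<close>.
  Hence the convexity deficit of the gradients tends to \<open>0\<close>, the gradients converge, and the
  functions follow by the Poincare inequality.
\<close>

lemma near_minimal_Lp_lim: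
  assumes w: "\<And>n. W0 \<Omega> p (w n) (g n)" and rng: "\<And>n. AE x in M. 0 \<le> w n x \<and> w n x \<le> \<phi> x"
    and e: "\<And>n. energy (g n) \<le> energy D\<phi> + \<kappa> n" and ms: "\<And>n. mass (w n) \<ge> mass \<phi> - \<kappa> n"
    and \<kappa>: "\<kappa> \<longlonglongrightarrow> 0" "\<And>n. \<kappa> n \<le> 1"
  shows "Lp_lim M p w \<phi>"
proof (rule W0_Lp_lim_of_gradients[OF w \<phi>_W0])
  define mid where "mid n = energy (\<lambda>x. (g n x + D\<phi> x) /\<^sub>R 2)" for n
  show "Lp_lim M p g D\<phi>"
  proof (rule Lp_lim_of_midpoints[OF exponent_gt_1 W0_Lp(2)[OF w] W0_Lp(2)[OF \<phi>_W0]])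
    show "energy (g n) \<le> energy D\<phi> + 1" for n using e[of n] \<kappa>(2)[of n] by linarith
    have lower: "mid n \<ge> energy D\<phi> - \<Lambda>\<^sub>1 * \<kappa> n" for n
    proof -
      have W: "W0 \<Omega> p (\<lambda>x. (1/2) * w n x + (1/2) * \<phi> x) (\<lambda>x. (1/2) *\<^sub>R g n x + (1/2) *\<^sub>R D\<phi> x)"
        by (rule W0_linear[OF w \<phi>_W0])
      have "mass (w n) \<le> mass (\<lambda>x. (1/2) * w n x + (1/2) * \<phi> x)"
      proof (rule mass_mono[OF W0_measurable(1)[OF w] W0_measurable(1)[OF W]])
        show "AE x in M. \<bar>w n x\<bar> \<le> \<bar>(1/2) * w n x + (1/2) * \<phi> x\<bar>" using rng[of n] by eventually_elim auto
        show "AE x in M. \<bar>(1/2) * w n x + (1/2) * \<phi> x\<bar> \<le> 1" using rng[of n] \<phi>_range by eventually_elim auto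
      qed
      hence "\<Lambda>\<^sub>1 * (mass \<phi> - \<kappa> n) \<le> \<Lambda>\<^sub>1 * mass (\<lambda>x. (1/2) * w n x + (1/2) * \<phi> x)"
        using ms[of n] eigenvalue_nonneg by (intro mult_left_mono) auto
      also have "\<dots> \<le> energy (\<lambda>x. (1/2) *\<^sub>R g n x + (1/2) *\<^sub>R D\<phi> x)"
        by (rule minimal[OF W])
      also have "(\<lambda>x. (1/2) *\<^sub>R g n x + (1/2) *\<^sub>R D\<phi> x) = (\<lambda>x. (g n x + D\<phi> x) /\<^sub>R 2)"
        by (simp add: scaleR_add_right)
      finally show ?thesis using attained by (simp add: mid_def algebra_simps)
    qed
    have upper: "mid n \<le> (energy (g n) + energy D\<phi>) / 2" for n
    proof -
      have i: "integrable M (\<lambda>x. norm (g n x) powr p)" "integrable M (\<lambda>x. norm (D\<phi> x) powr p)"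
        "integrable M (\<lambda>x. norm ((g n x + D\<phi> x) /\<^sub>R 2) powr p)"
        by (intro LpD(2) Lp_scaleR Lp_add exponent_pos W0_Lp(2)[OF w] W0_Lp(2)[OF \<phi>_W0])+
      have "mid n \<le> (LINT x|M. (norm (g n x) powr p + norm (D\<phi> x) powr p) / 2)"
        unfolding mid_def using i norm_powr_midpoint[OF exponent_gt_1] by (intro integral_mono) auto
      thus ?thesis using i by simp
    qed
    have "(\<lambda>n. \<kappa> n / 2 + \<Lambda>\<^sub>1 * \<kappa> n) \<longlonglongrightarrow> 0 / 2 + \<Lambda>\<^sub>1 * 0"
      by (intro tendsto_intros \<kappa>) simp
    hence lim: "(\<lambda>n. \<kappa> n / 2 + \<Lambda>\<^sub>1 * \<kappa> n) \<longlonglongrightarrow> 0" by simp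
    show "(\<lambda>n. (energy (g n) + energy D\<phi>) / 2 - energy (\<lambda>x. (g n x + D\<phi> x) /\<^sub>R 2)) \<longlonglongrightarrow> 0"
    proof (rule tendsto_sandwich[OF _ _ tendsto_const lim]; intro always_eventually allI)
      fix n
      show "0 \<le> (energy (g n) + energy D\<phi>) / 2 - energy (\<lambda>x. (g n x + D\<phi> x) /\<^sub>R 2)"
        using upper[of n] by (simp add: mid_def)
      show "(energy (g n) + energy D\<phi>) / 2 - energy (\<lambda>x. (g n x + D\<phi> x) /\<^sub>R 2) \<le> \<kappa> n / 2 + \<Lambda>\<^sub>1 * \<kappa> n"
        using lower[of n] e[of n] unfolding mid_def by argo
    qed
  qed
qed

text \<open>
  Otherwise some sequence of \<open>w\<close> would converge to \<open>\<phi>\<close> with nonpositive weighted integrals, and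
  dominated convergence would contradict the sign of the integral of \<open>a |\<phi>|\<^sup>q\<close>.
\<close>

lemma near_minimal_weighted_positive:
  assumes a: "integrable M a" and q: "q > 0" and pos: "(LINT x|M. a x * \<bar>\<phi> x\<bar> powr q) > 0"
  obtains \<kappa> where "\<kappa> > 0"
    "\<And>w g. W0 \<Omega> p w g \<Longrightarrow> (AE x in M. 0 \<le> w x \<and> w x \<le> \<phi> x) \<Longrightarrow>
       energy g \<le> energy D\<phi> + \<kappa> \<Longrightarrow> mass w \<ge> mass \<phi> - \<kappa> \<Longrightarrow> (LINT x|M. a x * \<bar>w x\<bar> powr q) > 0"
proof -
  define good where "good \<kappa> \<longleftrightarrow> (\<forall>w g. W0 \<Omega> p w g \<longrightarrow> (AE x in M. 0 \<le> w x \<and> w x \<le> \<phi> x) \<longrightarrow>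
       energy g \<le> energy D\<phi> + \<kappa> \<longrightarrow> mass w \<ge> mass \<phi> - \<kappa> \<longrightarrow> (LINT x|M. a x * \<bar>w x\<bar> powr q) > 0)" for \<kappa>
  have "\<exists>n::nat. good (inverse (real (Suc n)))"
  proof (rule ccontr)
    assume "\<not> ?thesis"
    hence "\<forall>n::nat. \<exists>w g. W0 \<Omega> p w g \<and> (AE x in M. 0 \<le> w x \<and> w x \<le> \<phi> x) \<and>
       energy g \<le> energy D\<phi> + inverse (real (Suc n)) \<and> mass w \<ge> mass \<phi> - inverse (real (Suc n)) \<and>
       \<not> (LINT x|M. a x * \<bar>w x\<bar> powr q) > 0"
      unfolding good_def by blast
    then obtain w g where w: "\<And>n. W0 \<Omega> p (w n) (g n)" "\<And>n. AE x in M. 0 \<le> w n x \<and> w n x \<le> \<phi> x"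
       "\<And>n. energy (g n) \<le> energy D\<phi> + inverse (real (Suc n))"
       "\<And>n. mass (w n) \<ge> mass \<phi> - inverse (real (Suc n))"
       "\<And>n::nat. \<not> (LINT x|M. a x * \<bar>w n x\<bar> powr q) > 0"
      unfolding choice_iff by blast
    have "inverse (real (Suc n)) \<le> 1" for n by (simp add: inverse_le_1_iff)
    from near_minimal_Lp_lim[OF w(1-4) LIMSEQ_inverse_real_of_nat this]
    have "Lp_lim M p w \<phi>" .
    then obtain r :: "nat \<Rightarrow> nat" where r: "AE x in M. (\<lambda>n. w (r n) x) \<longlonglongrightarrow> \<phi> x"
      using Lp_lim_AE_subseq[OF exponent_pos(1)] by blast
    note [measurable] = \<phi>_measurable borel_measurable_integrable[OF a]
    have [measurable]: "w n \<in> borel_measurable M" for n by (rule W0_measurable(1)[OF w(1)])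
    have "(\<lambda>n. LINT x|M. a x * \<bar>w (r n) x\<bar> powr q) \<longlonglongrightarrow> (LINT x|M. a x * \<bar>\<phi> x\<bar> powr q)"
    proof (rule integral_dominated_convergence[where w = "\<lambda>x. \<bar>a x\<bar>"])
      show "AE x in M. (\<lambda>n. a x * \<bar>w (r n) x\<bar> powr q) \<longlonglongrightarrow> a x * \<bar>\<phi> x\<bar> powr q"
        using r by eventually_elim (use q in \<open>intro tendsto_intros tendsto_powr'; auto\<close>)
      show "AE x in M. norm (a x * \<bar>w (r n) x\<bar> powr q) \<le> \<bar>a x\<bar>" for n
        using below_\<phi>(2)[OF w(2)[of "r n"]]
      proof eventually_elim
        case (elim x)
        hence "\<bar>w (r n) x\<bar> powr q \<le> 1 powr q" using q by (intro powr_mono2) auto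
        thus ?case by (simp add: abs_mult mult_left_le)
      qed
      show "integrable M (\<lambda>x. \<bar>a x\<bar>)" using a by simp
    qed measurable
    hence "(LINT x|M. a x * \<bar>\<phi> x\<bar> powr q) \<le> 0"
      by (rule LIMSEQ_le_const2) (use w(5) in \<open>auto simp: not_less\<close>)
    thus False using pos by simp
  qed
  then obtain n where "good (inverse (real (Suc n)))" by blast
  thus ?thesis using that[of "inverse (real (Suc n))"] unfolding good_def by simp
qed

text \<open>
  Without the support condition, \<open>\<phi>\<close> itself minimizes \<open>energy g - \<Lambda> * mass w\<close>:
  the excess over the value at \<open>\<phi>\<close> is the sum of \<open>energy g - \<Lambda>\<^sub>1 * mass w \<ge> 0\<close> and
  \<open>(\<Lambda> - \<Lambda>\<^sub>1) * (mass \<phi> - mass w) \<ge> 0\<close>. So a small excess makes \<open>w\<close> close to \<open>\<phi>\<close>, and \<open>K\<close> is chosen such that the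
  infimum over functions supported in \<open>K\<close> has small excess. The bounds \<open>B\<close> and \<open>\<kappa>\<close> are uniform in \<open>\<epsilon>\<close>.
\<close>

lemma near_minimizers:
  assumes a: "integrable M a" and q: "q > 0" and pos: "(LINT x|M. a x * \<bar>\<phi> x\<bar> powr q) > 0"
    and \<Lambda>: "\<Lambda> > \<Lambda>\<^sub>1"
  obtains K B \<kappa> where "compact K" "K \<subseteq> \<Omega>" "\<kappa> > 0"
    "\<And>\<epsilon>. \<epsilon> > 0 \<Longrightarrow> \<exists>\<psi> g. admissible K \<psi> g \<and> energy g \<le> B \<and> mass \<psi> \<ge> \<kappa> \<and>
        (LINT x|M. a x * \<bar>\<psi> x\<bar> powr q) \<ge> 0 \<and>
        (\<forall>w h. admissible K w h \<longrightarrow> energy g - \<Lambda> * mass \<psi> \<le> energy h - \<Lambda> * mass w + \<epsilon>)"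
proof -
  obtain \<kappa>\<^sub>0 where \<kappa>\<^sub>0: "\<kappa>\<^sub>0 > 0"
    "\<And>w g. W0 \<Omega> p w g \<Longrightarrow> (AE x in M. 0 \<le> w x \<and> w x \<le> \<phi> x) \<Longrightarrow>
       energy g \<le> energy D\<phi> + \<kappa>\<^sub>0 \<Longrightarrow> mass w \<ge> mass \<phi> - \<kappa>\<^sub>0 \<Longrightarrow> (LINT x|M. a x * \<bar>w x\<bar> powr q) > 0"
    using near_minimal_weighted_positive[OF a q pos] by blast
  define \<kappa> where "\<kappa> = min \<kappa>\<^sub>0 (mass \<phi> / 2)"
  have \<kappa>: "\<kappa> > 0" "\<kappa> \<le> \<kappa>\<^sub>0" "\<kappa> \<le> mass \<phi> / 2" using \<kappa>\<^sub>0(1) \<phi>_pos by (auto simp: \<kappa>_def)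
  define \<delta> where "\<delta> = \<Lambda> - \<Lambda>\<^sub>1"
  have \<delta>: "\<delta> > 0" using \<Lambda> by (simp add: \<delta>_def)
  have \<Lambda>0: "\<Lambda> > 0" using \<Lambda> eigenvalue_nonneg by linarith
  define \<sigma> where "\<sigma> = min \<kappa> (\<delta> * \<kappa>)"
  have \<sigma>: "\<sigma> > 0" "\<sigma> \<le> \<kappa>" "\<sigma> \<le> \<delta> * \<kappa>" using \<kappa>(1) \<delta> by (auto simp: \<sigma>_def)
  define J where "J g w = energy g - \<Lambda> * mass w" for g w
  define c where "c = J D\<phi> \<phi>"
  have c: "c = - \<delta> * mass \<phi>" using attained by (simp add: c_def J_def \<delta>_def algebra_simps)
  have mass_le: "mass w \<le> mass \<phi>" if "admissible K w g" for K w g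
    using that below_\<phi>[of w] unfolding admissible_def
    by (intro mass_mono[of _ _ 1] \<phi>_measurable W0_measurable(1)[of w g]) auto
  have J_ge: "J g w = energy g - \<Lambda>\<^sub>1 * mass w + \<delta> * (mass \<phi> - mass w) + c" for g w
    by (simp add: J_def c \<delta>_def algebra_simps)
  have lower: "c \<le> J g w" if "admissible K w g" for K w g
  proof -
    have "\<Lambda>\<^sub>1 * mass w \<le> energy g" using that minimal by (simp add: admissible_def)
    moreover have "\<delta> * (mass \<phi> - mass w) \<ge> 0" using mass_le[OF that] \<delta> by simp
    ultimately show ?thesis unfolding J_ge by linarith
  qed
  have close: "energy g \<le> energy D\<phi> + \<kappa> \<and> mass w \<ge> mass \<phi> - \<kappa>" if adm: "admissible K w g" and le: "J g w \<le> c + \<sigma>" for K w g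
  proof -
    have 1: "\<Lambda>\<^sub>1 * mass w \<le> energy g" using adm minimal by (simp add: admissible_def)
    have 2: "\<delta> * (mass \<phi> - mass w) \<ge> 0" using mass_le[OF adm] \<delta> by simp
    have "\<Lambda>\<^sub>1 * mass w \<le> \<Lambda>\<^sub>1 * mass \<phi>" using mass_le[OF adm] eigenvalue_nonneg by (rule mult_left_mono)
    hence "energy g \<le> energy D\<phi> + \<kappa>" using le 2 \<sigma>(2) attained unfolding J_ge by linarith
    moreover have "\<delta> * (mass \<phi> - mass w) \<le> \<delta> * \<kappa>" using le 1 \<sigma>(3) unfolding J_ge by linarith
    hence "mass \<phi> - mass w \<le> \<kappa>" using \<delta> by simp
    ultimately show ?thesis by linarith
  qed
  \<comment> \<open>An energy and a mass within \<open>\<rho>\<close> of those of \<open>\<phi>\<close> leave half of \<open>\<sigma>\<close> for near-minimality.\<close>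
  define \<rho> where "\<rho> = \<sigma> / (2 * (1 + \<Lambda>))"
  have \<rho>: "\<rho> > 0" "(1 + \<Lambda>) * \<rho> = \<sigma> / 2" using \<sigma>(1) \<Lambda>0 by (auto simp: \<rho>_def field_simps)
  obtain K w0 g0 where K: "compact K" "K \<subseteq> \<Omega>" and w0: "admissible K w0 g0"
    "energy g0 \<le> energy D\<phi> + \<rho>" "mass w0 \<ge> mass \<phi> - \<rho>"
    using admissible_approximation[OF \<rho>(1)] by blast
  have "J g0 w0 \<le> c + (1 + \<Lambda>) * \<rho>"
    using w0(2) mult_left_mono[OF w0(3) less_imp_le[OF \<Lambda>0]] by (simp add: J_def c_def algebra_simps)
  hence J0: "J g0 w0 \<le> c + \<sigma> / 2" using \<rho>(2) by simp
  define S where "S = {J g w |g w. admissible K w g}"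
  have S: "J g0 w0 \<in> S" "bdd_below S"
    using w0(1) lower unfolding S_def by (auto intro!: bdd_belowI[of _ c])
  show ?thesis
  proof (rule that[OF K \<kappa>(1), of "energy D\<phi> + \<kappa>"])
    fix \<epsilon> :: real assume \<epsilon>: "\<epsilon> > 0"
    have "Inf S < Inf S + min \<epsilon> (\<sigma> / 2)" using \<epsilon> \<sigma>(1) by simp
    then obtain y where "y \<in> S" "y < Inf S + min \<epsilon> (\<sigma> / 2)"
      using cInf_lessD[of S] S(1) by blast
    then obtain \<psi> g where \<psi>: "admissible K \<psi> g" "J g \<psi> < Inf S + min \<epsilon> (\<sigma> / 2)"
      unfolding S_def by blast
    have "Inf S \<le> c + \<sigma> / 2" using cInf_lower[OF S] J0 by linarith
    hence "J g \<psi> \<le> c + \<sigma>" using \<psi>(2) by linarith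
    note cl = close[OF \<psi>(1) this]
    have "(LINT x|M. a x * \<bar>\<psi> x\<bar> powr q) \<ge> 0"
      using \<psi>(1) cl \<kappa>(2) by (intro less_imp_le[OF \<kappa>\<^sub>0(2)[of \<psi> g]]) (auto simp: admissible_def)
    moreover have "mass \<psi> \<ge> \<kappa>" using cl \<kappa>(3) by linarith
    moreover have "J g \<psi> \<le> J h w + \<epsilon>" if "admissible K w h" for w h
    proof -
      have "Inf S \<le> J h w" using that by (intro cInf_lower S(2)) (auto simp: S_def)
      thus ?thesis using \<psi>(2) by linarith
    qed
    ultimately show "\<exists>\<psi> g. admissible K \<psi> g \<and> energy g \<le> energy D\<phi> + \<kappa> \<and> mass \<psi> \<ge> \<kappa> \<and>
        (LINT x|M. a x * \<bar>\<psi> x\<bar> powr q) \<ge> 0 \<and>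
        (\<forall>w h. admissible K w h \<longrightarrow> energy g - \<Lambda> * mass \<psi> \<le> energy h - \<Lambda> * mass w + \<epsilon>)"
      using \<psi>(1) cl unfolding J_def by blast
  qed
qed

text \<open>
  Compare \<open>\<psi>\<close> with the admissible function \<open>\<psi> - t \<zeta>\<close>. By convexity, the difference of the energies is
  bounded below by the flux at the second function, and the difference of the masses is bounded
  above by the derivative at the first.
\<close>

lemma one_sided_euler_lagrange:
  assumes \<psi>: "admissible K \<psi> g"
    and min: "\<And>w h. admissible K w h \<Longrightarrow> energy g - \<Lambda> * mass \<psi> \<le> energy h - \<Lambda> * mass w + \<epsilon>"
    and \<zeta>: "W0 \<Omega> p \<zeta> k" "AE x in M. 0 \<le> \<zeta> x \<and> t * \<zeta> x \<le> \<psi> x"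
    and \<Lambda>: "\<Lambda> \<ge> 0" and t: "t > 0"
  shows "(LINT x|M. pflux p (g x - t *\<^sub>R k x) \<bullet> k x)
    \<le> \<Lambda> * (LINT x|M. m x * (\<psi> x powr (p - 1) * \<zeta> x)) + \<epsilon> / (p * t)"
    and "integrable M (\<lambda>x. pflux p (g x - t *\<^sub>R k x) \<bullet> k x)"
proof -
  have W\<psi>: "W0 \<Omega> p \<psi> g" and rng: "AE x in M. 0 \<le> \<psi> x \<and> \<psi> x \<le> \<phi> x" and off: "AE x in M. x \<notin> K \<longrightarrow> \<psi> x = 0"
    using \<psi> by (auto simp: admissible_def)
  define w h where "w x = \<psi> x - t * \<zeta> x" and "h x = g x - t *\<^sub>R k x" for x
  have W: "W0 \<Omega> p w h"
    using W0_linear[OF W\<psi> \<zeta>(1), of 1 "- t"] by (simp add: w_def[abs_def] h_def[abs_def])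
  have adm: "admissible K w h"
    unfolding admissible_def
  proof (intro conjI W)
    show "AE x in M. 0 \<le> w x \<and> w x \<le> \<phi> x"
      using rng \<zeta>(2)
    proof eventually_elim
      case (elim x)
      have "t * \<zeta> x \<ge> 0" using elim t by simp
      thus ?case using elim unfolding w_def by linarith
    qed
    show "AE x in M. x \<notin> K \<longrightarrow> w x = 0"
      using off \<zeta>(2)
    proof eventually_elim
      case (elim x)
      show ?case
      proof
        assume "x \<notin> K"
        hence "\<psi> x = 0" using elim by simp
        moreover have "t * \<zeta> x \<ge> 0" using elim t by simp
        ultimately show "w x = 0" using elim by (simp add: w_def)
      qed
    qed
  qed
  have [measurable]: "g \<in> borel_measurable M" "k \<in> borel_measurable M" "h \<in> borel_measurable M"
    "\<psi> \<in> borel_measurable M" "\<zeta> \<in> borel_measurable M" "w \<in> borel_measurable M"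
    using W0_measurable[OF W\<psi>] W0_measurable[OF \<zeta>(1)] W0_measurable[OF W] by auto
  have i: "integrable M (\<lambda>x. norm (g x) powr p)" "integrable M (\<lambda>x. norm (h x) powr p)" "integrable M (\<lambda>x. norm (k x) powr p)"
    using W0_Lp(2)[OF W\<psi>] W0_Lp(2)[OF W] W0_Lp(2)[OF \<zeta>(1)] by (auto dest: LpD)
  have ipf: "integrable M (\<lambda>x. pflux p (h x) \<bullet> k x)"
    by (rule pflux_inner_integrable[OF W0_Lp(2)[OF W] W0_Lp(2)[OF \<zeta>(1)]])
  thus "integrable M (\<lambda>x. pflux p (g x - t *\<^sub>R k x) \<bullet> k x)" by (simp add: h_def)
  have im: "integrable M (\<lambda>x. m x * \<bar>\<psi> x\<bar> powr p)" "integrable M (\<lambda>x. m x * \<bar>w x\<bar> powr p)"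
    using below_\<phi>(2)[OF rng] below_\<phi>(2)[of w] adm
    by (auto intro!: mass_integrable[where B = 1] simp: admissible_def)
  have im1: "integrable M (\<lambda>x. m x * (\<psi> x powr (p - 1) * \<zeta> x))"
  proof (rule integrable_mult_AE_bounded[OF m_integrable])
    show "AE x in M. \<bar>\<psi> x powr (p - 1) * \<zeta> x\<bar> \<le> 1 * (1 / t)"
      using rng \<phi>_range \<zeta>(2)
    proof eventually_elim
      case (elim x)
      have "\<psi> x powr (p - 1) \<le> 1 powr (p - 1)" using elim exponent_gt_1 by (intro powr_mono2) auto
      moreover have "\<zeta> x \<le> 1 / t" using elim t by (simp add: pos_le_divide_eq mult.commute)
      ultimately show ?case unfolding abs_mult using elim t by (intro mult_mono) auto
    qed
  qed measurable
  have "p * t * (LINT x|M. pflux p (h x) \<bullet> k x) = (LINT x|M. p * (pflux p (h x) \<bullet> (g x - h x)))"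
    by (simp add: h_def)
  also have "\<dots> \<le> (LINT x|M. norm (g x) powr p - norm (h x) powr p)"
  proof (rule integral_mono)
    show "integrable M (\<lambda>x. p * (pflux p (h x) \<bullet> (g x - h x)))" using ipf by (simp add: h_def)
  qed (use i norm_powr_ge_pflux_tangent[OF exponent_gt_1] in auto)
  also have "\<dots> = energy g - energy h" using i by simp
  also have "\<dots> \<le> \<Lambda> * (mass \<psi> - mass w) + \<epsilon>"
    using min[OF adm] by (simp add: algebra_simps)
  also have "mass \<psi> - mass w = (LINT x|M. m x * \<bar>\<psi> x\<bar> powr p - m x * \<bar>w x\<bar> powr p)"
    using im by simp
  also have "\<Lambda> * \<dots> \<le> \<Lambda> * (LINT x|M. p * t * (m x * (\<psi> x powr (p - 1) * \<zeta> x)))"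
  proof (intro mult_left_mono \<Lambda> integral_mono_AE)
    show "AE x in M. m x * \<bar>\<psi> x\<bar> powr p - m x * \<bar>w x\<bar> powr p \<le> p * t * (m x * (\<psi> x powr (p - 1) * \<zeta> x))"
      using rng \<zeta>(2) m_nonneg
    proof eventually_elim
      case (elim x)
      have "p * (\<psi> x powr (p - 1)) * \<bar>w x\<bar> \<le> (p - 1) * \<psi> x powr p + \<bar>w x\<bar> powr p"
        using elim by (intro scalar_young exponent_gt_1) auto
      moreover have "\<psi> x powr (p - 1) * \<psi> x = \<psi> x powr p"
        using elim by (cases "\<psi> x = 0") (auto simp: powr_diff)
      moreover have "w x \<ge> 0" using elim unfolding w_def by simp
      ultimately have "\<bar>\<psi> x\<bar> powr p - \<bar>w x\<bar> powr p \<le> p * t * (\<psi> x powr (p - 1) * \<zeta> x)"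
        using elim by (simp add: w_def algebra_simps)
      from mult_left_mono[OF this, of "m x"] show ?case using elim by (simp add: algebra_simps)
    qed
  qed (use im im1 in auto)
  finally have "p * t * (LINT x|M. pflux p (h x) \<bullet> k x)
      \<le> p * t * (\<Lambda> * (LINT x|M. m x * (\<psi> x powr (p - 1) * \<zeta> x))) + \<epsilon>"
    by (simp add: mult_ac)
  moreover have "a \<le> b + \<epsilon> / y" if "y * a \<le> y * b + \<epsilon>" "y > 0" for a b y :: real
    using that by (simp add: field_simps)
  moreover have "p * t > 0" using exponent_pos t by simp
  ultimately show "(LINT x|M. pflux p (g x - t *\<^sub>R k x) \<bullet> k x)
    \<le> \<Lambda> * (LINT x|M. m x * (\<psi> x powr (p - 1) * \<zeta> x)) + \<epsilon> / (p * t)"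
    unfolding h_def[symmetric] by blast
qed

end

section \<open>Powers as test functions\<close>

text \<open>
  A \<open>C\<^sup>1\<close> function that is the identity on \<open>[c, C]\<close> and takes its values in \<open>[c - d, C + d]\<close>.
\<close>

definition soft_clamp :: "real \<Rightarrow> real \<Rightarrow> real \<Rightarrow> real \<Rightarrow> real" where
  "soft_clamp d c C s = s - soft_pos d (s - C) + soft_pos d (c - s)"

lemma soft_clamp_range:
  assumes "d > 0" "c \<le> C"
  shows "c - d \<le> soft_clamp d c C s" "soft_clamp d c C s \<le> C + d" "c \<le> s \<Longrightarrow> s \<le> C \<Longrightarrow> soft_clamp d c C s = s"
proof -
  note b = soft_pos_bounds[OF assms(1), of "s - C"] soft_pos_bounds[OF assms(1), of "c - s"]
  consider "s \<le> c" | "c \<le> s" "s \<le> C" | "C \<le> s" using assms(2) by linarith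
  hence "c - d \<le> soft_clamp d c C s \<and> soft_clamp d c C s \<le> C + d"
    by cases (use b assms in \<open>auto simp: soft_clamp_def max_def split: if_splits\<close>)
  thus "c - d \<le> soft_clamp d c C s" "soft_clamp d c C s \<le> C + d" by auto
  show "c \<le> s \<Longrightarrow> s \<le> C \<Longrightarrow> soft_clamp d c C s = s"
    using b(4,8) by (simp add: soft_clamp_def)
qed

text \<open>
  Precomposing with \<open>soft_clamp\<close> confines the argument of the power to a compact set of positive
  numbers, where the power and its derivative are bounded.
\<close>

lemma powr_truncation:
  fixes \<alpha> c C :: real
  assumes "0 < c" "c \<le> C"
  obtains k k' B where "\<And>s. (k has_real_derivative k' s) (at s)" "continuous_on UNIV k'"
    "\<And>s. \<bar>k s\<bar> \<le> B" "\<And>s. \<bar>k' s\<bar> \<le> B"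
    "\<And>s. c \<le> s \<Longrightarrow> s \<le> C \<Longrightarrow> k s = s powr \<alpha>" "\<And>s. c \<le> s \<Longrightarrow> s \<le> C \<Longrightarrow> k' s = \<alpha> * s powr (\<alpha> - 1)"
proof -
  define d where "d = c / 2"
  have d: "d > 0" using assms by (simp add: d_def)
  define \<tau> where "\<tau> = soft_clamp d c C"
  define \<tau>' where "\<tau>' s = 1 - soft_pos' d (s - C) - soft_pos' d (c - s)" for s
  have \<tau>_pos: "\<tau> s > 0" for s
    using soft_clamp_range(1)[OF d assms(2), of s] assms(1) by (simp add: \<tau>_def d_def)
  have \<tau>_d: "(\<tau> has_real_derivative \<tau>' s) (at s)" for s
  proof -
    have 1: "((\<lambda>s. soft_pos d (s - C)) has_real_derivative soft_pos' d (s - C) * 1) (at s)"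
      by (rule DERIV_chain2[where g = "\<lambda>s. s - C", OF soft_pos_deriv[OF d]]) (auto intro!: derivative_eq_intros)
    have 2: "((\<lambda>s. soft_pos d (c - s)) has_real_derivative soft_pos' d (c - s) * (- 1)) (at s)"
      by (rule DERIV_chain2[where g = "\<lambda>s. c - s", OF soft_pos_deriv[OF d]]) (auto intro!: derivative_eq_intros)
    have "((\<lambda>s. s - soft_pos d (s - C) + soft_pos d (c - s)) has_real_derivative
        1 - soft_pos' d (s - C) * 1 + soft_pos' d (c - s) * (- 1)) (at s)"
      by (intro DERIV_add DERIV_diff DERIV_ident 1 2)
    thus ?thesis by (simp add: \<tau>_def \<tau>'_def soft_clamp_def[abs_def])
  qed
  have \<tau>_c: "continuous_on UNIV \<tau>"
    using \<tau>_d DERIV_isCont by (blast intro: continuous_at_imp_continuous_on)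
  have \<tau>'_c: "continuous_on UNIV \<tau>'"
    unfolding \<tau>'_def[abs_def]
    by (intro continuous_intros continuous_on_compose2[OF soft_pos'_continuous[OF d]]) auto
  have \<tau>'_b: "\<bar>\<tau>' s\<bar> \<le> 1" for s
    using soft_pos'_bounds[OF d, of "s - C"] soft_pos'_bounds[OF d, of "c - s"] by (simp add: \<tau>'_def)
  define I where "I = {c - d .. C + d}"
  have \<tau>_I: "\<tau> s \<in> I" for s
    using soft_clamp_range(1,2)[OF d assms(2), of s] by (simp add: I_def \<tau>_def)
  have I_pos: "y > 0" if "y \<in> I" for y using that assms(1) by (simp add: I_def d_def)
  have bdd: "\<exists>B. \<forall>y\<in>I. \<bar>y powr \<beta>\<bar> \<le> B" for \<beta>
  proof -
    have "continuous_on I (\<lambda>y. y powr \<beta>)" using I_pos by (intro continuous_intros) auto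
    hence "bounded ((\<lambda>y. y powr \<beta>) ` I)"
      unfolding I_def by (intro compact_imp_bounded compact_continuous_image) auto
    thus ?thesis by (auto simp: bounded_iff)
  qed
  obtain B1 where B1: "\<And>y. y \<in> I \<Longrightarrow> \<bar>y powr \<alpha>\<bar> \<le> B1" using bdd by blast
  obtain B2 where B2: "\<And>y. y \<in> I \<Longrightarrow> \<bar>y powr (\<alpha> - 1)\<bar> \<le> B2" using bdd by blast
  define k k' where "k s = \<tau> s powr \<alpha>" and "k' s = \<alpha> * \<tau> s powr (\<alpha> - 1) * \<tau>' s" for s
  show ?thesis
  proof (rule that[of k k' "max B1 (\<bar>\<alpha>\<bar> * B2)"])
    fix s
    show "(k has_real_derivative k' s) (at s)"
      unfolding k_def k'_def
      by (rule DERIV_chain2[where f = "\<lambda>y. y powr \<alpha>", OF has_real_derivative_powr[OF \<tau>_pos] \<tau>_d])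
    show "\<bar>k s\<bar> \<le> max B1 (\<bar>\<alpha>\<bar> * B2)" using B1[OF \<tau>_I[of s]] by (simp add: k_def)
    have "\<bar>k' s\<bar> = \<bar>\<alpha>\<bar> * \<bar>\<tau> s powr (\<alpha> - 1)\<bar> * \<bar>\<tau>' s\<bar>" by (simp add: k'_def abs_mult)
    also have "\<dots> \<le> \<bar>\<alpha>\<bar> * B2 * 1"
    proof -
      have "B2 \<ge> 0" using B2[OF \<tau>_I[of s]] by linarith
      thus ?thesis using B2[OF \<tau>_I[of s]] \<tau>'_b by (intro mult_mono mult_nonneg_nonneg) auto
    qed
    finally show "\<bar>k' s\<bar> \<le> max B1 (\<bar>\<alpha>\<bar> * B2)" by simp
    assume s: "c \<le> s" "s \<le> C"
    hence "\<tau> s = s" "\<tau>' s = 1"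
      using soft_clamp_range(3)[OF d assms(2)] by (auto simp: \<tau>_def \<tau>'_def soft_pos'_def max_def)
    thus "k s = s powr \<alpha>" "k' s = \<alpha> * s powr (\<alpha> - 1)" by (simp_all add: k_def k'_def)
  next
    show "continuous_on UNIV k'"
      unfolding k'_def[abs_def] using \<tau>_pos
      by (intro continuous_intros \<tau>_c \<tau>'_c) (auto simp: less_imp_neq[symmetric])
  qed
qed

context bounded_open
begin

lemma energy_linear_combination_le:
  fixes a b :: "'a \<Rightarrow> real" and g h :: "'a \<Rightarrow> 'a"
  assumes "Lp M p (\<lambda>x. a x *\<^sub>R g x + b x *\<^sub>R h x)" "Lp M p g" "Lp M p h"
    and "\<And>x. \<bar>a x\<bar> \<le> B" "\<And>x. \<bar>b x\<bar> \<le> B"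
  shows "(LINT x|M. norm (a x *\<^sub>R g x + b x *\<^sub>R h x) powr p)
    \<le> 2 powr p * B powr p * ((LINT x|M. norm (g x) powr p) + (LINT x|M. norm (h x) powr p))"
proof -
  have B: "B \<ge> 0" using assms(4)[of undefined] by linarith
  note i = LpD(2)[OF assms(1)] LpD(2)[OF assms(2)] LpD(2)[OF assms(3)]
  have "(LINT x|M. norm (a x *\<^sub>R g x + b x *\<^sub>R h x) powr p)
      \<le> (LINT x|M. 2 powr p * (B powr p * norm (g x) powr p + B powr p * norm (h x) powr p))"
  proof (rule integral_mono)
    fix x
    have "norm (c *\<^sub>R y) powr p \<le> B powr p * norm y powr p" if "\<bar>c\<bar> \<le> B" for c and y :: 'a
    proof -
      have "\<bar>c\<bar> powr p \<le> B powr p" using that exponent_pos by (intro powr_mono2) auto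
      thus ?thesis by (simp add: powr_mult mult_right_mono)
    qed
    hence "2 powr p * (norm (a x *\<^sub>R g x) powr p + norm (b x *\<^sub>R h x) powr p)
        \<le> 2 powr p * (B powr p * norm (g x) powr p + B powr p * norm (h x) powr p)"
      using assms(4,5) by (intro mult_left_mono add_mono) auto
    thus "norm (a x *\<^sub>R g x + b x *\<^sub>R h x) powr p
       \<le> 2 powr p * (B powr p * norm (g x) powr p + B powr p * norm (h x) powr p)"
      using norm_powr_add_le[OF exponent_pos(2), of "a x *\<^sub>R g x" "b x *\<^sub>R h x"] by linarith
  qed (use i in auto)
  also have "\<dots> = 2 powr p * B powr p * ((LINT x|M. norm (g x) powr p) + (LINT x|M. norm (h x) powr p))"
    using i by (simp add: algebra_simps)
  finally show ?thesis .
qed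

text \<open>
  The test functions: \<open>\<psi>\<close> is shifted away from \<open>0\<close>, where a power may fail to be Lipschitz, and the constant is subtracted to
  keep the zeros of \<open>\<psi>\<close>.
\<close>

definition shifted_product :: "real \<Rightarrow> real \<Rightarrow> real \<Rightarrow> ('a \<Rightarrow> real) \<Rightarrow> ('a \<Rightarrow> real) \<Rightarrow> 'a \<Rightarrow> real" where
  "shifted_product e \<alpha> \<beta> \<psi> v x = ((\<psi> x + e) powr \<alpha> - e powr \<alpha>) * v x powr \<beta>"

definition shifted_product_grad :: "real \<Rightarrow> real \<Rightarrow> real \<Rightarrow> ('a \<Rightarrow> real) \<Rightarrow> ('a \<Rightarrow> 'a) \<Rightarrow>
    ('a \<Rightarrow> real) \<Rightarrow> ('a \<Rightarrow> 'a) \<Rightarrow> 'a \<Rightarrow> 'a" where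
  "shifted_product_grad e \<alpha> \<beta> \<psi> g v h x = (\<alpha> * (\<psi> x + e) powr (\<alpha> - 1) * v x powr \<beta>) *\<^sub>R g x
     + (((\<psi> x + e) powr \<alpha> - e powr \<alpha>) * (\<beta> * v x powr (\<beta> - 1))) *\<^sub>R h x"

text \<open>
  Only values of \<open>\<psi>\<close> in \<open>[0, 1]\<close> and values of \<open>v\<close> in \<open>[c, C]\<close> matter, since everything vanishes outside \<open>K\<close>. So
  both powers may be truncated and the chain rule applies. The bound \<open>B\<close> does not depend on \<open>\<psi>\<close>,
  which allows \<open>\<psi>\<close> to be chosen after the size of its test function is known.
\<close>

lemma W0_powr_product:
  fixes \<alpha> \<beta> e c C :: real
  assumes "0 < e" "0 < c" "c \<le> C"
  obtains B where "B \<ge> 0"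
    "\<And>K \<psi> g v h. W0 \<Omega> p \<psi> g \<Longrightarrow> (AE x in M. 0 \<le> \<psi> x \<and> \<psi> x \<le> 1) \<Longrightarrow>
      (AE x in M. x \<notin> K \<longrightarrow> \<psi> x = 0) \<Longrightarrow> W0 \<Omega> p v h \<Longrightarrow> (\<And>x. x \<in> K \<Longrightarrow> c \<le> v x \<and> v x \<le> C) \<Longrightarrow>
      \<exists>k. W0 \<Omega> p (shifted_product e \<alpha> \<beta> \<psi> v) k \<and>
        (AE x in M. k x = shifted_product_grad e \<alpha> \<beta> \<psi> g v h x) \<and>
        (LINT x|M. norm (k x) powr p)
          \<le> B * ((LINT x|M. norm (g x) powr p) + (LINT x|M. norm (h x) powr p))"
proof -
  have ee: "e \<le> 1 + e" by simp
  obtain A A' BA where A: "\<And>s. (A has_real_derivative A' s) (at s)" "continuous_on UNIV A'"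
    "\<And>s. \<bar>A s\<bar> \<le> BA" "\<And>s. \<bar>A' s\<bar> \<le> BA"
    "\<And>s. e \<le> s \<Longrightarrow> s \<le> 1 + e \<Longrightarrow> A s = s powr \<alpha>" "\<And>s. e \<le> s \<Longrightarrow> s \<le> 1 + e \<Longrightarrow> A' s = \<alpha> * s powr (\<alpha> - 1)"
    using powr_truncation[OF assms(1) ee] by blast
  obtain b b' Bb where b: "\<And>s. (b has_real_derivative b' s) (at s)" "continuous_on UNIV b'"
    "\<And>s. \<bar>b s\<bar> \<le> Bb" "\<And>s. \<bar>b' s\<bar> \<le> Bb"
    "\<And>s. c \<le> s \<Longrightarrow> s \<le> C \<Longrightarrow> b s = s powr \<beta>" "\<And>s. c \<le> s \<Longrightarrow> s \<le> C \<Longrightarrow> b' s = \<beta> * s powr (\<beta> - 1)"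
    using powr_truncation[OF assms(2,3)] by blast
  have nn: "BA \<ge> 0" "Bb \<ge> 0" using A(3)[of 0] b(3)[of 0] by linarith+
  define F D1 D2 where "F z = (A (fst z + e) - e powr \<alpha>) * b (snd z)"
    and "D1 z = A' (fst z + e) * b (snd z)" and "D2 z = (A (fst z + e) - e powr \<alpha>) * b' (snd z)" for z :: "real \<times> real"
  define B where "B = (BA + e powr \<alpha>) * Bb"
  have Ab: "\<bar>A s - e powr \<alpha>\<bar> \<le> BA + e powr \<alpha>" for s using A(3)[of s] powr_ge_zero[of e \<alpha>] by linarith
  have F: "C1_Lipschitz F D1 D2 B"
  proof
    fix z :: "real \<times> real"
    have "((\<lambda>z. fst z + e) has_derivative fst) (at z)" by (auto intro!: derivative_eq_intros)
    moreover have "(A has_derivative (\<lambda>t. A' (fst z + e) * t)) (at (fst z + e))"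
      using A(1) by (simp add: has_field_derivative_def)
    ultimately have dA: "((\<lambda>z. A (fst z + e)) has_derivative (\<lambda>h. A' (fst z + e) * fst h)) (at z)"
      by (rule has_derivative_compose)
    have dA': "((\<lambda>z. A (fst z + e) - e powr \<alpha>) has_derivative (\<lambda>h. A' (fst z + e) * fst h)) (at z)"
      using has_derivative_diff[OF dA has_derivative_const[of "e powr \<alpha>"]] by simp
    have "(snd has_derivative snd) (at z)" by (intro derivative_intros)
    moreover have "(b has_derivative (\<lambda>t. b' (snd z) * t)) (at (snd z))"
      using b(1) by (simp add: has_field_derivative_def)
    ultimately have db: "((\<lambda>z. b (snd z)) has_derivative (\<lambda>h. b' (snd z) * snd h)) (at z)"
      by (rule has_derivative_compose)
    have eq: "(\<lambda>h. D1 z * fst h + D2 z * snd h)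
       = (\<lambda>h. (A (fst z + e) - e powr \<alpha>) * (b' (snd z) * snd h) + A' (fst z + e) * fst h * b (snd z))"
      by (rule ext) (simp add: D1_def D2_def)
    show "(F has_derivative (\<lambda>h. D1 z * fst h + D2 z * snd h)) (at z)"
      unfolding eq F_def[abs_def] by (rule has_derivative_mult[OF dA' db])
    have "\<bar>D1 z\<bar> \<le> BA * Bb"
      unfolding D1_def abs_mult using A(4) b(3) nn by (intro mult_mono) auto
    also have "\<dots> \<le> B" unfolding B_def using nn by (intro mult_right_mono) auto
    finally show "\<bar>D1 z\<bar> \<le> B" .
    show "\<bar>D2 z\<bar> \<le> B"
      unfolding D2_def abs_mult B_def using Ab b(4) nn by (intro mult_mono) (auto intro: order_trans[OF abs_ge_zero])
  next
    have cA: "continuous_on UNIV A" using A(1) DERIV_isCont by (blast intro: continuous_at_imp_continuous_on)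
    have cb: "continuous_on UNIV b" using b(1) DERIV_isCont by (blast intro: continuous_at_imp_continuous_on)
    have comp: "continuous_on UNIV (\<lambda>z::real \<times> real. f (fst z + e))" "continuous_on UNIV (\<lambda>z::real \<times> real. f (snd z))"
      if "continuous_on UNIV f" for f :: "real \<Rightarrow> real" and e
      by (intro continuous_on_compose2[OF that] continuous_intros; simp)+
    show "continuous_on UNIV D1" "continuous_on UNIV D2"
      unfolding D1_def[abs_def] D2_def[abs_def]
      by (intro continuous_on_mult continuous_on_diff continuous_on_const
          comp(1)[OF A(2)] comp(1)[OF cA] comp(2)[OF b(2)] comp(2)[OF cb])+
  next
    show "F (0, 0) = 0" using A(5)[of e] by (simp add: F_def)
  qed
  show ?thesis
  proof (rule that[of "2 powr p * B powr p"])
    fix K \<psi> g v h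
    assume \<psi>: "W0 \<Omega> p \<psi> g" and rng: "AE x in M. 0 \<le> \<psi> x \<and> \<psi> x \<le> 1"
      and off: "AE x in M. x \<notin> K \<longrightarrow> \<psi> x = 0" and v: "W0 \<Omega> p v h" and vK: "\<And>x. x \<in> K \<Longrightarrow> c \<le> v x \<and> v x \<le> C"
    define k where "k x = D1 (\<psi> x, v x) *\<^sub>R g x + D2 (\<psi> x, v x) *\<^sub>R h x" for x
    have W: "W0 \<Omega> p (\<lambda>x. F (\<psi> x, v x)) k"
      unfolding k_def by (rule W0_chain[OF F \<psi> v])
    have z: "AE x in M. \<psi> x = 0 \<longrightarrow> g x = 0"
      by (rule W0_gradient_on_zero_set[OF \<psi>]) (use rng in \<open>auto elim!: eventually_mono\<close>)
    have Aeq: "A (s + e) = (s + e) powr \<alpha>" "A' (s + e) = \<alpha> * (s + e) powr (\<alpha> - 1)" if "0 \<le> s" "s \<le> 1" for s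
      using A(5)[of "s + e"] A(6)[of "s + e"] that by auto
    have 1: "AE x in M. F (\<psi> x, v x) = shifted_product e \<alpha> \<beta> \<psi> v x"
      using rng off
    proof eventually_elim
      case (elim x)
      show ?case
      proof (cases "x \<in> K")
        case True
        thus ?thesis using Aeq elim b(5) vK[OF True] by (simp add: F_def shifted_product_def)
      next
        case False
        thus ?thesis using Aeq(1)[of 0] elim by (simp add: F_def shifted_product_def)
      qed
    qed
    have 2: "AE x in M. k x = shifted_product_grad e \<alpha> \<beta> \<psi> g v h x"
      using rng off z
    proof eventually_elim
      case (elim x)
      show ?case
      proof (cases "x \<in> K")
        case True
        thus ?thesis using Aeq elim b(5,6) vK[OF True] by (simp add: k_def D1_def D2_def shifted_product_grad_def)
      next
        case False
        thus ?thesis using Aeq(1)[of 0] elim by (simp add: k_def D2_def shifted_product_grad_def)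
      qed
    qed
    have "W0 \<Omega> p (shifted_product e \<alpha> \<beta> \<psi> v) k"
      by (rule W0_cong_AE[OF W 1]) simp
    moreover have "(LINT x|M. norm (k x) powr p)
        \<le> 2 powr p * B powr p * ((LINT x|M. norm (g x) powr p) + (LINT x|M. norm (h x) powr p))"
      unfolding k_def
      by (rule energy_linear_combination_le[OF W0_Lp(2)[OF W, unfolded k_def[abs_def]] W0_Lp(2)[OF \<psi>] W0_Lp(2)[OF v]])
        (rule C1_Lipschitz.bounds[OF F])+
    ultimately show "\<exists>k. W0 \<Omega> p (shifted_product e \<alpha> \<beta> \<psi> v) k \<and>
        (AE x in M. k x = shifted_product_grad e \<alpha> \<beta> \<psi> g v h x) \<and>
        (LINT x|M. norm (k x) powr p)
          \<le> 2 powr p * B powr p * ((LINT x|M. norm (g x) powr p) + (LINT x|M. norm (h x) powr p))"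
      using 2 by blast
  qed simp
qed

end

text \<open>
  Concavity, in the form of Young's inequality for the inverse exponent. It makes a small multiple of
  the test function lie below \<open>\<psi>\<close>.
\<close>

lemma shifted_powr_sublinear:
  fixes \<theta> e s :: real
  assumes "0 < \<theta>" "\<theta> < 1" "0 < e" "0 \<le> s"
  shows "(s + e) powr \<theta> - e powr \<theta> \<le> \<theta> * e powr (\<theta> - 1) * s"
proof -
  define P where "P = 1 / \<theta>"
  have P: "P > 1" "\<theta> * P = 1" using assms by (auto simp: P_def)
  define E A where "E = e powr \<theta>" and "A = (s + e) powr \<theta>"
  have pw: "E powr P = e" "A powr P = s + e" "E powr (P - 1) = e powr (1 - \<theta>)"
    using assms P by (simp_all add: E_def A_def powr_powr right_diff_distrib)
  have "E powr (P - 1) * E = e" using assms by (simp add: pw(3)) (simp add: E_def flip: powr_add)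
  moreover have "P * E powr (P - 1) * A \<le> (P - 1) * E powr P + A powr P"
    by (rule scalar_young[OF P(1)]) (auto simp: A_def E_def)
  ultimately have "P * E powr (P - 1) * (A - E) \<le> s" unfolding pw by (simp add: algebra_simps)
  hence le: "(\<theta> * e powr (\<theta> - 1)) * (P * E powr (P - 1) * (A - E)) \<le> (\<theta> * e powr (\<theta> - 1)) * s"
    using assms by (intro mult_left_mono) auto
  have "(\<theta> * e powr (\<theta> - 1)) * (P * E powr (P - 1) * (A - E)) = (\<theta> * P) * (e powr (\<theta> - 1) * e powr (1 - \<theta>)) * (A - E)"
    by (simp add: pw(3))
  also have "e powr (\<theta> - 1) * e powr (1 - \<theta>) = 1" using assms by (simp flip: powr_add)
  finally show ?thesis using le by (simp only: P(2) mult_1_left A_def E_def)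
qed

lemma shifted_powr_close:
  fixes q e s :: real
  assumes "1 < q" "0 < e" "e \<le> 1" "0 \<le> s" "s \<le> 1"
  shows "\<bar>(s + e) powr q - e powr q - s powr q\<bar> \<le> (q * 2 powr (q - 1) + 1) * e"
proof -
  define c where "c = s + e"
  have c: "c > 0" "c \<le> 2" using assms by (auto simp: c_def)
  have "q * c powr (q - 1) * s = q * (c powr (q - 1) * c) - q * c powr (q - 1) * e"
    by (simp add: c_def algebra_simps)
  also have "c powr (q - 1) * c = c powr q" using c by (simp add: powr_diff)
  finally have "q * c powr (q - 1) * s = q * c powr q - q * c powr (q - 1) * e" .
  moreover have "q * c powr (q - 1) * s \<le> (q - 1) * c powr q + s powr q"
    using scalar_young[OF assms(1,4), of c] c by simp
  ultimately have "c powr q - s powr q \<le> q * c powr (q - 1) * e"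
    by (simp add: left_diff_distrib)
  also have "\<dots> \<le> q * 2 powr (q - 1) * e"
    using c assms by (intro mult_right_mono mult_left_mono powr_mono2) auto
  finally have "c powr q - s powr q \<le> q * 2 powr (q - 1) * e" .
  moreover have "s powr q \<le> c powr q" using assms by (intro powr_mono2) (auto simp: c_def)
  moreover have "e powr q \<le> e" using powr_mono'[of 1 q e] assms by simp
  moreover have "q * 2 powr (q - 1) * e \<ge> 0" using assms by simp
  moreover have "e powr q \<ge> 0" by simp
  ultimately show ?thesis
    using assms(2) unfolding c_def[symmetric] abs_le_iff distrib_right by (intro conjI; linarith)
qed

section \<open>Nonexistence\<close>

locale nonexistence =
  first_eigen \<Omega> p m \<phi> D\<phi> \<Lambda>\<^sub>1 + picone_exponents p q
  for \<Omega> :: "'a::euclidean_space set" and p m \<phi> D\<phi> \<Lambda>\<^sub>1 q +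
  fixes a :: "'a \<Rightarrow> real"
  assumes a_integrable: "integrable M a" and a_\<phi>_pos: "(LINT x|M. a x * \<bar>\<phi> x\<bar> powr q) > 0"
begin

text \<open>
  The differential inequality \<open>- \<Delta>\<^sub>p v \<ge> \<Lambda> m v\<^sup>p\<^sup>-\<^sup>1 + \<eta> a v\<^sup>q\<^sup>-\<^sup>1\<close> with \<open>h\<close> as the gradient of \<open>v\<close>, tested only
  with nonnegative functions that vanish outside \<open>K\<close>.
\<close>

definition weak_supersolution_on :: "'a set \<Rightarrow> real \<Rightarrow> real \<Rightarrow> ('a \<Rightarrow> real) \<Rightarrow> ('a \<Rightarrow> 'a) \<Rightarrow> bool" where
  "weak_supersolution_on K \<Lambda> \<eta> v h \<longleftrightarrow> (\<forall>\<xi> k. W0 \<Omega> p \<xi> k \<longrightarrow> (AE x in M. x \<notin> K \<longrightarrow> \<xi> x = 0) \<longrightarrow>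
     (AE x in M. 0 \<le> \<xi> x) \<longrightarrow>
     (LINT x|M. pflux p (h x) \<bullet> k x) \<ge> \<Lambda> * (LINT x|M. m x * (v x powr (p - 1) * \<xi> x))
       + \<eta> * (LINT x|M. a x * (v x powr (q - 1) * \<xi> x)))"

text \<open>
  The integrated Picone inequality. The comparison function \<open>J\<close> stands for the flux of \<open>\<psi>\<close> against the
  gradient of \<open>\<zeta>\<close>, up to the perturbation that the Euler-Lagrange inequality requires.
\<close>

lemma picone_energy_estimate:
  assumes \<psi>: "W0 \<Omega> p \<psi> g" and rng: "AE x in M. 0 \<le> \<psi> x \<and> \<psi> x \<le> 1"
    and off: "AE x in M. x \<notin> K \<longrightarrow> \<psi> x = 0" and v: "W0 \<Omega> p v h"
    and vK: "\<And>x. x \<in> K \<Longrightarrow> c \<le> v x" and c: "0 < c" and e: "0 < e"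
    and k\<xi>: "W0 \<Omega> p \<xi> k\<xi>" "AE x in M. k\<xi> x = shifted_product_grad e q (1 - q) \<psi> g v h x"
    and k\<zeta>: "W0 \<Omega> p \<zeta> k\<zeta>" "AE x in M. k\<zeta> x = shifted_product_grad e (q - p + 1) (p - q) \<psi> g v h x"
    and J: "integrable M J" "\<And>x. pflux p (g x) \<bullet> k\<zeta> x \<le> J x"
  shows "(LINT x|M. pflux p (h x) \<bullet> k\<xi> x) \<le> (LINT x|M. J x)
    + (q - 1) * c powr (- q) * e powr q * energy h
    + (p - q) * c powr (p - q - 1) * e powr (q - p + 1) * (energy g + energy h)"
proof -
  define A where "A = (q - 1) * c powr (- q) * e powr q"
  define A' where "A' = (p - q) * c powr (p - q - 1) * e powr (q - p + 1)"
  have A: "A \<ge> 0" "A' \<ge> 0" using q_gt_1 q_less_p by (auto simp: A_def A'_def)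
  have i: "integrable M (\<lambda>x. norm (g x) powr p)" "integrable M (\<lambda>x. norm (h x) powr p)"
    by (rule LpD(2)[OF W0_Lp(2)[OF \<psi>]] LpD(2)[OF W0_Lp(2)[OF v]])+
  have z: "AE x in M. \<psi> x = 0 \<longrightarrow> g x = 0"
    by (rule W0_gradient_on_zero_set[OF \<psi>]) (use rng in \<open>auto elim!: eventually_mono\<close>)
  have "(LINT x|M. pflux p (h x) \<bullet> k\<xi> x)
      \<le> (LINT x|M. J x + (A * norm (h x) powr p + A' * (norm (g x) powr p + norm (h x) powr p)))"
  proof (rule integral_mono_AE)
    show "integrable M (\<lambda>x. pflux p (h x) \<bullet> k\<xi> x)"
      by (rule pflux_inner_integrable[OF W0_Lp(2)[OF v] W0_Lp(2)[OF k\<xi>(1)]])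
    show "integrable M (\<lambda>x. J x + (A * norm (h x) powr p + A' * (norm (g x) powr p + norm (h x) powr p)))"
      using i J(1) by simp
    show "AE x in M. pflux p (h x) \<bullet> k\<xi> x
        \<le> J x + (A * norm (h x) powr p + A' * (norm (g x) powr p + norm (h x) powr p))"
      using rng off z k\<xi>(2) k\<zeta>(2)
    proof eventually_elim
      case (elim x)
      have err: "A * norm (h x) powr p + A' * (norm (g x) powr p + norm (h x) powr p) \<ge> 0"
        using A by simp
      show ?case
      proof (cases "x \<in> K")
        case True
        have vx: "0 < v x" "c \<le> v x" using vK[OF True] c by auto
        have "pflux p (h x) \<bullet> k\<xi> x \<le> pflux p (g x) \<bullet> k\<zeta> x
            + (q - 1) * e powr q * v x powr (- q) * norm (h x) powr p
            + (p - q) * e powr (q - p + 1) * v x powr (p - q - 1) * (norm (g x) powr (p - 1) * norm (h x))"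
          using picone_regularized[OF e _ vx(1), of "\<psi> x + e" "h x" "g x"] elim
            by (simp add: shifted_product_grad_def)
        moreover have "(q - 1) * e powr q * v x powr (- q) * norm (h x) powr p \<le> A * norm (h x) powr p"
        proof -
          have "v x powr (- q) \<le> c powr (- q)" using vx c q_gt_1 by (intro powr_mono2') auto
          hence "((q - 1) * e powr q * norm (h x) powr p) * v x powr (- q) \<le> ((q - 1) * e powr q * norm (h x) powr p) * c powr (- q)"
            using q_gt_1 by (intro mult_left_mono) auto
          thus ?thesis by (simp add: A_def mult_ac)
        qed
        moreover have "(p - q) * e powr (q - p + 1) * v x powr (p - q - 1) * (norm (g x) powr (p - 1) * norm (h x))
            \<le> A' * (norm (g x) powr p + norm (h x) powr p)"
        proof -
          have "v x powr (p - q - 1) \<le> c powr (p - q - 1)" using vx c theta_pos by (intro powr_mono2') auto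
          hence "(p - q) * e powr (q - p + 1) * v x powr (p - q - 1) \<le> (p - q) * e powr (q - p + 1) * c powr (p - q - 1)"
            using q_less_p by (intro mult_left_mono) auto
          also have "\<dots> = A'" by (simp add: A'_def mult_ac)
          finally show ?thesis
            using powr_pm1_mult_le[OF exponent_gt_1, of "norm (g x)" "norm (h x)"] A(2)
            by (intro mult_mono) auto
        qed
        ultimately show ?thesis using J(2)[of x] by linarith
      next
        case False
        hence "\<psi> x = 0" "g x = 0" using elim by auto
        hence "k\<xi> x = 0" "k\<zeta> x = 0" using elim by (auto simp: shifted_product_grad_def)
        hence "0 \<le> J x" "pflux p (h x) \<bullet> k\<xi> x = 0" using J(2)[of x] by auto
        thus ?thesis using err by linarith
      qed
    qed
  qed
  also have "\<dots> = (LINT x|M. J x) + A * energy h + A' * (energy g + energy h)"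
    using i J(1) by (simp add: algebra_simps)
  finally show ?thesis by (simp add: A_def A'_def)
qed

text \<open>
  The parameters are chosen in the order \<open>K\<close>, \<open>e\<close>, \<open>t\<close>, \<open>\<epsilon>\<close>, \<open>\<psi>\<close>. The set \<open>K\<close> depends only on the
  eigenvalue problem, \<open>a\<close> and \<open>\<Lambda>\<close>; given \<open>v\<close>, the shift \<open>e\<close> makes the errors of the Picone inequality small;
  then \<open>t\<close> and finally the near-minimality \<open>\<epsilon>\<close> of \<open>\<psi>\<close> make the error in the Euler-Lagrange inequality
  small. The bounds on \<open>\<psi>\<close> used for this hold for all near-minimizers.
\<close>

lemma no_positive_supersolution:
  assumes "\<Lambda>\<^sub>1 < \<Lambda>"
  obtains K where "compact K" "K \<subseteq> \<Omega>"
    "\<And>\<eta> v h. 0 \<le> \<eta> \<Longrightarrow> W0 \<Omega> p v h \<Longrightarrow> continuous_on \<Omega> v \<Longrightarrow> (\<And>x. x \<in> \<Omega> \<Longrightarrow> 0 < v x) \<Longrightarrow>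
       \<not> weak_supersolution_on K \<Lambda> \<eta> v h"
proof -
  define \<Lambda>' where "\<Lambda>' = (\<Lambda>\<^sub>1 + \<Lambda>) / 2"
  have \<Lambda>': "\<Lambda>\<^sub>1 < \<Lambda>'" "\<Lambda>' < \<Lambda>" "0 \<le> \<Lambda>'" using assms eigenvalue_nonneg by (auto simp: \<Lambda>'_def)
  have q0: "q > 0" using q_gt_1 by simp
  obtain K B \<kappa> where K: "compact K" "K \<subseteq> \<Omega>" and \<kappa>: "\<kappa> > 0" and
    near: "\<And>\<epsilon>. \<epsilon> > 0 \<Longrightarrow> \<exists>\<psi> g. admissible K \<psi> g \<and> energy g \<le> B \<and> mass \<psi> \<ge> \<kappa> \<and>
        (LINT x|M. a x * \<bar>\<psi> x\<bar> powr q) \<ge> 0 \<and>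
        (\<forall>w h. admissible K w h \<longrightarrow> energy g - \<Lambda>' * mass \<psi> \<le> energy h - \<Lambda>' * mass w + \<epsilon>)"
    by (rule near_minimizers[OF a_integrable q0 a_\<phi>_pos \<Lambda>'(1)]) blast
  show ?thesis
  proof (rule that[OF K])
    fix \<eta> :: real and v h
    assume \<eta>: "0 \<le> \<eta>" and v: "W0 \<Omega> p v h" and vc: "continuous_on \<Omega> v" and vpos: "\<And>x. x \<in> \<Omega> \<Longrightarrow> 0 < v x"
    show "\<not> weak_supersolution_on K \<Lambda> \<eta> v h"
    proof
      assume super: "weak_supersolution_on K \<Lambda> \<eta> v h"
      obtain c C where c: "0 < c" "c \<le> C" and vK: "\<And>x. x \<in> K \<Longrightarrow> c \<le> v x \<and> v x \<le> C"
      proof (cases "K = {}")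
        case True
        thus ?thesis using that[of 1 1] by simp
      next
        case False
        have vcK: "continuous_on K v" using vc K(2) by (rule continuous_on_subset)
        obtain y where y: "y \<in> K" "\<And>x. x \<in> K \<Longrightarrow> v y \<le> v x"
          using continuous_attains_inf[OF K(1) False vcK] by blast
        obtain z where z: "z \<in> K" "\<And>x. x \<in> K \<Longrightarrow> v x \<le> v z"
          using continuous_attains_sup[OF K(1) False vcK] by blast
        show ?thesis using that[of "v y" "v z"] y z vpos K(2) by blast
      qed
      define \<theta> where "\<theta> = q - p + 1"
      have \<theta>: "0 < \<theta>" "\<theta> < 1" using theta_pos q_less_p by (auto simp: \<theta>_def)
      define cp Cp where "cp = c powr (p - q)" and "Cp = C powr (p - q)"
      have cp: "cp > 0" "Cp > 0" "cp \<le> Cp"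
        using c q_less_p by (auto simp: cp_def Cp_def intro!: powr_mono2)
      define Im Ia where "Im = (LINT x|M. m x)" and "Ia = (LINT x|M. \<bar>a x\<bar>)"
      define Dq where "Dq = q * 2 powr (q - 1) + 1"
      define H where "H = energy h"
      have H0: "H \<ge> 0" unfolding H_def by (rule energy_nonneg)
      define B' where "B' = max B 0"
      define \<kappa>' where "\<kappa>' = (\<Lambda> - \<Lambda>') * cp * \<kappa>"
      have \<kappa>': "\<kappa>' > 0" using \<Lambda>' cp \<kappa> by (simp add: \<kappa>'_def)
      \<comment> \<open>The errors caused by the shift \<open>e\<close>: two from the lower bounds for the terms of the
        equation, one from the right-hand side of the Euler-Lagrange inequality, and two from the
        Picone inequality.\<close>
      define err where "err e = (\<Lambda> - \<Lambda>') * (cp * (e powr q * Im)) + \<eta> * (Dq * e * Ia) + \<Lambda>' * (e powr q * (Cp * Im))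
          + (q - 1) * c powr (- q) * e powr q * H + (p - q) * c powr (p - q - 1) * e powr \<theta> * (B' + H)" for e
      have "(err \<longlongrightarrow> (\<Lambda> - \<Lambda>') * (cp * (0 * Im)) + \<eta> * (Dq * 0 * Ia) + \<Lambda>' * (0 * (Cp * Im))
          + (q - 1) * c powr (- q) * 0 * H + (p - q) * c powr (p - q - 1) * 0 * (B' + H)) (at_right 0)"
      proof -
        have t: "((\<lambda>e::real. e powr \<alpha>) \<longlongrightarrow> 0) (at_right 0)" if "\<alpha> > 0" for \<alpha>
        proof -
          have "((\<lambda>e::real. e powr \<alpha>) \<longlongrightarrow> 0 powr \<alpha>) (at_right 0)"
            using that by (intro tendsto_powr' tendsto_const tendsto_ident_at)
              (auto simp: eventually_at_filter)
          thus ?thesis by simp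
        qed
        show ?thesis unfolding err_def by (intro tendsto_intros t q0 \<theta>(1))
      qed
      hence "(err \<longlongrightarrow> 0) (at_right 0)" by simp
      hence "\<forall>\<^sub>F e in at_right 0. err e < \<kappa>' / 3"
        by (rule order_tendstoD(2)) (use \<kappa>' in simp)
      moreover have "\<forall>\<^sub>F e in at_right (0::real). 0 < e \<and> e < 1"
        using eventually_at_right_real[of 0 1] by (auto elim!: eventually_mono)
      ultimately obtain e where e: "err e < \<kappa>' / 3" "0 < e" "e < 1"
        using eventually_happens'[OF trivial_limit_at_right_real, OF eventually_conj] by blast
      obtain B\<zeta> where B\<zeta>: "B\<zeta> \<ge> 0" and prod\<zeta>: "\<And>K \<psi> g v h. W0 \<Omega> p \<psi> g \<Longrightarrow> (AE x in M. 0 \<le> \<psi> x \<and> \<psi> x \<le> 1) \<Longrightarrow>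
        (AE x in M. x \<notin> K \<longrightarrow> \<psi> x = 0) \<Longrightarrow> W0 \<Omega> p v h \<Longrightarrow> (\<And>x. x \<in> K \<Longrightarrow> c \<le> v x \<and> v x \<le> C) \<Longrightarrow>
        \<exists>k. W0 \<Omega> p (shifted_product e \<theta> (p - q) \<psi> v) k \<and>
          (AE x in M. k x = shifted_product_grad e \<theta> (p - q) \<psi> g v h x) \<and>
          energy k \<le> B\<zeta> * (energy g + energy h)"
        by (rule W0_powr_product[where \<alpha> = \<theta> and \<beta> = "p - q", OF e(2) c]) blast
      obtain B\<xi> where prod\<xi>: "\<And>K \<psi> g v h. W0 \<Omega> p \<psi> g \<Longrightarrow> (AE x in M. 0 \<le> \<psi> x \<and> \<psi> x \<le> 1) \<Longrightarrow>
        (AE x in M. x \<notin> K \<longrightarrow> \<psi> x = 0) \<Longrightarrow> W0 \<Omega> p v h \<Longrightarrow> (\<And>x. x \<in> K \<Longrightarrow> c \<le> v x \<and> v x \<le> C) \<Longrightarrow>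
        \<exists>k. W0 \<Omega> p (shifted_product e q (1 - q) \<psi> v) k \<and>
          (AE x in M. k x = shifted_product_grad e q (1 - q) \<psi> g v h x) \<and>
          energy k \<le> B\<xi> * (energy g + energy h)"
        by (rule W0_powr_product[where \<alpha> = q and \<beta> = "1 - q", OF e(2) c]) blast
      \<comment> \<open>A bound for the energies of \<open>\<psi>\<close> and \<open>\<zeta>\<close> together.\<close>
      define E where "E = B' + B\<zeta> * (B' + H)"
      have E: "E \<ge> 0" using B\<zeta> H0 by (simp add: E_def B'_def)
      define \<epsilon>\<^sub>1 where "\<epsilon>\<^sub>1 = \<kappa>' / (6 * (E + 1))"
      have \<epsilon>\<^sub>1: "\<epsilon>\<^sub>1 > 0" using \<kappa>' E by (simp add: \<epsilon>\<^sub>1_def)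
      have \<epsilon>\<^sub>1E: "\<epsilon>\<^sub>1 * E \<le> \<kappa>' / 6"
      proof -
        have "\<epsilon>\<^sub>1 * E \<le> \<epsilon>\<^sub>1 * (E + 1)" using \<epsilon>\<^sub>1 by simp
        also have "\<dots> = \<kappa>' / 6" using E by (simp add: \<epsilon>\<^sub>1_def field_simps)
        finally show ?thesis .
      qed
      \<comment> \<open>A constant with \<open>\<zeta> \<le> L \<psi>\<close>, so that \<open>t \<le> 1 / L\<close> keeps \<open>\<psi> - t \<zeta>\<close> nonnegative.\<close>
      define L where "L = \<theta> * e powr (\<theta> - 1) * Cp"
      have L: "L > 0" using \<theta> e cp by (simp add: L_def)
      obtain t where t: "t > 0" "t \<le> 1 / L" and pert: "\<And>x k :: 'a.
         pflux p x \<bullet> k \<le> pflux p (x - t *\<^sub>R k) \<bullet> k + \<epsilon>\<^sub>1 * (norm x powr p + norm k powr p)"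
        using pflux_perturbation[OF exponent_gt_1 \<epsilon>\<^sub>1, of "1 / L"] L by (metis zero_less_divide_1_iff)
      define \<epsilon> where "\<epsilon> = p * t * (\<kappa>' / 6)"
      have \<epsilon>: "\<epsilon> > 0" "\<epsilon> / (p * t) = \<kappa>' / 6" using exponent_pos t \<kappa>' by (auto simp: \<epsilon>_def)
      obtain \<psi> g where adm: "admissible K \<psi> g" and gB: "energy g \<le> B" and m\<psi>: "mass \<psi> \<ge> \<kappa>"
        and a\<psi>: "(LINT x|M. a x * \<bar>\<psi> x\<bar> powr q) \<ge> 0"
        and nmin: "\<And>w h. admissible K w h \<Longrightarrow> energy g - \<Lambda>' * mass \<psi> \<le> energy h - \<Lambda>' * mass w + \<epsilon>"
        using near[OF \<epsilon>(1)] by blast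
      have W\<psi>: "W0 \<Omega> p \<psi> g" and rng\<phi>: "AE x in M. 0 \<le> \<psi> x \<and> \<psi> x \<le> \<phi> x" and off: "AE x in M. x \<notin> K \<longrightarrow> \<psi> x = 0"
        using adm by (auto simp: admissible_def)
      have rng: "AE x in M. 0 \<le> \<psi> x \<and> \<psi> x \<le> 1" using rng\<phi> \<phi>_range by eventually_elim auto
      define \<zeta> \<xi> where "\<zeta> = shifted_product e \<theta> (p - q) \<psi> v"
        and "\<xi> = shifted_product e q (1 - q) \<psi> v"
      define G where "G x = (\<psi> x + e) powr q - e powr q" for x
      have \<zeta>: "\<zeta> x = ((\<psi> x + e) powr \<theta> - e powr \<theta>) * v x powr (p - q)" for x
        by (simp add: \<zeta>_def shifted_product_def)
      have \<xi>: "\<xi> x = G x * v x powr (1 - q)" for x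
        by (simp add: \<xi>_def G_def shifted_product_def)
      obtain k\<zeta> where k\<zeta>: "W0 \<Omega> p \<zeta> k\<zeta>" "AE x in M. k\<zeta> x = shifted_product_grad e \<theta> (p - q) \<psi> g v h x"
          "energy k\<zeta> \<le> B\<zeta> * (energy g + energy h)"
        using prod\<zeta>[OF W\<psi> rng off v vK] unfolding \<zeta>_def by blast
      obtain k\<xi> where k\<xi>: "W0 \<Omega> p \<xi> k\<xi>" "AE x in M. k\<xi> x = shifted_product_grad e q (1 - q) \<psi> g v h x"
        using prod\<xi>[OF W\<psi> rng off v vK] unfolding \<xi>_def by blast
      have M_space: "AE x in M. x \<in> \<Omega>" by (rule AE_I2) simp
      have [measurable]: "\<psi> \<in> borel_measurable M" "v \<in> borel_measurable M" "\<zeta> \<in> borel_measurable M"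
        using W0_measurable(1)[OF W\<psi>] W0_measurable(1)[OF v] W0_measurable(1)[OF k\<zeta>(1)] by auto
      have [measurable]: "G \<in> borel_measurable M" unfolding G_def by measurable
      have gB': "energy g \<le> B'" using gB by (simp add: B'_def)
      have Gb: "0 \<le> G x \<and> G x \<le> 2 powr q" if "0 \<le> \<psi> x" "\<psi> x \<le> 1" for x
      proof -
        have "e powr q \<le> (\<psi> x + e) powr q" "(\<psi> x + e) powr q \<le> 2 powr q"
          using that e q0 by (auto intro!: powr_mono2)
        moreover have "e powr q \<ge> 0" by simp
        ultimately show ?thesis unfolding G_def by (intro conjI; linarith)
      qed
      have \<zeta>b: "0 \<le> \<zeta> x \<and> \<zeta> x \<le> L * \<psi> x" if "0 \<le> \<psi> x" "x \<in> K \<or> \<psi> x = 0" for x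
      proof (cases "\<psi> x = 0")
        case True
        thus ?thesis by (simp add: \<zeta>)
      next
        case False
        hence "x \<in> K" using that by simp
        have s: "(\<psi> x + e) powr \<theta> - e powr \<theta> \<le> \<theta> * e powr (\<theta> - 1) * \<psi> x"
          by (rule shifted_powr_sublinear) (use \<theta> e that in auto)
        have n: "0 \<le> (\<psi> x + e) powr \<theta> - e powr \<theta>" using that e \<theta> by (simp add: powr_mono2)
        have "v x powr (p - q) \<le> Cp"
          unfolding Cp_def using vK[OF \<open>x \<in> K\<close>] c q_less_p by (intro powr_mono2) auto
        hence "\<zeta> x \<le> (\<theta> * e powr (\<theta> - 1) * \<psi> x) * Cp"
          unfolding \<zeta> using s n by (intro mult_mono) auto
        thus ?thesis using n by (simp add: \<zeta> L_def mult_ac)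
      qed

      \<comment> \<open>The function \<open>J\<close> replaces the flux of \<open>\<psi>\<close> by that of \<open>\<psi> - t \<zeta>\<close>, which occurs in the
        Euler-Lagrange inequality.\<close>
      define J where "J x = pflux p (g x - t *\<^sub>R k\<zeta> x) \<bullet> k\<zeta> x + \<epsilon>\<^sub>1 * (norm (g x) powr p + norm (k\<zeta> x) powr p)" for x
      have \<zeta>t: "AE x in M. 0 \<le> \<zeta> x \<and> t * \<zeta> x \<le> \<psi> x"
        using rng off
      proof eventually_elim
        case (elim x)
        hence z: "0 \<le> \<zeta> x" "\<zeta> x \<le> L * \<psi> x" using \<zeta>b[of x] by auto
        have "t * \<zeta> x \<le> (1 / L) * (L * \<psi> x)" using t z L by (intro mult_mono) auto
        thus ?case using z L by simp
      qed
      note EL = one_sided_euler_lagrange[OF adm nmin k\<zeta>(1) \<zeta>t \<Lambda>'(3) t(1)]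
      have ig: "integrable M (\<lambda>x. norm (g x) powr p)" "integrable M (\<lambda>x. norm (k\<zeta> x) powr p)"
        by (rule LpD(2)[OF W0_Lp(2)[OF W\<psi>]] LpD(2)[OF W0_Lp(2)[OF k\<zeta>(1)]])+
      have Ji: "integrable M J" unfolding J_def[abs_def] using EL(2) ig by simp
      have "(LINT x|M. J x) = (LINT x|M. pflux p (g x - t *\<^sub>R k\<zeta> x) \<bullet> k\<zeta> x) + \<epsilon>\<^sub>1 * (energy g + energy k\<zeta>)"
        unfolding J_def using EL(2) ig by simp
      moreover have "\<epsilon>\<^sub>1 * (energy g + energy k\<zeta>) \<le> \<kappa>' / 6"
      proof -
        have "B\<zeta> * (energy g + energy h) \<le> B\<zeta> * (B' + H)" using B\<zeta> gB' by (intro mult_left_mono) (auto simp: H_def)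
        hence "energy g + energy k\<zeta> \<le> E" using gB' k\<zeta>(3) by (simp add: E_def)
        hence "\<epsilon>\<^sub>1 * (energy g + energy k\<zeta>) \<le> \<epsilon>\<^sub>1 * E" using \<epsilon>\<^sub>1 by (intro mult_left_mono) auto
        thus ?thesis using \<epsilon>\<^sub>1E by linarith
      qed
      ultimately have J_le: "(LINT x|M. J x) \<le> \<Lambda>' * (LINT x|M. m x * (\<psi> x powr (p - 1) * \<zeta> x)) + \<kappa>' / 3"
        using EL(1) \<epsilon>(2) by linarith
      define X where "X = (LINT x|M. m x * (G x * v x powr (p - q)))"
      have Gv_int: "integrable M (\<lambda>x. m x * (G x * v x powr (p - q)))"
      proof (rule integrable_mult_AE_bounded[OF m_integrable])
        show "AE x in M. \<bar>G x * v x powr (p - q)\<bar> \<le> 2 powr q * Cp"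
          using rng off
        proof eventually_elim
          case (elim x)
          show ?case
          proof (cases "x \<in> K")
            case True
            have "v x powr (p - q) \<le> Cp"
              unfolding Cp_def using vK[OF True] c q_less_p by (intro powr_mono2) auto
            thus ?thesis unfolding abs_mult using Gb[of x] elim by (intro mult_mono) auto
          next
            case False
            hence "G x = 0" using elim by (simp add: G_def)
            thus ?thesis using cp by simp
          qed
        qed
      qed measurable
      have "(LINT x|M. m x * (\<psi> x powr (p - 1) * \<zeta> x)) \<le> (LINT x|M. m x * (G x * v x powr (p - q)) + e powr q * Cp * m x)"
      proof (rule integral_mono_AE)
        show "integrable M (\<lambda>x. m x * (\<psi> x powr (p - 1) * \<zeta> x))"
        proof (rule integrable_mult_AE_bounded[OF m_integrable])
          show "AE x in M. \<bar>\<psi> x powr (p - 1) * \<zeta> x\<bar> \<le> 1 * (1 / t)"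
            using rng \<zeta>t
          proof eventually_elim
            case (elim x)
            have "\<psi> x powr (p - 1) \<le> 1 powr (p - 1)" using elim exponent_gt_1 by (intro powr_mono2) auto
            moreover have "\<zeta> x \<le> 1 / t" using elim t(1) by (simp add: pos_le_divide_eq mult.commute)
            ultimately show ?case unfolding abs_mult using elim t(1) by (intro mult_mono) auto
          qed
        qed measurable
        show "integrable M (\<lambda>x. m x * (G x * v x powr (p - q)) + e powr q * Cp * m x)"
          using Gv_int m_integrable by simp
        show "AE x in M. m x * (\<psi> x powr (p - 1) * \<zeta> x) \<le> m x * (G x * v x powr (p - q)) + e powr q * Cp * m x"
          using rng off m_nonneg
        proof eventually_elim
          case (elim x)
          have "\<psi> x powr (p - 1) * \<zeta> x \<le> G x * v x powr (p - q) + e powr q * Cp"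
          proof (cases "x \<in> K")
            case True
            have vC: "v x powr (p - q) \<le> Cp"
              unfolding Cp_def using vK[OF True] c q_less_p by (intro powr_mono2) auto
            have "\<psi> x powr (p - 1) * ((\<psi> x + e) powr \<theta> - e powr \<theta>) \<le> (\<psi> x + e) powr (p - 1) * (\<psi> x + e) powr \<theta>"
              using elim e exponent_gt_1 \<theta> by (intro mult_mono powr_mono2) (auto simp: powr_mono2)
            also have "\<dots> = (\<psi> x + e) powr q" by (simp add: \<theta>_def flip: powr_add)
            also have "\<dots> = G x + e powr q" by (simp add: G_def)
            finally have "\<psi> x powr (p - 1) * ((\<psi> x + e) powr \<theta> - e powr \<theta>) * v x powr (p - q)
                \<le> (G x + e powr q) * v x powr (p - q)" by (rule mult_right_mono) simp
            also have "\<dots> \<le> G x * v x powr (p - q) + e powr q * Cp"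
              using vC by (simp add: distrib_right mult_left_mono)
            finally show ?thesis by (simp add: \<zeta> mult_ac)
          next
            case False
            thus ?thesis using elim cp by (simp add: G_def)
          qed
          from mult_left_mono[OF this, of "m x"] show ?case using elim by (simp add: algebra_simps)
        qed
      qed
      also have "\<dots> = X + e powr q * (Cp * Im)"
        using Gv_int m_integrable by (simp add: X_def Im_def)
      finally have m\<zeta>_le: "(LINT x|M. m x * (\<psi> x powr (p - 1) * \<zeta> x)) \<le> X + e powr q * (Cp * Im)" .

      \<comment> \<open>Since \<open>0 \<le> \<psi> \<le> 1\<close>, the power with the smaller exponent \<open>q\<close> dominates the one with \<open>p\<close>, which
        brings in the mass of \<open>\<psi>\<close>. In \<open>Y\<close>, \<open>G\<close> differs from \<open>\<psi>\<^sup>q\<close> by a multiple of \<open>e\<close> only.\<close>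
      have "cp * (mass \<psi> - e powr q * Im) = (LINT x|M. cp * (m x * \<bar>\<psi> x\<bar> powr p - e powr q * m x))"
        using mass_integrable[of \<psi> 1] below_\<phi>(2)[OF rng\<phi>] m_integrable by (simp add: Im_def)
      also have "\<dots> \<le> X"
        unfolding X_def
      proof (rule integral_mono_AE)
        show "integrable M (\<lambda>x. cp * (m x * \<bar>\<psi> x\<bar> powr p - e powr q * m x))"
          using mass_integrable[of \<psi> 1] below_\<phi>(2)[OF rng\<phi>] m_integrable by simp
        show "AE x in M. cp * (m x * \<bar>\<psi> x\<bar> powr p - e powr q * m x) \<le> m x * (G x * v x powr (p - q))"
          using rng off m_nonneg
        proof eventually_elim
          case (elim x)
          have "cp * (\<psi> x powr p - e powr q) \<le> G x * v x powr (p - q)"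
          proof (cases "x \<in> K")
            case True
            have "\<psi> x powr p \<le> \<psi> x powr q" using elim q_less_p by (intro powr_mono') auto
            moreover have "\<psi> x powr q \<le> (\<psi> x + e) powr q" using elim e q0 by (intro powr_mono2) auto
            ultimately have "cp * (\<psi> x powr p - e powr q) \<le> cp * G x"
              using cp by (intro mult_left_mono) (auto simp: G_def)
            also have "\<dots> \<le> v x powr (p - q) * G x"
              unfolding cp_def using vK[OF True] c q_less_p Gb[of x] elim
              by (intro mult_right_mono powr_mono2) auto
            finally show ?thesis by (simp add: mult.commute)
          next
            case False
            thus ?thesis using elim cp by (simp add: G_def)
          qed
          from mult_left_mono[OF this, of "m x"] show ?case using elim by (simp add: algebra_simps)
        qed
      qed (rule Gv_int)
      finally have "cp * (mass \<psi> - e powr q * Im) \<le> X" .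
      moreover have "cp * (\<kappa> - e powr q * Im) \<le> cp * (mass \<psi> - e powr q * Im)"
        using m\<psi> cp by simp
      ultimately have X_ge: "cp * \<kappa> - cp * (e powr q * Im) \<le> X"
        by (simp add: right_diff_distrib)
      define Y where "Y = (LINT x|M. a x * G x)"
      have a\<psi>_int: "integrable M (\<lambda>x. a x * \<bar>\<psi> x\<bar> powr q)"
      proof (rule integrable_mult_AE_bounded[OF a_integrable])
        show "AE x in M. \<bar>\<bar>\<psi> x\<bar> powr q\<bar> \<le> 1 powr q"
          using rng by eventually_elim (use q0 in \<open>auto intro!: powr_mono2 simp del: powr_one_eq_one\<close>)
      qed measurable
      have aG_int: "integrable M (\<lambda>x. a x * G x)"
      proof (rule integrable_mult_AE_bounded[OF a_integrable])
        show "AE x in M. \<bar>G x\<bar> \<le> 2 powr q"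
          using rng by eventually_elim (use Gb in auto)
      qed measurable
      have "(LINT x|M. a x * \<bar>\<psi> x\<bar> powr q - Dq * e * \<bar>a x\<bar>) \<le> Y"
        unfolding Y_def
      proof (rule integral_mono_AE)
        show "AE x in M. a x * \<bar>\<psi> x\<bar> powr q - Dq * e * \<bar>a x\<bar> \<le> a x * G x"
          using rng
        proof eventually_elim
          case (elim x)
          have "\<bar>G x - \<psi> x powr q\<bar> \<le> Dq * e"
            unfolding G_def Dq_def by (rule shifted_powr_close) (use elim e q_gt_1 in auto)
          hence "\<bar>a x\<bar> * \<bar>G x - \<psi> x powr q\<bar> \<le> \<bar>a x\<bar> * (Dq * e)" by (intro mult_left_mono) auto
          hence "\<bar>a x * G x - a x * \<psi> x powr q\<bar> \<le> Dq * e * \<bar>a x\<bar>"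
            by (simp only: abs_mult[symmetric] right_diff_distrib mult_ac)
          thus ?case using elim by (simp add: abs_le_iff)
        qed
      qed (use a\<psi>_int aG_int a_integrable in auto)
      moreover have "(LINT x|M. a x * \<bar>\<psi> x\<bar> powr q - Dq * e * \<bar>a x\<bar>) = (LINT x|M. a x * \<bar>\<psi> x\<bar> powr q) - Dq * e * Ia"
        using a\<psi>_int a_integrable by (simp add: Ia_def)
      ultimately have Y_ge: "- (Dq * e * Ia) \<le> Y" using a\<psi> by linarith

      \<comment> \<open>The test function \<open>\<xi>\<close> cancels one power of \<open>v\<close> completely, so that \<open>\<eta>\<close> multiplies an
        integral of \<open>a\<close> whose sign does not depend on \<open>v\<close>.\<close>
      have "(LINT x|M. pflux p (h x) \<bullet> k\<xi> x) \<ge> \<Lambda> * (LINT x|M. m x * (v x powr (p - 1) * \<xi> x))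
          + \<eta> * (LINT x|M. a x * (v x powr (q - 1) * \<xi> x))"
      proof -
        have "AE x in M. x \<notin> K \<longrightarrow> \<xi> x = 0" using off by eventually_elim (simp add: \<xi> G_def)
        moreover have "AE x in M. 0 \<le> \<xi> x"
          using rng by eventually_elim (use Gb in \<open>auto simp: \<xi>\<close>)
        ultimately show ?thesis using super k\<xi>(1) unfolding weak_supersolution_on_def by blast
      qed
      moreover have "(LINT x|M. m x * (v x powr (p - 1) * \<xi> x)) = X"
        unfolding X_def
      proof (rule Bochner_Integration.integral_cong[OF refl])
        fix x assume "x \<in> space M"
        hence "0 < v x" using vpos by simp
        hence "v x powr (p - 1) * v x powr (1 - q) = v x powr (p - q)" by (simp flip: powr_add)
        thus "m x * (v x powr (p - 1) * \<xi> x) = m x * (G x * v x powr (p - q))"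
          by (simp add: \<xi> mult.left_commute)
      qed
      moreover have "(LINT x|M. a x * (v x powr (q - 1) * \<xi> x)) = Y"
        unfolding Y_def
      proof (rule Bochner_Integration.integral_cong[OF refl])
        fix x assume "x \<in> space M"
        hence "0 < v x" using vpos by simp
        hence "v x powr (q - 1) * v x powr (1 - q) = 1" by (simp flip: powr_add)
        thus "a x * (v x powr (q - 1) * \<xi> x) = a x * G x"
          by (simp add: \<xi> mult.left_commute)
      qed
      ultimately have eqn: "\<Lambda> * X + \<eta> * Y \<le> (LINT x|M. pflux p (h x) \<bullet> k\<xi> x)" by simp
      have "(LINT x|M. pflux p (h x) \<bullet> k\<xi> x) \<le> (LINT x|M. J x)
          + (q - 1) * c powr (- q) * e powr q * energy h
          + (p - q) * c powr (p - q - 1) * e powr (q - p + 1) * (energy g + energy h)"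
      proof (rule picone_energy_estimate[OF W\<psi> rng off v _ c(1) e(2) k\<xi> k\<zeta>(1) _ Ji])
        show "AE x in M. k\<zeta> x = shifted_product_grad e (q - p + 1) (p - q) \<psi> g v h x"
          using k\<zeta>(2) unfolding \<theta>_def .
        show "pflux p (g x) \<bullet> k\<zeta> x \<le> J x" for x using pert[of "g x" "k\<zeta> x"] by (simp add: J_def)
      qed (use vK in auto)
      also have "(p - q) * c powr (p - q - 1) * e powr (q - p + 1) * (energy g + energy h)
          \<le> (p - q) * c powr (p - q - 1) * e powr \<theta> * (B' + H)"
        unfolding \<theta>_def H_def using gB' q_less_p by (intro mult_left_mono) auto
      finally have upper: "(LINT x|M. pflux p (h x) \<bullet> k\<xi> x) \<le> (LINT x|M. J x)
          + (q - 1) * c powr (- q) * e powr q * H + (p - q) * c powr (p - q - 1) * e powr \<theta> * (B' + H)"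
        by (simp add: H_def)
      have "\<Lambda>' * (LINT x|M. m x * (\<psi> x powr (p - 1) * \<zeta> x)) \<le> \<Lambda>' * X + \<Lambda>' * (e powr q * (Cp * Im))"
        using mult_left_mono[OF m\<zeta>_le \<Lambda>'(3)] by (simp add: distrib_left)
      moreover have "(\<Lambda> - \<Lambda>') * (cp * \<kappa>) - (\<Lambda> - \<Lambda>') * (cp * (e powr q * Im)) \<le> \<Lambda> * X - \<Lambda>' * X"
        using mult_left_mono[OF X_ge, of "\<Lambda> - \<Lambda>'"] \<Lambda>'(2) by (simp add: right_diff_distrib left_diff_distrib)
      moreover have "- (\<eta> * (Dq * e * Ia)) \<le> \<eta> * Y"
        using mult_left_mono[OF Y_ge \<eta>] by simp
      ultimately have "(\<Lambda> - \<Lambda>') * (cp * \<kappa>) \<le> err e + \<kappa>' / 3"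
        using eqn upper J_le unfolding err_def by linarith
      thus False using e(1) \<kappa>' by (simp add: \<kappa>'_def)
    qed
  qed
qed

end

theorem theorem2p13:
  fixes \<Omega> :: "'a::euclidean_space set"
    and p q \<gamma> lam :: real
    and m a \<phi>\<^sub>1 :: "'a \<Rightarrow> real"
  assumes domain: "bounded_domain \<Omega>"
    and boundary: "DIM('a) \<ge> 2 \<Longrightarrow> C11_boundary \<Omega>"
    and exponents: "1 < q" "q < p"
    and gamma: "\<gamma> > real DIM('a)"
    and weights: "m \<in> Lp_space \<Omega> \<gamma>" "a \<in> Lp_space \<Omega> \<gamma>"
    and m_pos_part: "\<not> (AE x in lebesgue_on \<Omega>. max (m x) 0 = 0)"
    and a_nonzero: "\<not> (AE x in lebesgue_on \<Omega>. a x = 0)"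
    and m_nonneg: "AE x in lebesgue_on \<Omega>. m x \<ge> 0"
    and eigenfunction: "first_eigenfunction \<Omega> p m \<phi>\<^sub>1"
    and a_phi: "(LINT x|lebesgue_on \<Omega>. a x * \<phi>\<^sub>1 x powr q) > 0"
    and pq: "\<And>s::real. s \<ge> 0 \<Longrightarrow>
      (q - 1) * s powr p + q * s powr (p - 1) - (p - q) * s + (q - p + 1) \<ge> 0"
    and lambda: "lam > lambda1 \<Omega> p m"
  shows "\<exists>f\<in>C0_inf \<Omega>. (\<exists>x\<in>\<Omega>. f x \<noteq> 0) \<and> (\<forall>x\<in>\<Omega>. f x \<ge> 0) \<and>
    (\<forall>\<eta>\<ge>0. (\<nexists>u. is_positive_solution \<Omega> p q m a lam \<eta> f u) \<and>
            (\<nexists>u. is_negative_solution \<Omega> p q m a lam \<eta> f u))"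
proof -
  have \<Omega>: "open \<Omega>" "bounded \<Omega>" "connected \<Omega>" "\<Omega> \<noteq> {}" using domain by (auto simp: bounded_domain_def)
  have p1: "1 < p" using exponents by simp
  interpret bounded_open \<Omega> p by unfold_locales (use \<Omega> p1 in auto)
  have \<gamma>1: "1 \<le> \<gamma>"
  proof -
    have "real DIM('a) \<ge> 1" using DIM_positive[where 'a = 'a] by linarith
    thus ?thesis using gamma by linarith
  qed
  have m_int: "integrable M m" and a_int: "integrable M a"
    using weights by (auto simp: Lp_space_def Lp_def intro!: Lp_imp_integrable[OF finite_M \<gamma>1])
  define D where "D = weak_grad \<Omega> \<phi>\<^sub>1"
  have W: "W0 \<Omega> p \<phi>\<^sub>1 D"
    unfolding D_def by (rule W01p_imp_W0) (use eigenfunction in \<open>simp add: first_eigenfunction_def\<close>)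
  have mass: "(LINT x|M. m x * \<bar>\<phi>\<^sub>1 x\<bar> powr p) > 0"
    and ratio: "(LINT x|M. norm (D x) powr p) / (LINT x|M. m x * \<bar>\<phi>\<^sub>1 x\<bar> powr p) = lambda1 \<Omega> p m"
    and nonneg: "AE x in M. \<phi>\<^sub>1 x \<ge> 0" and sup: "esssup M (\<lambda>x. ereal \<bar>\<phi>\<^sub>1 x\<bar>) = 1"
    using eigenfunction by (auto simp: first_eigenfunction_def D_def)
  have rng: "AE x in M. 0 \<le> \<phi>\<^sub>1 x \<and> \<phi>\<^sub>1 x \<le> 1"
    using nonneg esssup_AE[of "\<lambda>x. ereal \<bar>\<phi>\<^sub>1 x\<bar>" M] unfolding sup by eventually_elim (simp add: one_ereal_def)
  have minimal: "lambda1 \<Omega> p m * (LINT x|M. m x * \<bar>u x\<bar> powr p) \<le> (LINT x|M. norm (g x) powr p)"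
    if u: "W0 \<Omega> p u g" for u g
  proof (cases "(LINT x|M. m x * \<bar>u x\<bar> powr p) > 0")
    case True
    let ?S = "{(LINT x|lebesgue_on \<Omega>. norm (weak_grad \<Omega> u x) powr p)
            / (LINT x|lebesgue_on \<Omega>. m x * \<bar>u x\<bar> powr p) | u.
          u \<in> W01p \<Omega> p \<and> (LINT x|lebesgue_on \<Omega>. m x * \<bar>u x\<bar> powr p) > 0}"
    have "bdd_below ?S"
    proof (rule bdd_belowI[of _ 0])
      fix y assume "y \<in> ?S"
      thus "0 \<le> y" by (auto intro!: divide_nonneg_pos Bochner_Integration.integral_nonneg)
    qed
    moreover have "(LINT x|M. norm (weak_grad \<Omega> u x) powr p) / (LINT x|M. m x * \<bar>u x\<bar> powr p) \<in> ?S"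
      using W0_imp_W01p(1)[OF u] True by blast
    ultimately have "lambda1 \<Omega> p m \<le> (LINT x|M. norm (weak_grad \<Omega> u x) powr p) / (LINT x|M. m x * \<bar>u x\<bar> powr p)"
      unfolding lambda1_def by (intro cInf_lower)
    also have "(LINT x|M. norm (weak_grad \<Omega> u x) powr p) = (LINT x|M. norm (g x) powr p)"
      by (rule energy_cong[OF u W0_imp_W01p(2)[OF u]])
    finally show ?thesis using True by (simp add: pos_le_divide_eq)
  next
    case False
    moreover have "(LINT x|M. m x * \<bar>u x\<bar> powr p) \<ge> 0"
      by (rule integral_nonneg_AE) (use m_nonneg in \<open>auto elim!: eventually_mono\<close>)
    ultimately have "(LINT x|M. m x * \<bar>u x\<bar> powr p) = 0" by simp
    moreover have "(LINT x|M. norm (g x) powr p) \<ge> 0"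
      by (rule Bochner_Integration.integral_nonneg) auto
    ultimately show ?thesis by simp
  qed
  have a_pos: "(LINT x|M. a x * \<bar>\<phi>\<^sub>1 x\<bar> powr q) > 0"
  proof -
    note [measurable] = W0_measurable(1)[OF W] borel_measurable_integrable[OF a_int]
    have "(LINT x|M. a x * \<bar>\<phi>\<^sub>1 x\<bar> powr q) = (LINT x|M. a x * \<phi>\<^sub>1 x powr q)"
      by (rule integral_cong_AE) (measurable, use nonneg in \<open>auto elim!: eventually_mono\<close>)
    thus ?thesis using a_phi by simp
  qed
  interpret nonexistence \<Omega> p m \<phi>\<^sub>1 D "lambda1 \<Omega> p m" q a
  proof
    show "(LINT x|M. norm (D x) powr p) = lambda1 \<Omega> p m * (LINT x|M. m x * \<bar>\<phi>\<^sub>1 x\<bar> powr p)"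
      using ratio mass by (simp add: field_simps)
  qed (fact m_int m_nonneg W rng mass minimal exponents pq a_int a_pos)+
  obtain K where K: "compact K" "K \<subseteq> \<Omega>" and none:
    "\<And>\<eta> v h. 0 \<le> \<eta> \<Longrightarrow> W0 \<Omega> p v h \<Longrightarrow> continuous_on \<Omega> v \<Longrightarrow> (\<And>x. x \<in> \<Omega> \<Longrightarrow> 0 < v x) \<Longrightarrow>
       \<not> weak_supersolution_on K lam \<eta> v h"
    by (rule no_positive_supersolution[OF lambda]) blast
  have "\<Omega> \<noteq> K"
  proof
    assume "\<Omega> = K"
    hence "closed \<Omega>" using K(1) by (simp add: compact_imp_closed)
    hence "\<Omega> = UNIV" using \<Omega> clopen by blast
    thus False using \<Omega>(2) not_bounded_UNIV by simp
  qed
  then obtain x\<^sub>0 where x\<^sub>0: "x\<^sub>0 \<in> \<Omega> - K" using K(2) by blast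
  have "open (\<Omega> - K)" using \<Omega>(1) K(1) by (intro open_Diff compact_imp_closed)
  then obtain r where r: "r > 0" "cball x\<^sub>0 r \<subseteq> \<Omega> - K" using x\<^sub>0 open_contains_cball by blast
  define f where "f = bump r x\<^sub>0"
  have f_C0: "f \<in> C0_inf \<Omega>" unfolding f_def by (rule bump_in_C0_inf) (use r in auto)
  have f_pos: "f x\<^sub>0 > 0" unfolding f_def using bump_pos_iff[OF r(1), of x\<^sub>0 x\<^sub>0] r(1) by simp
  have f_nonneg: "f x \<ge> 0" for x unfolding f_def by (rule bump_nonneg)
  have f_K: "f x = 0" if "x \<in> K" for x
  proof -
    have "x \<notin> cball x\<^sub>0 r" using that r(2) by blast
    thus ?thesis unfolding f_def by (intro bump_eq_0[OF r(1)]) (simp add: dist_norm norm_minus_commute)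
  qed
  \<comment> \<open>The factor \<open>s\<close> is \<open>1\<close> for positive and \<open>-1\<close> for negative solutions.\<close>
  have none_sgn: False if \<eta>: "\<eta> \<ge> 0" and sol: "is_solution \<Omega> p q m a lam \<eta> f u" and uc: "continuous_on \<Omega> u"
    and s: "\<bar>s\<bar> = 1" and sgn: "\<And>x. x \<in> \<Omega> \<Longrightarrow> 0 < s * u x" for \<eta> u s
  proof -
    define h where "h = weak_grad \<Omega> u"
    have u: "W0 \<Omega> p u h"
      unfolding h_def by (rule W01p_imp_W0) (use sol in \<open>simp add: is_solution_def\<close>)
    have v: "W0 \<Omega> p (\<lambda>x. s * u x) (\<lambda>x. s *\<^sub>R h x)"
      using W0_linear[OF u u, of s 0] by simp
    have ss: "s * s = 1" "s = 1 \<or> s = - 1" using s by (auto simp: abs_if split: if_splits)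
    have "weak_supersolution_on K lam \<eta> (\<lambda>x. s * u x) (\<lambda>x. s *\<^sub>R h x)"
      unfolding weak_supersolution_on_def
    proof (intro allI impI)
      fix \<xi> k assume \<xi>: "W0 \<Omega> p \<xi> k" and off: "AE x in M. x \<notin> K \<longrightarrow> \<xi> x = 0"
      note \<xi>W = W0_imp_W01p[OF \<xi>]
      have eq: "(LINT x|M. pflux p (h x) \<bullet> weak_grad \<Omega> \<xi> x) = lam * (LINT x|M. m x * \<bar>u x\<bar> powr (p - 2) * u x * \<xi> x)
          + \<eta> * (LINT x|M. a x * \<bar>u x\<bar> powr (q - 2) * u x * \<xi> x) + (LINT x|M. f x * \<xi> x)"
        using sol \<xi>W(1) unfolding is_solution_def h_def pflux_def by simp
      have f0: "(LINT x|M. f x * \<xi> x) = 0"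
      proof -
        have "AE x in M. f x * \<xi> x = 0" using off by eventually_elim (use f_K in auto)
        thus ?thesis by (rule integral_eq_zero_AE)
      qed
      have pw: "\<bar>u x\<bar> powr (\<alpha> - 2) * u x = s * (s * u x) powr (\<alpha> - 1)" if "x \<in> \<Omega>" for x \<alpha>
      proof -
        have pos: "0 < s * u x" using sgn that by simp
        have "\<bar>u x\<bar> = s * u x" "u x = s * (s * u x)" using pos ss by auto
        moreover have "(s * u x) powr (\<alpha> - 2) * (s * u x) = (s * u x) powr (\<alpha> - 1)"
          using pos powr_add[of "s * u x" "\<alpha> - 2" 1] by simp
        ultimately show ?thesis by (metis mult.left_commute)
      qed
      have lower: "(LINT x|M. b x * \<bar>u x\<bar> powr (\<alpha> - 2) * u x * \<xi> x) = s * (LINT x|M. b x * ((s * u x) powr (\<alpha> - 1) * \<xi> x))" for b \<alpha>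
      proof -
        have "(LINT x|M. b x * \<bar>u x\<bar> powr (\<alpha> - 2) * u x * \<xi> x) = (LINT x|M. s * (b x * ((s * u x) powr (\<alpha> - 1) * \<xi> x)))"
          by (rule Bochner_Integration.integral_cong[OF refl]) (use pw in \<open>simp add: mult_ac\<close>)
        thus ?thesis by simp
      qed
      have flux: "(LINT x|M. pflux p (h x) \<bullet> weak_grad \<Omega> \<xi> x) = s * (LINT x|M. pflux p (s *\<^sub>R h x) \<bullet> k x)"
      proof -
        have "(LINT x|M. pflux p (h x) \<bullet> weak_grad \<Omega> \<xi> x) = (LINT x|M. pflux p (h x) \<bullet> k x)"
          by (rule flux_cong[OF u \<xi> \<xi>W(2)])
        also have "\<dots> = (LINT x|M. s * (pflux p (s *\<^sub>R h x) \<bullet> k x))"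
          using ss by (intro Bochner_Integration.integral_cong[OF refl]) (auto simp: pflux_uminus)
        finally show ?thesis by simp
      qed
      have "s * (LINT x|M. pflux p (s *\<^sub>R h x) \<bullet> k x)
          = s * (lam * (LINT x|M. m x * ((s * u x) powr (p - 1) * \<xi> x)) + \<eta> * (LINT x|M. a x * ((s * u x) powr (q - 1) * \<xi> x)))"
        using eq unfolding f0 lower flux by (simp only: distrib_left mult.left_commute[of s] add_0_right)
      moreover have "s \<noteq> 0" using s by auto
      ultimately show "lam * (LINT x|M. m x * ((s * u x) powr (p - 1) * \<xi> x)) + \<eta> * (LINT x|M. a x * ((s * u x) powr (q - 1) * \<xi> x))
          \<le> (LINT x|M. pflux p (s *\<^sub>R h x) \<bullet> k x)" by simp
    qed
    moreover have "continuous_on \<Omega> (\<lambda>x. s * u x)" using uc by (intro continuous_intros)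
    ultimately show False using none[OF \<eta> v] sgn by blast
  qed
  have "\<nexists>u. is_positive_solution \<Omega> p q m a lam \<eta> f u" "\<nexists>u. is_negative_solution \<Omega> p q m a lam \<eta> f u"
    if "\<eta> \<ge> 0" for \<eta>
    using none_sgn[OF that, of _ 1] none_sgn[OF that, of _ "- 1"]
    by (auto simp: is_positive_solution_def is_negative_solution_def)
  thus ?thesis
    using f_C0 f_pos f_nonneg x\<^sub>0 by (intro bexI[of _ f]) (auto intro!: bexI[of _ x\<^sub>0])
qed

end
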